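(* Let $h\in\mathbb R[x_1,\ldots,x_n]$ be irreducible, homogeneous and hyperbolic in direction $e\in\mathbb R^n$. If $-1\notin\Sigma^2\mathcal A_e(h)$, then $\Lambda_e(h)$ is spectrahedral, i.e. there are hermitian matrices $M_1,\ldots,M_n$ (of some size) with $\Lambda_e(h)=\{a\in\mathbb R^n: a_1M_1+\cdots+a_nM_n\succeq 0\}$.
   Context: A homogeneous polynomial $h\in\mathbb R[x]$ is hyperbolic in direction $e\in\mathbb R^n$ if $h(e)\neq0$ and for every $a\in\mathbb R^n$ the polynomial $h_{a,e}(t):=h(a-te)$ has only real roots. The hyperbolicity cone is $\Lambda_e(h)=\{a\in\mathbb R^n: h_{a,e}(t)\text{ has only nonnegative roots}\}$. For $a\in\mathbb R^n$ write $a\bullet z=a_1z_1+\cdots+a_nz_n$. Let $\mathbb C\langle z\rangle=\mathbb C\langle z_1,\ldots,z_n\rangle$ be the free noncommutative unital algebra with the involution determined by $z_i^*=z_i$. Let $J_e(h)$ be the two-sided ideal generated by all $h_{a,e}(a\bullet z)$, $a\in\mathbb R^n$, together with $1-e\bullet z$, and $\mathcal A_e(h)=\mathbb C\langle z\rangle/J_e(h)$ (a unital $*$-algebra). $\Sigma^2\mathcal A_e(h)$ is the set of finite sums $\sum_i a_i^*a_i$, $a_i\in\mathcal A_e(h)$. *)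

theory Defs
  imports "HOL-Analysis.Analysis" "HOL-Library.Poly_Mapping" "HOL-Library.Function_Algebras"
    "HOL-Computational_Algebra.Polynomial" "HOL-Computational_Algebra.Factorial_Ring"
begin

text \<open>R[x] is the ring of finitely supported maps from monomials to reals (monomials = exponent vectors);
  it is a comm_ring_1, so the library notion irreducible applies.\<close>

type_synonym 'n mpoly = "('n \<Rightarrow>\<^sub>0 nat) \<Rightarrow>\<^sub>0 real"

definition mpoly_eval :: "'n::finite mpoly \<Rightarrow> real^'n \<Rightarrow> real" where
  "mpoly_eval h a = (\<Sum>m\<in>Poly_Mapping.keys h. Poly_Mapping.lookup h m * (\<Prod>i\<in>UNIV. (a $ i) ^ Poly_Mapping.lookup m i))"

definition homogeneous :: "'n::finite mpoly \<Rightarrow> bool" where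
  "homogeneous h \<longleftrightarrow> (\<exists>d. \<forall>m\<in>Poly_Mapping.keys h. (\<Sum>i\<in>UNIV. Poly_Mapping.lookup m i) = d)"

definition hae :: "'n::finite mpoly \<Rightarrow> real^'n \<Rightarrow> real^'n \<Rightarrow> real poly" where
  "hae h e a = (\<Sum>m\<in>Poly_Mapping.keys h. [:Poly_Mapping.lookup h m:] * (\<Prod>i\<in>UNIV. [:a $ i, - (e $ i):] ^ Poly_Mapping.lookup m i))"

definition only_real_roots :: "real poly \<Rightarrow> bool" where
  "only_real_roots p \<longleftrightarrow> (\<forall>z::complex. poly (map_poly complex_of_real p) z = 0 \<longrightarrow> z \<in> \<real>)"

definition hyperbolic :: "'n::finite mpoly \<Rightarrow> real^'n \<Rightarrow> bool" where
  "hyperbolic h e \<longleftrightarrow> mpoly_eval h e \<noteq> 0 \<and> (\<forall>a. only_real_roots (hae h e a))"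

definition hyp_cone :: "'n::finite mpoly \<Rightarrow> real^'n \<Rightarrow> (real^'n) set" where
  "hyp_cone h e = {a. \<forall>z::complex. poly (map_poly complex_of_real (hae h e a)) z = 0
                        \<longrightarrow> z \<in> \<real> \<and> 0 \<le> Re z}"

text \<open>Elements: finitely supported functions from words ('n list) to complex numbers.\<close>
type_synonym 'n ncpoly = "'n list \<Rightarrow> complex"

definition nc_fin :: "'n ncpoly \<Rightarrow> bool" where
  "nc_fin p \<longleftrightarrow> finite {w. p w \<noteq> 0}"

definition nc_mul :: "'n ncpoly \<Rightarrow> 'n ncpoly \<Rightarrow> 'n ncpoly" where
  "nc_mul p q = (\<lambda>w. \<Sum>k\<le>length w. p (take k w) * q (drop k w))"

definition nc_one :: "'n ncpoly" where
  "nc_one = (\<lambda>w. if w = [] then 1 else 0)"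

definition nc_var :: "'n \<Rightarrow> 'n ncpoly" where
  "nc_var i = (\<lambda>w. if w = [i] then 1 else 0)"

text \<open>Involution: conjugate-linear anti-automorphism with z_i^* = z_i.\<close>
definition nc_star :: "'n ncpoly \<Rightarrow> 'n ncpoly" where
  "nc_star p = (\<lambda>w. cnj (p (rev w)))"

definition nc_smult :: "complex \<Rightarrow> 'n ncpoly \<Rightarrow> 'n ncpoly" where
  "nc_smult c p = (\<lambda>w. c * p w)"

primrec nc_pow :: "'n ncpoly \<Rightarrow> nat \<Rightarrow> 'n ncpoly" where
  "nc_pow x 0 = nc_one"
| "nc_pow x (Suc k) = nc_mul x (nc_pow x k)"

definition nc_lin :: "real^'n::finite \<Rightarrow> 'n ncpoly" where
  "nc_lin a = (\<Sum>i\<in>UNIV. nc_smult (complex_of_real (a $ i)) (nc_var i))"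

definition nc_polyeval :: "real poly \<Rightarrow> 'n ncpoly \<Rightarrow> 'n ncpoly" where
  "nc_polyeval p x = (\<Sum>k\<le>degree p. nc_smult (complex_of_real (coeff p k)) (nc_pow x k))"

inductive_set nc_ideal :: "'n ncpoly set \<Rightarrow> 'n ncpoly set" for G where
  zero: "(\<lambda>_. 0) \<in> nc_ideal G"
| gen: "g \<in> G \<Longrightarrow> nc_fin u \<Longrightarrow> nc_fin v \<Longrightarrow> nc_mul (nc_mul u g) v \<in> nc_ideal G"
| add: "x \<in> nc_ideal G \<Longrightarrow> y \<in> nc_ideal G \<Longrightarrow> x + y \<in> nc_ideal G"

definition J_gens :: "'n::finite mpoly \<Rightarrow> real^'n \<Rightarrow> 'n ncpoly set" where
  "J_gens h e = {nc_polyeval (hae h e a) (nc_lin a) | a. True} \<union> {nc_one - nc_lin e}"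

definition J :: "'n::finite mpoly \<Rightarrow> real^'n \<Rightarrow> 'n ncpoly set" where
  "J h e = nc_ideal (J_gens h e)"

text \<open>-1 is a sum of hermitian squares in A_e(h) = C<z>/J_e(h):
  there are p_1..p_k in C<z> with -1 - sum p_i^* p_i in J_e(h).\<close>
definition minus_one_SOS :: "'n::finite mpoly \<Rightarrow> real^'n \<Rightarrow> bool" where
  "minus_one_SOS h e \<longleftrightarrow> (\<exists>ps. (\<forall>p\<in>set ps. nc_fin p) \<and>
      (- nc_one - sum_list (map (\<lambda>p. nc_mul (nc_star p) p) ps)) \<in> J h e)"

definition hermitian_mat :: "nat \<Rightarrow> (nat \<Rightarrow> nat \<Rightarrow> complex) \<Rightarrow> bool" where
  "hermitian_mat m M \<longleftrightarrow> (\<forall>i<m. \<forall>j<m. M i j = cnj (M j i))"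

definition psd_mat :: "nat \<Rightarrow> (nat \<Rightarrow> nat \<Rightarrow> complex) \<Rightarrow> bool" where
  "psd_mat m A \<longleftrightarrow> hermitian_mat m A \<and>
     (\<forall>v::nat \<Rightarrow> complex. let q = (\<Sum>i<m. \<Sum>j<m. cnj (v i) * A i j * v j) in q \<in> \<real> \<and> 0 \<le> Re q)"

definition spectrahedral :: "(real^'n::finite) set \<Rightarrow> bool" where
  "spectrahedral C \<longleftrightarrow> (\<exists>m (M :: 'n \<Rightarrow> nat \<Rightarrow> nat \<Rightarrow> complex).
      (\<forall>i. hermitian_mat m (M i)) \<and>
      C = {a. psd_mat m (\<lambda>r c. \<Sum>i\<in>UNIV. complex_of_real (a $ i) * M i r c)})"

end

theory Submission
  imports Defs "HOL-Computational_Algebra.Fundamental_Theorem_Algebra"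
    "HOL-Computational_Algebra.Field_as_Ring" "HOL-Computational_Algebra.Polynomial_Factorial"
begin

text \<open>Modulo \<open>J\<close>, a real polynomial in \<open>a \<bullet> z\<close> that is positive on the (real) roots of \<open>h\<^sub>a\<^sub>,\<^sub>e\<close> is a square.
  Hence \<open>1\<close> is an order unit for the cone of sums of squares, and as \<open>-1\<close> is not in this cone, there is a
  state \<open>L\<close> on \<open>\<A>\<^sub>e(h)\<close>; moreover \<open>L (p\<^sup>* (a \<bullet> z) p) \<ge> 0\<close> for all \<open>a\<close> in the hyperbolicity cone.
  The pencil is the truncated moment matrix \<open>L (u\<^sup>* (a \<bullet> z) w)\<close>, where \<open>u\<close>, \<open>w\<close> range over the words of length
  at most \<open>d = deg h\<close>.

  Suppose that the matrix is positive semidefinite at some \<open>a\<close> outside the cone. Write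
  \<open>h\<^sub>b\<^sub>,\<^sub>e(t) = h(b) + t q\<^sub>b(t)\<close>. At zeros \<open>b\<close> of \<open>h\<close> the vector \<open>q\<^sub>b(b \<bullet> z)\<close> is in the kernel of the matrix, and where
  the matrix dominates a multiple of the Gram matrix this forces \<open>f(b) := L (q\<^sub>b(b \<bullet> z)) = 0\<close>. This happens for a
  root on each line \<open>a' - t e\<close>, with \<open>a'\<close> in a nonempty open set. So \<open>h(a' - t e)\<close> and \<open>f(a' - t e)\<close> have a
  nontrivial greatest common divisor in \<open>t\<close> there. On a small box where its degree is constant, its coefficients
  are polynomial along coordinate lines (Gauss' lemma in \<open>\<real>[s][t]\<close>), hence polynomial, and at \<open>t = 0\<close>
  one obtains a factorization of \<open>h\<close>. As \<open>h\<close> is irreducible and \<open>deg f < d\<close>, this gives \<open>f = 0\<close>, whereas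
  \<open>f(e) = - h(e) \<noteq> 0\<close>.\<close>

section \<open>The free algebra\<close>

text \<open>Of the kernel vector only the scalar f(b) is kept, because it is polynomial in b of
  total degree at most d - 1: the coefficient of t^(k+1) in h_{b,e} has degree d - k - 1 in b and is
  paired with a k-th power of b . z. This gap of one is what finally excludes that h divides f.

  The root of h on a' - t e at which f vanishes has no regularity in a', so it is never tracked;
  that some common root exists on every line says that the pointwise gcd in t is nonconstant. The
  obstacle is to glue these gcds, each taken over the field R, to a polynomial factor of h.
  Homogeneity gives all h_{a,e} the same leading coefficient (-1)^d h(e), so nothing degenerates at
  special points: degrees do not drop, the gcd degree is upper semicontinuous, and gcds can be taken
  monic. Gauss' lemma is needed in two variables only, since polynomiality of bounded degree along
  coordinate lines already implies polynomiality on a box.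

  At a itself the matrix is merely semidefinite; the room for dominating the Gram matrix comes from
  a negative root of h_{a,e}, which survives a small move towards e.\<close>

lemma sum_fun_apply: "(\<Sum>i\<in>I. f i) x = (\<Sum>i\<in>I. f i x :: 'b::comm_monoid_add)"
  by (induction I rule: infinite_finite_induct) auto

lemma nc_mul_Nil: "nc_mul p q [] = p [] * q []"
  by (simp add: nc_mul_def)

text \<open>Splitting off the first letter replaces the sum over cut positions by a recursion on
  words, which makes induction on the word available for the ring laws.\<close>

lemma nc_mul_Cons: "nc_mul p q (x # w) = p [] * q (x # w) + nc_mul (\<lambda>v. p (x # v)) q w"
  by (simp add: nc_mul_def sum.atMost_Suc_shift del: sum.atMost_Suc)

lemma nc_mul_add_left: "nc_mul (p + q) r = nc_mul p r + nc_mul q r"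
  by (rule ext) (simp add: nc_mul_def distrib_right sum.distrib)

lemma nc_mul_add_right: "nc_mul r (p + q) = nc_mul r p + nc_mul r q"
  by (rule ext) (simp add: nc_mul_def distrib_left sum.distrib)

lemma nc_mul_diff_left: "nc_mul (p - q) r = nc_mul p r - nc_mul q r"
  by (rule ext) (simp add: nc_mul_def left_diff_distrib sum_subtractf)

lemma nc_mul_diff_right: "nc_mul r (p - q) = nc_mul r p - nc_mul r q"
  by (rule ext) (simp add: nc_mul_def right_diff_distrib sum_subtractf)

lemma nc_mul_zero_left [simp]: "nc_mul 0 r = 0"
  by (rule ext) (simp add: nc_mul_def)

lemma nc_mul_zero_right [simp]: "nc_mul r 0 = 0"
  by (rule ext) (simp add: nc_mul_def)

lemma nc_mul_smult_left [simp]: "nc_mul (nc_smult c p) q = nc_smult c (nc_mul p q)"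
  by (rule ext) (simp add: nc_mul_def nc_smult_def sum_distrib_left mult_ac)

lemma nc_mul_smult_right [simp]: "nc_mul p (nc_smult c q) = nc_smult c (nc_mul p q)"
  by (rule ext) (simp add: nc_mul_def nc_smult_def sum_distrib_left mult_ac)

lemma nc_mul_assoc: "nc_mul (nc_mul p q) r = nc_mul p (nc_mul q r)"
proof (rule ext)
  fix w show "nc_mul (nc_mul p q) r w = nc_mul p (nc_mul q r) w"
  proof (induction w arbitrary: p q r)
    case Nil
    then show ?case by (simp add: nc_mul_Nil)
  next
    case (Cons x w)
    \<comment> \<open>Removing a leading \<open>x\<close> from a product: the letter is taken from
      \<open>q\<close> when the left factor is the empty word, and from \<open>p\<close>
      otherwise.\<close>
    have "(\<lambda>v. nc_mul p q (x # v))
        = nc_smult (p []) (\<lambda>v. q (x # v)) + nc_mul (\<lambda>v. p (x # v)) q"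
      by (rule ext) (simp add: nc_mul_Cons nc_smult_def)
    then have "nc_mul (\<lambda>v. nc_mul p q (x # v)) r w
        = p [] * nc_mul (\<lambda>v. q (x # v)) r w + nc_mul (nc_mul (\<lambda>v. p (x # v)) q) r w"
      by (simp only: nc_mul_add_left nc_mul_smult_left) (simp add: nc_smult_def)
    with Cons show ?case
      by (simp add: nc_mul_Cons nc_mul_Nil algebra_simps)
  qed
qed

lemma nc_mul_one_left [simp]: "nc_mul nc_one p = p"
proof (rule ext)
  fix w show "nc_mul nc_one p w = p w"
    by (cases w) (simp_all add: nc_mul_Nil nc_mul_Cons nc_one_def, simp add: nc_mul_def)
qed

lemma nc_mul_one_right [simp]: "nc_mul p nc_one = p"
proof (rule ext)
  fix w :: "'a list"
  have "(\<Sum>k\<le>length w. p (take k w) * nc_one (drop k w)) = (\<Sum>k\<in>{length w}. p (take k w) * nc_one (drop k w))"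
    by (rule sum.mono_neutral_right) (auto simp: nc_one_def)
  then show "nc_mul p nc_one w = p w"
    by (simp add: nc_mul_def nc_one_def)
qed

lemma nc_mul_sum_left: "nc_mul (\<Sum>i\<in>I. f i) q = (\<Sum>i\<in>I. nc_mul (f i) q)"
  by (induction I rule: infinite_finite_induct) (simp_all only: sum.infinite sum.empty sum.insert not_False_eq_True nc_mul_add_left nc_mul_zero_left)

lemma nc_mul_sum_right: "nc_mul q (\<Sum>i\<in>I. f i) = (\<Sum>i\<in>I. nc_mul q (f i))"
  by (induction I rule: infinite_finite_induct) (simp_all only: sum.infinite sum.empty sum.insert not_False_eq_True nc_mul_add_right nc_mul_zero_right)

lemma nc_smult_add_right: "nc_smult c (p + q) = nc_smult c p + nc_smult c q"
  by (rule ext) (simp add: nc_smult_def distrib_left)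

lemma nc_smult_diff_right: "nc_smult c (p - q) = nc_smult c p - nc_smult c q"
  by (rule ext) (simp add: nc_smult_def right_diff_distrib)

lemma nc_smult_add_left: "nc_smult (c + d) p = nc_smult c p + nc_smult d p"
  by (rule ext) (simp add: nc_smult_def distrib_right)

lemma nc_smult_diff_left: "nc_smult (c - d) p = nc_smult c p - nc_smult d p"
  by (rule ext) (simp add: nc_smult_def left_diff_distrib)

lemma nc_smult_smult [simp]: "nc_smult c (nc_smult d p) = nc_smult (c * d) p"
  by (rule ext) (simp add: nc_smult_def)

lemma nc_smult_one [simp]: "nc_smult 1 p = p"
  by (rule ext) (simp add: nc_smult_def)

lemma nc_smult_zero_left [simp]: "nc_smult 0 p = 0"
  by (rule ext) (simp add: nc_smult_def)

lemma nc_smult_zero_right [simp]: "nc_smult c 0 = 0"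
  by (rule ext) (simp add: nc_smult_def)

lemma nc_smult_minus_one: "nc_smult (- 1) p = - p"
  by (rule ext) (simp add: nc_smult_def)

lemma nc_smult_sum_right: "nc_smult c (\<Sum>i\<in>I. f i) = (\<Sum>i\<in>I. nc_smult c (f i))"
  by (induction I rule: infinite_finite_induct) (simp_all only: sum.infinite sum.empty sum.insert not_False_eq_True nc_smult_add_right nc_smult_zero_right)

lemma nc_star_add: "nc_star (p + q) = nc_star p + nc_star q"
  by (rule ext) (simp add: nc_star_def)

lemma nc_star_diff: "nc_star (p - q) = nc_star p - nc_star q"
  by (rule ext) (simp add: nc_star_def)

lemma nc_star_minus: "nc_star (- p) = - nc_star p"
  by (rule ext) (simp add: nc_star_def)

lemma nc_star_zero [simp]: "nc_star 0 = 0"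
  by (rule ext) (simp add: nc_star_def)

lemma nc_star_one [simp]: "nc_star nc_one = nc_one"
  by (rule ext) (simp add: nc_star_def nc_one_def)

lemma nc_star_star [simp]: "nc_star (nc_star p) = p"
  by (rule ext) (simp add: nc_star_def)

lemma nc_star_smult [simp]: "nc_star (nc_smult c p) = nc_smult (cnj c) (nc_star p)"
  by (rule ext) (simp add: nc_star_def nc_smult_def)

lemma nc_star_sum: "nc_star (\<Sum>i\<in>I. f i) = (\<Sum>i\<in>I. nc_star (f i))"
  by (induction I rule: infinite_finite_induct) (simp_all only: sum.infinite sum.empty sum.insert not_False_eq_True nc_star_add nc_star_zero)

lemma nc_star_mul: "nc_star (nc_mul p q) = nc_mul (nc_star q) (nc_star p)"
proof (rule ext)
  fix w :: "'a list"
  have "nc_star (nc_mul p q) w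
      = (\<Sum>k\<le>length w. cnj (q (rev (take (length w - k) w))) * cnj (p (rev (drop (length w - k) w))))"
    by (simp add: nc_star_def nc_mul_def take_rev drop_rev mult.commute)
  \<comment> \<open>Reversal exchanges prefix and suffix, so the cut position \<open>k\<close>
    becomes \<open>length w - k\<close>.\<close>
  also have "\<dots> = (\<Sum>k\<le>length w. cnj (q (rev (take k w))) * cnj (p (rev (drop k w))))"
    by (rule sum.nat_diff_reindex[of "\<lambda>k. cnj (q (rev (take k w))) * cnj (p (rev (drop k w)))" "Suc (length w)",
          simplified lessThan_Suc_atMost diff_Suc_Suc diff_Suc_1, simplified])
  finally show "nc_star (nc_mul p q) w = nc_mul (nc_star q) (nc_star p) w"
    by (simp add: nc_star_def nc_mul_def)
qed

lemma nc_star_var [simp]: "nc_star (nc_var i) = nc_var i"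
  by (rule ext) (auto simp: nc_star_def nc_var_def)

lemma nc_star_lin [simp]: "nc_star (nc_lin a) = nc_lin a"
  by (simp add: nc_lin_def nc_star_sum)

section \<open>Finite support\<close>

lemma nc_fin_add: "nc_fin p \<Longrightarrow> nc_fin q \<Longrightarrow> nc_fin (p + q)"
  unfolding nc_fin_def by (rule finite_subset[of _ "{w. p w \<noteq> 0} \<union> {w. q w \<noteq> 0}"]) auto

lemma nc_fin_minus: "nc_fin p \<Longrightarrow> nc_fin (- p)"
  unfolding nc_fin_def by simp

lemma nc_fin_diff: "nc_fin p \<Longrightarrow> nc_fin q \<Longrightarrow> nc_fin (p - q)"
  unfolding nc_fin_def by (rule finite_subset[of _ "{w. p w \<noteq> 0} \<union> {w. q w \<noteq> 0}"]) auto

lemma nc_fin_zero [simp]: "nc_fin 0"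
  by (simp add: nc_fin_def)

lemma nc_fin_smult: "nc_fin p \<Longrightarrow> nc_fin (nc_smult c p)"
  unfolding nc_fin_def by (rule finite_subset[of _ "{w. p w \<noteq> 0}"]) (auto simp: nc_smult_def)

lemma nc_fin_sum: "(\<And>i. i \<in> I \<Longrightarrow> nc_fin (f i)) \<Longrightarrow> nc_fin (\<Sum>i\<in>I. f i)"
  by (induction I rule: infinite_finite_induct) (simp_all add: nc_fin_add)

lemma nc_fin_one [simp]: "nc_fin nc_one"
  by (simp add: nc_fin_def nc_one_def)

lemma nc_fin_var [simp]: "nc_fin (nc_var i)"
  by (simp add: nc_fin_def nc_var_def)

lemma nc_fin_lin [simp]: "nc_fin (nc_lin a)"
  by (simp add: nc_lin_def nc_fin_sum nc_fin_smult)

lemma nc_fin_star: assumes "nc_fin p" shows "nc_fin (nc_star p)"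
proof -
  have "{w. nc_star p w \<noteq> 0} = rev ` {w. p w \<noteq> 0}"
    by (auto simp: nc_star_def image_iff) (metis rev_rev_ident)
  then show ?thesis using assms by (simp add: nc_fin_def)
qed

lemma nc_fin_mul: assumes "nc_fin p" "nc_fin q" shows "nc_fin (nc_mul p q)"
  unfolding nc_fin_def
proof (rule finite_subset)
  show "{w. nc_mul p q w \<noteq> 0} \<subseteq> (\<lambda>(u, v). u @ v) ` ({w. p w \<noteq> 0} \<times> {w. q w \<noteq> 0})"
  proof
    fix w assume "w \<in> {w. nc_mul p q w \<noteq> 0}"
    then have "(\<Sum>k\<le>length w. p (take k w) * q (drop k w)) \<noteq> 0"
      by (simp add: nc_mul_def)
    then obtain k where "p (take k w) * q (drop k w) \<noteq> 0"
      by (rule sum.not_neutral_contains_not_neutral)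
    then show "w \<in> (\<lambda>(u, v). u @ v) ` ({w. p w \<noteq> 0} \<times> {w. q w \<noteq> 0})"
      by (intro image_eqI[of _ _ "(take k w, drop k w)"]) simp_all
  qed
  show "finite ((\<lambda>(u, v). u @ v) ` ({w. p w \<noteq> 0} \<times> {w. q w \<noteq> 0}))"
    using assms by (simp add: nc_fin_def)
qed

lemma nc_fin_pow: "nc_fin p \<Longrightarrow> nc_fin (nc_pow p k)"
  by (induction k) (simp_all add: nc_fin_mul)

lemmas nc_fin_intros = nc_fin_add nc_fin_minus nc_fin_diff nc_fin_zero nc_fin_smult nc_fin_sum
  nc_fin_one nc_fin_var nc_fin_lin nc_fin_star nc_fin_mul nc_fin_pow

lemma nc_pow_commute: "nc_mul (nc_pow x k) x = nc_mul x (nc_pow x k)"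
  by (induction k) (simp_all add: nc_mul_assoc)

lemma nc_star_pow: "nc_star x = x \<Longrightarrow> nc_star (nc_pow x k) = nc_pow x k"
  by (induction k) (simp_all add: nc_star_mul nc_pow_commute)

lemma nc_lin_add: "nc_lin (a + b) = nc_lin a + nc_lin b"
  by (simp add: nc_lin_def nc_smult_add_left sum.distrib)

lemma nc_lin_scaleR: "nc_lin (r *\<^sub>R a) = nc_smult (complex_of_real r) (nc_lin a)"
  by (simp add: nc_lin_def nc_smult_sum_right)

lemma nc_lin_axis: "nc_lin (axis i 1) = nc_var i"
proof -
  have "nc_lin (axis i 1) = (\<Sum>j\<in>UNIV. if j = i then nc_var i else 0)"
    unfolding nc_lin_def by (rule sum.cong) (auto simp: axis_def)
  then show ?thesis by simp
qed

section \<open>Words as a basis, and the degree filtration\<close>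

definition nc_word :: "'n list \<Rightarrow> 'n ncpoly" where
  "nc_word u = (\<lambda>w. if w = u then 1 else 0)"

lemma nc_word_Nil: "nc_word [] = nc_one"
  by (simp add: nc_word_def nc_one_def)

lemma nc_mul_word: "nc_mul (nc_word u) (nc_word v) = nc_word (u @ v)"
proof (rule ext)
  fix w show "nc_mul (nc_word u) (nc_word v) w = nc_word (u @ v) w"
  proof (cases "w = u @ v")
    case True
    have "(\<Sum>k\<le>length w. nc_word u (take k w) * nc_word v (drop k w))
        = (\<Sum>k\<in>{length u}. nc_word u (take k w) * nc_word v (drop k w))"
      by (rule sum.mono_neutral_right) (use True in \<open>auto simp: nc_word_def simp del: take_append dest: arg_cong[where f = length] split: if_splits\<close>)
    then show ?thesis using True by (simp add: nc_mul_def nc_word_def)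
  next
    case False
    then have "nc_word u (take k w) * nc_word v (drop k w) = 0" for k
      by (auto simp: nc_word_def)
    then have "nc_mul (nc_word u) (nc_word v) w = 0"
      unfolding nc_mul_def by (intro sum.neutral) blast
    then show ?thesis using False by (simp add: nc_word_def)
  qed
qed

lemma nc_word_Cons: "nc_word (i # w) = nc_mul (nc_var i) (nc_word w)"
  using nc_mul_word[of "[i]" w] by (simp add: nc_word_def nc_var_def)

lemma nc_fin_word [simp]: "nc_fin (nc_word w)"
  by (simp add: nc_fin_def nc_word_def)

lemma nc_expand_words:
  assumes "finite W" "\<And>w. p w \<noteq> 0 \<Longrightarrow> w \<in> W"
  shows "p = (\<Sum>w\<in>W. nc_smult (p w) (nc_word w))"
proof (rule ext)
  fix w
  have "(\<Sum>v\<in>W. nc_smult (p v) (nc_word v) w) = (\<Sum>v\<in>W. if v = w then p w else 0)"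
    by (rule sum.cong) (auto simp: nc_smult_def nc_word_def)
  also have "\<dots> = p w" using assms by (auto simp: sum.delta)
  finally show "p w = (\<Sum>w\<in>W. nc_smult (p w) (nc_word w)) w" by (simp add: sum_fun_apply)
qed

definition nc_deg_le :: "nat \<Rightarrow> 'n ncpoly \<Rightarrow> bool" where
  "nc_deg_le k p \<longleftrightarrow> (\<forall>w. length w > k \<longrightarrow> p w = 0)"

lemma nc_deg_le_mul: assumes "nc_deg_le k p" "nc_deg_le l q" shows "nc_deg_le (k + l) (nc_mul p q)"
  unfolding nc_deg_le_def nc_mul_def
proof (intro allI impI sum.neutral ballI)
  fix w :: "'a list" and j assume "k + l < length w" "j \<in> {..length w}"
  then have "k < length (take j w) \<or> l < length (drop j w)" by auto
  then show "p (take j w) * q (drop j w) = 0"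
    using assms by (auto simp: nc_deg_le_def)
qed

lemma nc_deg_le_sum: "(\<And>i. i \<in> I \<Longrightarrow> nc_deg_le k (f i)) \<Longrightarrow> nc_deg_le k (\<Sum>i\<in>I. f i)"
  by (simp add: nc_deg_le_def sum_fun_apply)

lemma nc_deg_le_smult: "nc_deg_le k f \<Longrightarrow> nc_deg_le k (nc_smult c f)"
  by (simp add: nc_deg_le_def nc_smult_def)

lemma nc_deg_le_lin: "nc_deg_le 1 (nc_lin a)"
  unfolding nc_lin_def by (intro nc_deg_le_sum nc_deg_le_smult) (auto simp: nc_deg_le_def nc_var_def)

lemma nc_deg_le_pow_lin: "nc_deg_le k (nc_pow (nc_lin a) k)"
proof (induction k)
  case 0 show ?case by (auto simp: nc_deg_le_def nc_one_def)
next
  case (Suc k) then show ?case using nc_deg_le_mul[OF nc_deg_le_lin[of a] Suc] by simp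
qed

section \<open>Substitution into univariate real polynomials\<close>

lemma nc_polyeval_upto:
  assumes "degree p \<le> N"
  shows "nc_polyeval p x = (\<Sum>k\<le>N. nc_smult (complex_of_real (coeff p k)) (nc_pow x k))"
  unfolding nc_polyeval_def
  by (rule sum.mono_neutral_left) (use assms in \<open>auto simp: coeff_eq_0\<close>)

lemma nc_polyeval_0 [simp]: "nc_polyeval 0 x = 0"
  by (simp add: nc_polyeval_def)

lemma nc_polyeval_pCons:
  "nc_polyeval (pCons c p) x = nc_smult (complex_of_real c) nc_one + nc_mul x (nc_polyeval p x)"
proof -
  have "nc_polyeval (pCons c p) x
      = (\<Sum>k\<le>Suc (degree p). nc_smult (complex_of_real (coeff (pCons c p) k)) (nc_pow x k))"
    by (rule nc_polyeval_upto) (simp add: degree_pCons_le)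
  then show ?thesis
    by (simp add: sum.atMost_Suc_shift nc_polyeval_def nc_mul_sum_right del: sum.atMost_Suc)
qed

lemma nc_polyeval_add: "nc_polyeval (p + q) x = nc_polyeval p x + nc_polyeval q x"
  using nc_polyeval_upto[of "p + q" "max (degree p) (degree q)" x]
    nc_polyeval_upto[of p "max (degree p) (degree q)" x]
    nc_polyeval_upto[of q "max (degree p) (degree q)" x]
  by (simp add: degree_add_le nc_smult_add_left sum.distrib)

lemma nc_polyeval_smult: "nc_polyeval (smult c p) x = nc_smult (complex_of_real c) (nc_polyeval p x)"
  by (simp add: nc_polyeval_upto[of "smult c p" "degree p"] nc_polyeval_def degree_smult_le nc_smult_sum_right)

lemma nc_polyeval_diff: "nc_polyeval (p - q) x = nc_polyeval p x - nc_polyeval q x"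
proof -
  have "nc_polyeval (smult (- 1) q) x = - nc_polyeval q x"
    by (simp only: nc_polyeval_smult of_real_minus of_real_1 nc_smult_minus_one)
  then show ?thesis using nc_polyeval_add[of p "smult (- 1) q" x] by simp
qed

lemma nc_polyeval_mult: "nc_polyeval (p * q) x = nc_mul (nc_polyeval p x) (nc_polyeval q x)"
proof (induction p)
  case 0
  show ?case by (simp only: mult_zero_left nc_polyeval_0 nc_mul_zero_left)
next
  case (pCons c p)
  have "nc_polyeval (pCons c p * q) x
      = nc_smult (complex_of_real c) (nc_polyeval q x) + nc_mul x (nc_polyeval (p * q) x)"
    by (simp only: mult_pCons_left nc_polyeval_add nc_polyeval_smult nc_polyeval_pCons
        of_real_0 nc_smult_zero_left add_0)
  then show ?case
    by (simp only: pCons nc_polyeval_pCons nc_mul_add_left nc_mul_assoc nc_mul_smult_left nc_mul_one_left)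
qed

lemma nc_fin_polyeval: "nc_fin x \<Longrightarrow> nc_fin (nc_polyeval p x)"
  by (simp add: nc_polyeval_def nc_fin_intros)

lemma nc_star_polyeval: "nc_star x = x \<Longrightarrow> nc_star (nc_polyeval p x) = nc_polyeval p x"
  by (simp add: nc_polyeval_def nc_star_sum nc_star_pow)

section \<open>States on cones with an order unit\<close>

text \<open>An order-unit form of the Hahn--Banach theorem: a maximal cone \<open>P\<close> not containing \<open>- u\<close>
  satisfies \<open>P \<union> - P = S\<close>, so it determines a functional by Dedekind cuts.\<close>

lemma cone_state_exists:
  fixes scale :: "real \<Rightarrow> 'v::ab_group_add \<Rightarrow> 'v"
  assumes "vector_space scale" and S: "module.subspace scale S"
    and CS: "C \<subseteq> S"
    and C_add: "\<And>x y. x \<in> C \<Longrightarrow> y \<in> C \<Longrightarrow> x + y \<in> C"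
    and C_scale: "\<And>r x. 0 \<le> r \<Longrightarrow> x \<in> C \<Longrightarrow> scale r x \<in> C"
    and u: "u \<in> C" "- u \<notin> C"
    and unit: "\<And>x. x \<in> S \<Longrightarrow> \<exists>r. scale r u - x \<in> C"
  obtains L :: "'v \<Rightarrow> real" where
    "\<And>x y. x \<in> S \<Longrightarrow> y \<in> S \<Longrightarrow> L (x + y) = L x + L y"
    "\<And>r x. x \<in> S \<Longrightarrow> L (scale r x) = r * L x"
    "\<And>x. x \<in> C \<Longrightarrow> 0 \<le> L x" "L u = 1"
proof -
  interpret vector_space scale by fact
  define A where "A = {P. C \<subseteq> P \<and> P \<subseteq> S \<and> (\<forall>x\<in>P. \<forall>y\<in>P. x + y \<in> P)
    \<and> (\<forall>r\<ge>0. \<forall>x\<in>P. scale r x \<in> P) \<and> - u \<notin> P}"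
  have "C \<in> A" using assms by (auto simp: A_def)
  have "\<exists>M\<in>A. \<forall>X\<in>A. M \<subseteq> X \<longrightarrow> X = M"
  proof (rule subset_Zorn_nonempty)
    show "A \<noteq> {}" using \<open>C \<in> A\<close> by blast
    fix K assume K: "K \<noteq> {}" "subset.chain A K"
    then have KA: "\<And>P. P \<in> K \<Longrightarrow> P \<in> A" and lin: "\<And>P Q. P \<in> K \<Longrightarrow> Q \<in> K \<Longrightarrow> P \<subseteq> Q \<or> Q \<subseteq> P"
      by (auto simp: subset.chain_def)
    have "x + y \<in> \<Union>K" if "x \<in> \<Union>K" "y \<in> \<Union>K" for x y
    proof -
      from that obtain P Q where "P \<in> K" "Q \<in> K" "x \<in> P" "y \<in> Q" by blast
      then obtain R where "R \<in> K" "x \<in> R" "y \<in> R" using lin by blast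
      then show ?thesis using KA[of R] by (intro UnionI[of R]) (auto simp: A_def)
    qed
    moreover have "scale r x \<in> \<Union>K" if "0 \<le> r" "x \<in> \<Union>K" for r x
      using that KA by (auto simp: A_def)
    moreover have "C \<subseteq> \<Union>K" "\<Union>K \<subseteq> S" "- u \<notin> \<Union>K"
      using K(1) KA unfolding A_def by blast+
    ultimately show "\<Union>K \<in> A" unfolding A_def by blast
  qed
  then obtain P where "P \<in> A" and max: "\<And>X. X \<in> A \<Longrightarrow> P \<subseteq> X \<Longrightarrow> X = P" by blast
  then have CP: "C \<subseteq> P" and PS: "P \<subseteq> S" and P_add: "\<And>x y. x \<in> P \<Longrightarrow> y \<in> P \<Longrightarrow> x + y \<in> P"
    and P_scale: "\<And>r x. 0 \<le> r \<Longrightarrow> x \<in> P \<Longrightarrow> scale r x \<in> P" and uP: "- u \<notin> P"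
    by (auto simp: A_def)
  have P0: "0 \<in> P" using P_scale[of 0 u] u CP by auto
  have uS: "u \<in> S" using u CS by blast
  have total: "- x \<in> P" if "x \<in> S" "x \<notin> P" for x
  proof -
    \<comment> \<open>The cone generated by \<open>P\<close> and \<open>x\<close>. It is strictly
      larger than \<open>P\<close>, so by maximality it must violate the conditions of
      \<open>A\<close>, and only \<open>- u\<close> can be the culprit.\<close>
    define X where "X = {p + scale r x | p r. p \<in> P \<and> 0 \<le> r}"
    have "P \<subseteq> X"
    proof
      fix p assume "p \<in> P"
      then have "p = p + scale 0 x \<and> p \<in> P \<and> (0::real) \<le> 0" by simp
      then show "p \<in> X" unfolding X_def by blast
    qed
    moreover have "x \<in> X"
    proof -
      have "x = 0 + scale 1 x \<and> 0 \<in> P \<and> (0::real) \<le> 1" using P0 by simp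
      then show ?thesis unfolding X_def by blast
    qed
    ultimately have "X \<notin> A" using max that by blast
    moreover have "y + z \<in> X" if yz: "y \<in> X" "z \<in> X" for y z
    proof -
      from yz obtain p r q s where "y = p + scale r x" "p \<in> P" "0 \<le> r" "z = q + scale s x" "q \<in> P" "0 \<le> s"
        unfolding X_def by blast
      then have "y + z = (p + q) + scale (r + s) x \<and> p + q \<in> P \<and> 0 \<le> r + s"
        using P_add by (simp add: scale_left_distrib)
      then show ?thesis unfolding X_def by blast
    qed
    moreover have "scale t y \<in> X" if y: "y \<in> X" "0 \<le> t" for y t
    proof -
      from y obtain p r where "y = p + scale r x" "p \<in> P" "0 \<le> r" unfolding X_def by blast
      then have "scale t y = scale t p + scale (t * r) x \<and> scale t p \<in> P \<and> 0 \<le> t * r"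
        using P_scale y by (simp add: scale_right_distrib)
      then show ?thesis unfolding X_def by blast
    qed
    moreover have "X \<subseteq> S"
      using PS \<open>x \<in> S\<close> S unfolding X_def by (auto intro!: subspace_add subspace_scale)
    ultimately have "- u \<in> X"
      using CP \<open>P \<subseteq> X\<close> unfolding A_def by blast
    then obtain p r where pr: "- u = p + scale r x" "p \<in> P" "0 \<le> r"
      unfolding X_def by blast
    then have "r \<noteq> 0" using uP by auto
    have "p + u + scale r x = 0"
      using arg_cong[OF pr(1), of "\<lambda>z. z + u"] by (simp add: add_ac)
    then have "p + u = - scale r x" by (simp add: eq_neg_iff_add_eq_0)
    \<comment> \<open>The relation \<open>- u = p + scale r x\<close> is solved for
      \<open>- x\<close>; here \<open>r\<close> is positive because \<open>- u\<close> is not in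
      \<open>P\<close>.\<close>
    then have "scale (inverse r) (p + u) = - x"
      using \<open>r \<noteq> 0\<close> by (simp flip: scale_minus_right)
    moreover have "scale (inverse r) (p + u) \<in> P"
      using pr u CP by (intro P_scale P_add) auto
    ultimately show ?thesis by simp
  qed
  \<comment> \<open>The lower Dedekind cut of the value at \<open>x\<close>: all \<open>r\<close>
    with \<open>r u \<le> x\<close> in the order given by \<open>P\<close>.\<close>
  define D where "D x = {r. x - scale r u \<in> P}" for x
  define L where "L x = Sup (D x)" for x
  have D_down: "s \<in> D x" if "r \<in> D x" "s \<le> r" for r s x
  proof -
    have "x - scale s u = (x - scale r u) + scale (r - s) u"
      by (simp add: scale_left_diff_distrib)
    moreover have "(x - scale r u) + scale (r - s) u \<in> P"
      using that u CP by (intro P_add P_scale) (auto simp: D_def)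
    ultimately show ?thesis by (simp only: D_def mem_Collect_eq)
  qed
  have D0: "r \<le> 0" if "r \<in> D 0" for r
  proof (rule ccontr)
    assume "\<not> r \<le> 0"
    then have "scale (inverse r) (0 - scale r u) \<in> P"
      using that by (intro P_scale) (auto simp: D_def)
    moreover have "scale (inverse r) (0 - scale r u) = - u"
      using \<open>\<not> r \<le> 0\<close> by (simp add: scale_right_diff_distrib)
    ultimately show False using uP by simp
  qed
  have D_add: "r + s \<in> D (x + y)" if "r \<in> D x" "s \<in> D y" for r s x y
  proof -
    have "(x + y) - scale (r + s) u = (x - scale r u) + (y - scale s u)"
      by (simp add: scale_left_distrib)
    moreover have "(x - scale r u) + (y - scale s u) \<in> P"
      using that by (intro P_add) (auto simp: D_def)
    ultimately show ?thesis by (simp only: D_def mem_Collect_eq)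
  qed
  have D_ne: "\<exists>r. r \<in> D x" if "x \<in> S" for x
  proof -
    have "- x \<in> S" using that S by (simp add: subspace_neg)
    then obtain r where "scale r u - (- x) \<in> C" using unit by blast
    then have "- r \<in> D x" using CP by (auto simp: D_def add.commute)
    then show ?thesis by blast
  qed
  \<comment> \<open>A lower bound for \<open>- x\<close> yields an upper bound for \<open>x\<close>,
    because the cut of 0 has no positive element.\<close>
  have D_bdd: "bdd_above (D x)" if x: "x \<in> S" for x
  proof -
    have "- x \<in> S" using that S by (simp add: subspace_neg)
    then obtain s where s: "s \<in> D (- x)" using D_ne by blast
    have "r \<le> - s" if "r \<in> D x" for r
      using D0[of "r + s"] D_add[OF that s] by simp
    then show ?thesis by (meson bdd_aboveI)
  qed
  have L_upper: "r \<le> L x" if "x \<in> S" "r \<in> D x" for r x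
    unfolding L_def using that D_bdd by (simp add: cSup_upper)
  have L_less: "r \<in> D x" if "x \<in> S" "r < L x" for r x
  proof -
    have "r < Sup (D x)" "D x \<noteq> {}"
      using that D_ne[of x] by (auto simp: L_def)
    then obtain s where "s \<in> D x" "r < s" by (rule less_cSupE)
    then show ?thesis using D_down by (meson less_imp_le)
  qed
  have L_super: "L x + L y \<le> L (x + y)" if "x \<in> S" "y \<in> S" for x y
  proof (rule field_le_epsilon)
    fix e :: real assume "0 < e"
    then have "L x - e / 2 \<in> D x" "L y - e / 2 \<in> D y"
      using that by (auto intro!: L_less)
    then have "(L x - e / 2) + (L y - e / 2) \<le> L (x + y)"
      using that S by (intro L_upper D_add) (auto simp: subspace_add)
    then show "L x + L y \<le> L (x + y) + e" by simp
  qed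
  have L_zero: "L 0 = 0"
  proof -
    have "0 \<in> D 0" using P0 by (simp add: D_def)
    then have "0 \<le> L 0" using S by (intro L_upper) (auto simp: subspace_0)
    moreover have "L 0 \<le> 0"
      unfolding L_def by (rule cSup_least) (use \<open>0 \<in> D 0\<close> D0 in auto)
    ultimately show ?thesis by simp
  qed
  \<comment> \<open>Adding cuts gives only superadditivity of \<open>L\<close>. Totality of
    \<open>P\<close> enters here: if \<open>r\<close> lies above the cut of \<open>- x\<close>, then
    \<open>- r\<close> belongs to the cut of \<open>x\<close>.\<close>
  have L_minus: "L (- x) = - L x" if x: "x \<in> S" for x
  proof (rule antisym)
    have mx: "- x \<in> S" using that S by (simp add: subspace_neg)
    show "L (- x) \<le> - L x" using L_super[OF x mx] L_zero by simp
    show "- L x \<le> L (- x)"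
    proof (rule dense_ge)
      fix r assume "L (- x) < r"
      then have "r \<notin> D (- x)" using L_upper mx by force
      then have "- x - scale r u \<notin> P" by (simp add: D_def)
      then have "- (- x - scale r u) \<in> P"
        using mx uS S by (intro total) (auto intro: subspace_diff subspace_scale)
      then have "- r \<in> D x" by (simp add: D_def add_ac)
      then show "- L x \<le> r" using L_upper x by force
    qed
  qed
  have L_add: "L (x + y) = L x + L y" if "x \<in> S" "y \<in> S" for x y
  proof (rule antisym)
    have "L (x + y) + L (- y) \<le> L ((x + y) + (- y))"
      using that S by (intro L_super) (auto simp: subspace_neg subspace_add)
    then show "L (x + y) \<le> L x + L y" using L_minus that by simp
  qed (use L_super that in blast)
  have L_mono_scale: "r * L x \<le> L (scale r x)" if "x \<in> S" "0 < r" for r x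
  proof (rule dense_le)
    fix s assume "s < r * L x"
    then have "s / r \<in> D x" using that by (intro L_less) (auto simp: field_simps)
    then have "scale r (x - scale (s / r) u) \<in> P" using that by (intro P_scale) (auto simp: D_def)
    then have "s \<in> D (scale r x)" using that by (simp add: D_def scale_right_diff_distrib)
    then show "s \<le> L (scale r x)" using that S by (intro L_upper) (auto simp: subspace_scale)
  qed
  have L_pos_scale: "L (scale r x) = r * L x" if "x \<in> S" "0 < r" for r x
  proof (rule antisym)
    have "inverse r * L (scale r x) \<le> L (scale (inverse r) (scale r x))"
      using that S by (intro L_mono_scale) (auto simp: subspace_scale)
    then show "L (scale r x) \<le> r * L x" using that by (simp add: field_simps)
  qed (use L_mono_scale that in blast)
  have L_scale: "L (scale r x) = r * L x" if x: "x \<in> S" for r x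
  proof -
    consider "r = 0" | "r > 0" | "r < 0" by linarith
    then show ?thesis
    proof cases
      case 3
      have "L (scale (- r) x) = - r * L x" using L_pos_scale[of x "- r"] 3 x by simp
      moreover have "L (- scale r x) = - L (scale r x)" using x S by (simp add: L_minus subspace_scale)
      ultimately show ?thesis by simp
    qed (use L_zero L_pos_scale x in auto)
  qed
  show ?thesis
  proof (rule that[OF L_add L_scale])
    show "0 \<le> L x" if "x \<in> C" for x
      using that CS CP by (intro L_upper) (auto simp: D_def)
    show "L u = 1"
    proof (rule antisym)
      show "1 \<le> L u" using uS P0 by (intro L_upper) (auto simp: D_def)
      have "0 \<in> D (- u + u)" using P0 by (simp add: D_def)
      show "L u \<le> 1"
      proof (rule dense_le)
        fix r assume "r < L u"
        then have "r \<in> D u" using uS by (intro L_less)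
        moreover have "- 1 \<in> D (- u)" using P0 by (simp add: D_def)
        ultimately have "r + - 1 \<in> D (u + - u)" by (rule D_add)
        then show "r \<le> 1" using D0[of "r - 1"] by simp
      qed
    qed
  qed auto
qed

section \<open>Real-rooted polynomials\<close>

text \<open>Hensel-type induction: enlarging the modulus \<open>P\<close> by one root only requires adding a
  multiple of \<open>P\<close> to the square root.\<close>

lemma square_mod_split_poly:
  fixes f :: "real poly"
  assumes "\<forall>r\<in>set rs. poly f r > 0"
  shows "\<exists>s. (\<Prod>r\<leftarrow>rs. [:- r, 1:]) dvd s * s - f"
  using assms
proof (induction rs)
  case Nil
  then show ?case by simp
next
  case (Cons r rs)
  define P where "P = (\<Prod>r\<leftarrow>rs. [:- r, 1:])"
  from Cons obtain s where "P dvd s * s - f" by (auto simp: P_def)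
  then obtain g where g: "s * s - f = P * g" by (elim dvdE)
  have r: "poly f r > 0" using Cons by simp
  have gr: "poly s r * poly s r - poly f r = poly P r * poly g r"
    using arg_cong[OF g, of "\<lambda>p. poly p r"] by simp
  \<comment> \<open>If \<open>r\<close> is not a root of \<open>P\<close>, then \<open>c\<close>
    moves the value of \<open>s\<close> at \<open>r\<close> to the square root of
    \<open>f(r)\<close>. If it repeats a root, then \<open>c\<close> solves the linearized equation
    g + 2 c s = 0 at \<open>r\<close>, where \<open>s(r)\<close> is nonzero since its square is
    \<open>f(r) > 0\<close>.\<close>
  define c where "c = (if poly P r = 0 then - poly g r / (2 * poly s r)
                       else (sqrt (poly f r) - poly s r) / poly P r)"
  \<comment> \<open>The cofactor of \<open>P\<close> in (s + c P)^2 - f; its vanishing at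
    \<open>r\<close> provides the additional linear factor.\<close>
  define q where "q = g + smult (2 * c) s + smult (c * c) P"
  have "poly q r = 0"
  proof (cases "poly P r = 0")
    case True
    then have "poly s r \<noteq> 0" using gr r by auto
    then show ?thesis using True by (simp add: q_def c_def)
  next
    case False
    then have "poly s r + c * poly P r = sqrt (poly f r)" by (simp add: c_def)
    then have "(poly s r + c * poly P r) * (poly s r + c * poly P r) = poly f r"
      using r by simp
    then have "poly P r * poly q r = 0"
      using gr by (simp add: q_def algebra_simps)
    then show ?thesis using False by simp
  qed
  then have "[:- r, 1:] dvd q" by (simp add: poly_eq_0_iff_dvd)
  then have "[:- r, 1:] * P dvd q * P" by (rule mult_dvd_mono) simp
  also have "q * P = (s + smult c P) * (s + smult c P) - f"
  proof -
    have "q * P = (s * s - f) + smult (2 * c) s * P + smult (c * c) P * P"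
      by (simp add: g q_def algebra_simps)
    also have "smult (2 * c) s = smult c s + smult c s"
      by (simp flip: smult_add_left)
    finally show ?thesis by (simp add: algebra_simps smult_add_right)
  qed
  finally show ?case by (auto simp: P_def)
qed

lemma map_poly_complex_of_real_mult:
  "map_poly complex_of_real (p * q) = map_poly complex_of_real p * map_poly complex_of_real q"
  by (rule poly_eqI) (simp add: coeff_map_poly coeff_mult)

lemma poly_map_poly_complex_of_real [simp]:
  "poly (map_poly complex_of_real p) (complex_of_real x) = complex_of_real (poly p x)"
  by (induction p) (simp_all add: map_poly_pCons)

lemma only_real_roots_factor:
  assumes "only_real_roots (p * q)"
  shows "only_real_roots q"
  using assms unfolding only_real_roots_def
  by (simp add: map_poly_complex_of_real_mult)

lemma only_real_roots_split:
  assumes "only_real_roots p" "p \<noteq> 0"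
  obtains rs where "p = smult (lead_coeff p) (\<Prod>r\<leftarrow>rs. [:- r, 1:])"
proof -
  have "\<exists>rs. p = smult (lead_coeff p) (\<Prod>r\<leftarrow>rs. [:- r, 1:])"
    using assms
  proof (induction "degree p" arbitrary: p)
    case 0
    then obtain c where "p = [:c:]" by (metis degree_eq_zeroE)
    then show ?case by (intro exI[of _ "[]"]) simp
  next
    case (Suc n)
    let ?q = "map_poly complex_of_real p"
    have "degree ?q = degree p" by (simp add: degree_map_poly)
    then have "\<not> constant (poly ?q)"
      using Suc.hyps(2) by (simp add: constant_degree)
    then obtain z where z: "poly ?q z = 0"
      using fundamental_theorem_of_algebra by blast
    then obtain r where "z = complex_of_real r"
      using Suc.prems(1) by (auto simp: only_real_roots_def Reals_def)
    then have "poly p r = 0" using z by simp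
    then obtain q where q: "p = [:- r, 1:] * q"
      by (metis dvdE poly_eq_0_iff_dvd)
    have "q \<noteq> 0" using q Suc.prems by auto
    moreover have "only_real_roots q" using only_real_roots_factor Suc.prems(1) q by blast
    moreover have "degree p = Suc (degree q)"
      using degree_mult_eq[of "[:- r, 1:]" q] q \<open>q \<noteq> 0\<close> by simp
    ultimately obtain rs where rs: "q = smult (lead_coeff q) (\<Prod>r\<leftarrow>rs. [:- r, 1:])"
      using Suc.hyps by (metis Suc_inject)
    have "lead_coeff p = lead_coeff q" using q by (simp only: lead_coeff_mult) simp
    then have "p = smult (lead_coeff p) ([:- r, 1:] * (\<Prod>r\<leftarrow>rs. [:- r, 1:]))"
      using q rs by (metis mult_smult_right)
    then show ?case by (intro exI[of _ "r # rs"]) simp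
  qed
  then show ?thesis using that by blast
qed

lemma poly_split_eq_0_iff: "poly (\<Prod>r\<leftarrow>rs. [:- r, 1:]) x = 0 \<longleftrightarrow> x \<in> set rs" for x :: real
  by (induction rs) auto

lemma split_poly_degree:
  fixes rs :: "real list"
  shows "degree (\<Prod>r\<leftarrow>rs. [:- r, 1:]) = length rs \<and> lead_coeff (\<Prod>r\<leftarrow>rs. [:- r, 1:]) = 1"
proof (induction rs)
  case (Cons r rs)
  then have lc: "lead_coeff (\<Prod>r\<leftarrow>rs. [:- r, 1:]) = 1" by blast
  then have "(\<Prod>r\<leftarrow>rs. [:- r, 1:]) \<noteq> 0" by (metis coeff_0 zero_neq_one)
  then have "degree ([:- r, 1:] * (\<Prod>r\<leftarrow>rs. [:- r, 1:])) = Suc (length rs)"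
    using Cons degree_mult_eq[of "[:- r, 1:]" "\<Prod>r\<leftarrow>rs. [:- r, 1:]"] by simp
  moreover have "lead_coeff ([:- r, 1:] * (\<Prod>r\<leftarrow>rs. [:- r, 1:])) = 1"
    using lc by (simp only: lead_coeff_mult) simp
  ultimately show ?case by (simp only: list.map prod_list.Cons list.size add_Suc_right add_0_right)
qed simp

text \<open>Up to sign the coefficients are the elementary symmetric polynomials of the roots. This
  turns nonnegativity of the roots into a closed condition on the coefficients.\<close>

lemma alternating_coeffs:
  fixes rs :: "real list"
  assumes "\<forall>r\<in>set rs. 0 \<le> r"
  shows "0 \<le> (- 1) ^ (length rs + k) * coeff (\<Prod>r\<leftarrow>rs. [:- r, 1:]) k"
  using assms
proof (induction rs arbitrary: k)
  case Nil
  then show ?case by (cases k) (simp_all add: one_pCons)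
next
  case (Cons r rs)
  let ?P = "\<Prod>r\<leftarrow>rs. [:- r, 1:]"
  have IH: "0 \<le> (- 1) ^ (length rs + k) * coeff ?P k" for k
    using Cons.prems by (intro Cons.IH) simp
  have "0 \<le> r" using Cons.prems by simp
  then have "0 \<le> r * ((- 1) ^ (length rs + k) * coeff ?P k)"
    using IH by (rule mult_nonneg_nonneg)
  moreover have "(- 1) ^ (length (r # rs) + k) * coeff (\<Prod>r\<leftarrow>r # rs. [:- r, 1:]) k
      = (if k = 0 then 0 else (- 1) ^ (length rs + (k - 1)) * coeff ?P (k - 1))
        + r * ((- 1) ^ (length rs + k) * coeff ?P k)"
    by (cases k) (simp_all add: algebra_simps)
  moreover have "0 \<le> (if k = 0 then 0 else (- 1) ^ (length rs + (k - 1)) * coeff ?P (k - 1))"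
    using IH[of "k - 1"] by (cases "k = 0") (simp_all only: if_True if_False order_refl simp_thms)
  ultimately show ?case by linarith
qed

section \<open>The univariate polynomials \<open>hae h e a\<close>\<close>

lemma hae_poly: "poly (hae h e a) t = mpoly_eval h (a - t *\<^sub>R e)"
  by (simp add: hae_def mpoly_eval_def poly_sum poly_prod mult.commute)

text \<open>\<open>m\<close> and \<open>n\<close> are only bounds: the factor
  \<open>[:a $ i, - (e $ i):]\<close> is constant when \<open>e $ i = 0\<close>, and the coefficient
  at the formal top degree must be tracked all the same.\<close>

lemma coeff_mult_top:
  fixes p q :: "'a::comm_semiring_1 poly"
  assumes "degree p \<le> m" "degree q \<le> n"
  shows "coeff (p * q) (m + n) = coeff p m * coeff q n"
proof -
  have "(\<Sum>i\<le>m + n. coeff p i * coeff q (m + n - i)) = (\<Sum>i\<in>{m}. coeff p i * coeff q (m + n - i))"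
  proof (rule sum.mono_neutral_right)
    show "\<forall>i\<in>{..m + n} - {m}. coeff p i * coeff q (m + n - i) = 0"
    proof
      fix i assume "i \<in> {..m + n} - {m}"
      then have "i > m \<or> m + n - i > n" by auto
      then show "coeff p i * coeff q (m + n - i) = 0"
        using assms by (auto simp: coeff_eq_0)
    qed
  qed auto
  then show ?thesis by (simp add: coeff_mult)
qed

lemma coeff_prod_top:
  fixes f :: "'i \<Rightarrow> 'a::comm_semiring_1 poly"
  assumes "finite I" "\<And>i. i \<in> I \<Longrightarrow> degree (f i) \<le> n i"
  shows "degree (\<Prod>i\<in>I. f i) \<le> (\<Sum>i\<in>I. n i)
    \<and> coeff (\<Prod>i\<in>I. f i) (\<Sum>i\<in>I. n i) = (\<Prod>i\<in>I. coeff (f i) (n i))"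
  using assms
  by (induction I rule: finite_induct)
    (auto simp: coeff_mult_top intro!: order_trans[OF degree_mult_le] add_mono)

lemma coeff_linear_power_top:
  fixes c b :: "'a::comm_ring_1"
  shows "degree ([:c, b:] ^ n) \<le> n \<and> coeff ([:c, b:] ^ n) n = b ^ n"
proof -
  have "degree ([:c, b:] ^ n) \<le> n"
    using degree_power_le[of "[:c, b:]" n] by (auto intro: order_trans simp: degree_pCons_eq_if split: if_splits)
  moreover have "coeff ([:c, b:] ^ n) n = b ^ n"
    using coeff_prod_top[of "{..<n}" "\<lambda>_. [:c, b:]" "\<lambda>_. 1"] by simp
  ultimately show ?thesis by simp
qed

text \<open>For a hyperbolic form the choice is unique: \<open>h(e) \<noteq> 0\<close> provides at
  least one monomial, whose degree is \<open>d\<close>.\<close>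

definition homogeneous_degree :: "'n::finite mpoly \<Rightarrow> nat" where
  "homogeneous_degree h = (SOME d. \<forall>m\<in>Poly_Mapping.keys h. (\<Sum>i\<in>UNIV. Poly_Mapping.lookup m i) = d)"

locale hyperbolic_form =
  fixes h :: "'n::finite mpoly" and e :: "real^'n"
  assumes homogeneous: "homogeneous h" and hyperbolic: "hyperbolic h e"
begin

abbreviation d :: nat where "d \<equiv> homogeneous_degree h"

lemma keys_degree: "m \<in> Poly_Mapping.keys h \<Longrightarrow> (\<Sum>i\<in>UNIV. Poly_Mapping.lookup m i) = d"
  using someI_ex[OF homogeneous[unfolded homogeneous_def]] unfolding homogeneous_degree_def by blast

lemma hae_monomial_top:
  fixes a :: "real^'n"
  assumes "m \<in> Poly_Mapping.keys h"
  defines "P \<equiv> (\<Prod>i\<in>UNIV. [:a $ i, - (e $ i):] ^ Poly_Mapping.lookup m i)"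
  shows "degree P \<le> d" "coeff P d = (-1) ^ d * (\<Prod>i\<in>UNIV. (e $ i) ^ Poly_Mapping.lookup m i)"
proof -
  have "(\<Prod>i\<in>UNIV. (- (e $ i)) ^ Poly_Mapping.lookup m i)
      = (\<Prod>i\<in>UNIV. (-1) ^ Poly_Mapping.lookup m i * (e $ i) ^ Poly_Mapping.lookup m i)"
    by (simp flip: power_mult_distrib)
  also have "\<dots> = (-1) ^ d * (\<Prod>i\<in>UNIV. (e $ i) ^ Poly_Mapping.lookup m i)"
    using keys_degree[OF assms(1)] by (simp add: prod.distrib flip: power_sum)
  finally show "degree P \<le> d" "coeff P d = (-1) ^ d * (\<Prod>i\<in>UNIV. (e $ i) ^ Poly_Mapping.lookup m i)"
    using coeff_prod_top[of UNIV "\<lambda>i. [:a $ i, - (e $ i):] ^ Poly_Mapping.lookup m i" "Poly_Mapping.lookup m"]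
    by (simp_all add: coeff_linear_power_top keys_degree[OF assms(1)] P_def)
qed

text \<open>By homogeneity only the e-part of each linear factor reaches t^d, so the leading
  coefficient does not depend on \<open>a\<close>. The whole gcd argument rests on this.\<close>

lemma coeff_hae_top: "coeff (hae h e a) d = (-1) ^ d * mpoly_eval h e"
  by (simp add: hae_def coeff_sum hae_monomial_top mpoly_eval_def sum_distrib_left mult_ac)

lemma coeff_hae_top_nonzero: "coeff (hae h e a) d \<noteq> 0"
  using hyperbolic by (simp add: coeff_hae_top hyperbolic_def)

lemma degree_hae: "degree (hae h e a) = d"
proof (rule antisym)
  show "degree (hae h e a) \<le> d"
    unfolding hae_def by (intro degree_sum_le) (auto intro: order_trans[OF degree_smult_le] hae_monomial_top)
  show "d \<le> degree (hae h e a)"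
    using coeff_hae_top_nonzero by (rule le_degree)
qed

lemma hae_nonzero: "hae h e a \<noteq> 0"
  using coeff_hae_top_nonzero[of a] by auto

lemma hae_split:
  obtains c rs where "c \<noteq> 0" "hae h e a = smult c (\<Prod>r\<leftarrow>rs. [:- r, 1:])"
  using only_real_roots_split[of "hae h e a"] hyperbolic hae_nonzero[of a]
  by (metis hyperbolic_def leading_coeff_0_iff)

lemma hyp_cone_iff:
  "a \<in> hyp_cone h e \<longleftrightarrow> (\<forall>r. poly (hae h e a) r = 0 \<longrightarrow> 0 \<le> r)"
proof -
  have "z \<in> \<real>" if "poly (map_poly complex_of_real (hae h e a)) z = 0" for z
    using hyperbolic that by (auto simp: hyperbolic_def only_real_roots_def)
  then have "a \<in> hyp_cone h e \<longleftrightarrow>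
      (\<forall>r::real. poly (map_poly complex_of_real (hae h e a)) (complex_of_real r) = 0 \<longrightarrow> 0 \<le> r)"
    unfolding hyp_cone_def mem_Collect_eq by (metis Reals_cases Re_complex_of_real Reals_of_real)
  then show ?thesis by simp
qed

end

section \<open>The cone of sums of squares modulo the ideal\<close>

lemma J_gens_fin: "g \<in> J_gens h e \<Longrightarrow> nc_fin g"
  by (auto simp: J_gens_def nc_fin_diff nc_fin_polyeval)

lemma J_gens_star: "g \<in> J_gens h e \<Longrightarrow> nc_star g = g"
  by (auto simp: J_gens_def nc_star_diff nc_star_polyeval)

lemma J_zero: "0 \<in> J h e"
  using nc_ideal.zero[of "J_gens h e"] by (simp add: J_def zero_fun_def)

lemma J_add: "x \<in> J h e \<Longrightarrow> y \<in> J h e \<Longrightarrow> x + y \<in> J h e"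
  by (simp add: J_def nc_ideal.add)

lemma J_fin: "x \<in> J h e \<Longrightarrow> nc_fin x"
  unfolding J_def
  by (induction rule: nc_ideal.induct)
    (auto intro: nc_fin_intros J_gens_fin simp: nc_fin_def[of "\<lambda>_. 0"] simp del: plus_fun_apply)

lemma J_mul:
  assumes "x \<in> J h e" "nc_fin u" "nc_fin v"
  shows "nc_mul (nc_mul u x) v \<in> J h e"
  using assms(1) unfolding J_def
proof (induction rule: nc_ideal.induct)
  case zero
  have "nc_mul (nc_mul u (\<lambda>_. 0)) v = (\<lambda>_. 0)"
    by (rule ext) (simp add: nc_mul_def)
  then show ?case by (simp only: nc_ideal.zero)
next
  case (gen g u' v')
  then have "nc_mul (nc_mul (nc_mul u u') g) (nc_mul v' v) \<in> nc_ideal (J_gens h e)"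
    using assms by (intro nc_ideal.gen nc_fin_mul) auto
  then show ?case by (simp add: nc_mul_assoc)
next
  case (add x y)
  then show "nc_mul (nc_mul u (x + y)) v \<in> nc_ideal (J_gens h e)"
    by (simp only: nc_mul_add_left nc_mul_add_right nc_ideal.add)
qed

lemma J_mul_right: "x \<in> J h e \<Longrightarrow> nc_fin v \<Longrightarrow> nc_mul x v \<in> J h e"
  using J_mul[of x h e nc_one v] by simp

lemma J_smult:
  assumes "x \<in> J h e"
  shows "nc_smult c x \<in> J h e"
  using J_mul[OF assms, of "nc_smult c nc_one" nc_one] by (simp add: nc_fin_smult)

lemma J_minus: "x \<in> J h e \<Longrightarrow> - x \<in> J h e"
  using J_smult[of x h e "- 1"] by (simp add: nc_smult_minus_one)

lemma J_star: "x \<in> J h e \<Longrightarrow> nc_star x \<in> J h e"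
  unfolding J_def
proof (induction rule: nc_ideal.induct)
  case zero
  have "nc_star (\<lambda>_. 0) = ((\<lambda>_. 0) :: 'a ncpoly)"
    by (rule ext) (simp add: nc_star_def)
  then show ?case by (simp only: nc_ideal.zero)
next
  case (gen g u v)
  then have "nc_mul (nc_mul (nc_star v) g) (nc_star u) \<in> nc_ideal (J_gens h e)"
    by (intro nc_ideal.gen nc_fin_star)
  then show ?case using J_gens_star[OF gen(1)] by (simp add: nc_star_mul nc_mul_assoc)
next
  case (add x y)
  then show "nc_star (x + y) \<in> nc_ideal (J_gens h e)"
    by (simp only: nc_star_add nc_ideal.add)
qed

lemma polyeval_hae_in_J: "nc_polyeval (hae h e a) (nc_lin a) \<in> J h e"
  using nc_ideal.gen[of _ "J_gens h e" nc_one nc_one] by (auto simp: J_def J_gens_def)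

lemma one_minus_lin_in_J: "nc_one - nc_lin e \<in> J h e"
  using nc_ideal.gen[of _ "J_gens h e" nc_one nc_one] by (auto simp: J_def J_gens_def)

abbreviation nc_square :: "'n ncpoly \<Rightarrow> 'n ncpoly" where
  "nc_square p \<equiv> nc_mul (nc_star p) p"

text \<open>Antihermitian elements are included so that the cone lives in the real space of all
  finitely supported elements instead of the hermitian ones. A state then vanishes on them and is
  the real part of a hermitian complex functional.\<close>

definition sos_cone :: "'n::finite mpoly \<Rightarrow> real^'n \<Rightarrow> 'n ncpoly set" where
  "sos_cone h e = {f. \<exists>ps j k. (\<forall>p\<in>set ps. nc_fin p) \<and> j \<in> J h e \<and> nc_fin k \<and> nc_star k = - k
      \<and> f = sum_list (map nc_square ps) + j + k}"

lemma sum_list_squares_fin: "\<forall>p\<in>set ps. nc_fin p \<Longrightarrow> nc_fin (sum_list (map nc_square ps))"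
  by (induction ps) (simp_all add: nc_fin_intros)

lemma sum_list_squares_star: "nc_star (sum_list (map nc_square ps)) = sum_list (map nc_square ps)"
  by (induction ps) (simp_all only: list.map sum_list.Nil sum_list.Cons nc_star_zero nc_star_add nc_star_mul nc_star_star)

lemma sum_list_squares_conj:
  "nc_mul (nc_mul (nc_star q) (sum_list (map nc_square ps))) q = sum_list (map nc_square (map (\<lambda>p. nc_mul p q) ps))"
  by (induction ps) (simp_all only: list.map sum_list.Nil sum_list.Cons nc_mul_zero_left nc_mul_zero_right
      nc_mul_add_left nc_mul_add_right nc_star_mul nc_mul_assoc)

lemma sos_cone_fin: "f \<in> sos_cone h e \<Longrightarrow> nc_fin f"
  by (auto simp: sos_cone_def intro!: nc_fin_add sum_list_squares_fin intro: J_fin)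

lemma sos_coneI:
  assumes "\<forall>p\<in>set ps. nc_fin p" "j \<in> J h e" "nc_fin k" "nc_star k = - k"
    and "f = sum_list (map nc_square ps) + j + k"
  shows "f \<in> sos_cone h e"
  using assms unfolding sos_cone_def by blast

lemma sos_cone_add:
  assumes "f \<in> sos_cone h e" "g \<in> sos_cone h e"
  shows "f + g \<in> sos_cone h e"
proof -
  from assms obtain ps j k qs j' k' where
    *: "\<forall>p\<in>set ps. nc_fin p" "j \<in> J h e" "nc_fin k" "nc_star k = - k" "f = sum_list (map nc_square ps) + j + k"
    "\<forall>p\<in>set qs. nc_fin p" "j' \<in> J h e" "nc_fin k'" "nc_star k' = - k'" "g = sum_list (map nc_square qs) + j' + k'"
    unfolding sos_cone_def by blast
  show ?thesis
    by (rule sos_coneI[of "ps @ qs" "j + j'" h e "k + k'"])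
      (use * in \<open>auto simp: J_add nc_fin_add nc_star_add add_ac\<close>)
qed

lemma sos_cone_conj:
  assumes "f \<in> sos_cone h e" "nc_fin q"
  shows "nc_mul (nc_mul (nc_star q) f) q \<in> sos_cone h e"
proof -
  from assms obtain ps j k where
    *: "\<forall>p\<in>set ps. nc_fin p" "j \<in> J h e" "nc_fin k" "nc_star k = - k" "f = sum_list (map nc_square ps) + j + k"
    unfolding sos_cone_def by blast
  have "nc_mul (nc_mul (nc_star q) (- k)) q = - nc_mul (nc_mul (nc_star q) k) q"
    using nc_mul_diff_right[of "nc_star q" 0 k] nc_mul_diff_left[of 0 "nc_mul (nc_star q) k" q] by simp
  then have "nc_star (nc_mul (nc_mul (nc_star q) k) q) = - nc_mul (nc_mul (nc_star q) k) q"
    by (simp add: nc_star_mul nc_mul_assoc *)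
  moreover have "nc_mul (nc_mul (nc_star q) f) q = sum_list (map nc_square (map (\<lambda>p. nc_mul p q) ps))
      + nc_mul (nc_mul (nc_star q) j) q + nc_mul (nc_mul (nc_star q) k) q"
    by (simp only: *(5) nc_mul_add_left nc_mul_add_right sum_list_squares_conj)
  ultimately show ?thesis
    using * assms
    by (intro sos_coneI[of "map (\<lambda>p. nc_mul p q) ps" "nc_mul (nc_mul (nc_star q) j) q" h e
          "nc_mul (nc_mul (nc_star q) k) q"] J_mul) (auto intro: nc_fin_intros)
qed

lemma sos_cone_square: "nc_fin q \<Longrightarrow> nc_square q \<in> sos_cone h e"
  by (rule sos_coneI[of "[q]" 0 h e 0]) (simp_all add: J_zero)

lemma sos_cone_J: "j \<in> J h e \<Longrightarrow> j \<in> sos_cone h e"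
  by (rule sos_coneI[of "[]" j h e 0]) simp_all

lemma sos_cone_antihermitian: "nc_fin k \<Longrightarrow> nc_star k = - k \<Longrightarrow> k \<in> sos_cone h e"
  by (rule sos_coneI[of "[]" 0 h e k]) (simp_all add: J_zero)

lemma sos_cone_scale:
  assumes "0 \<le> r" "f \<in> sos_cone h e"
  shows "nc_smult (complex_of_real r) f \<in> sos_cone h e"
proof -
  have "nc_mul (nc_mul (nc_star (nc_smult (sqrt r) nc_one)) f) (nc_smult (sqrt r) nc_one) \<in> sos_cone h e"
    using assms by (intro sos_cone_conj nc_fin_smult) auto
  moreover have "complex_of_real (sqrt r) * complex_of_real (sqrt r) = complex_of_real r"
    using assms by (simp flip: of_real_mult)
  ultimately show ?thesis by simp
qed

text \<open>Strict positivity makes multiple roots harmless; at a zero of \<open>f\<close> they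
  would obstruct, since t is not even a sum of squares modulo t^2.\<close>

lemma (in hyperbolic_form) sos_cone_polyeval:
  assumes "\<And>r. poly (hae h e a) r = 0 \<Longrightarrow> 0 < poly f r"
  shows "nc_polyeval f (nc_lin a) \<in> sos_cone h e"
proof -
  obtain c rs where c: "c \<noteq> 0" "hae h e a = smult c (\<Prod>r\<leftarrow>rs. [:- r, 1:])"
    using hae_split by blast
  then have "\<forall>r\<in>set rs. 0 < poly f r" using assms by (simp add: poly_split_eq_0_iff)
  then obtain s where "(\<Prod>r\<leftarrow>rs. [:- r, 1:]) dvd s * s - f" using square_mod_split_poly by blast
  then have "hae h e a dvd s * s - f" using c by (simp add: smult_dvd)
  then obtain g where "s * s - f = hae h e a * g" by (elim dvdE)
  then have f: "f = s * s - hae h e a * g" by (metis diff_diff_eq2 add_diff_cancel_left')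
  have "nc_polyeval f (nc_lin a)
      = nc_square (nc_polyeval s (nc_lin a)) + - nc_mul (nc_polyeval (hae h e a) (nc_lin a)) (nc_polyeval g (nc_lin a))"
    by (subst f) (simp add: nc_polyeval_diff nc_polyeval_mult nc_star_polyeval)
  also have "\<dots> \<in> sos_cone h e"
    by (intro sos_cone_add sos_cone_square sos_cone_J J_minus J_mul_right polyeval_hae_in_J nc_fin_polyeval nc_fin_lin)
  finally show ?thesis .
qed

text \<open>The enlarged cone does not create new certificates: if \<open>x = j + k\<close> is
  hermitian and \<open>k\<close> antihermitian, averaging \<open>x\<close> with its adjoint removes
  \<open>k\<close> and leaves half of \<open>j + nc_star j\<close>, an element of the ideal.\<close>

lemma minus_one_not_in_sos_cone:
  assumes "\<not> minus_one_SOS h e"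
  shows "- nc_one \<notin> sos_cone h e"
proof
  assume "- nc_one \<in> sos_cone h e"
  then obtain ps j k where
    *: "\<forall>p\<in>set ps. nc_fin p" "j \<in> J h e" "nc_star k = - k" "- nc_one = sum_list (map nc_square ps) + j + k"
    unfolding sos_cone_def by blast
  define x where "x = - nc_one - sum_list (map nc_square ps)"
  have "x = j + k"
    using *(4) by (simp add: x_def)
  moreover have "nc_star x = x"
    by (simp only: x_def nc_star_diff nc_star_minus nc_star_one sum_list_squares_star)
  ultimately have "x = nc_star j - k"
    using *(3) by (metis nc_star_add add_uminus_conv_diff)
  with \<open>x = j + k\<close> have "x + x = (j + k) + (nc_star j - k)" by simp
  also have "\<dots> = j + nc_star j" by simp
  finally have "x + x = j + nc_star j" .
  then have "nc_smult (1/2) (x + x) \<in> J h e"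
    using * by (simp only: J_smult J_add J_star)
  moreover have "nc_smult (1/2) (x + x) = x" for x :: "'a ncpoly"
    by (rule ext) (simp add: nc_smult_def)
  ultimately have "x \<in> J h e" by (simp only:)
  then have "minus_one_SOS h e"
    unfolding minus_one_SOS_def x_def using *(1) by (intro exI[of _ ps] conjI)
  then show False using assms by contradiction
qed

section \<open>The unit dominates every element\<close>

definition sos_bounded :: "'n::finite mpoly \<Rightarrow> real^'n \<Rightarrow> 'n ncpoly \<Rightarrow> bool" where
  "sos_bounded h e f \<longleftrightarrow> (\<exists>r. nc_smult (complex_of_real r) nc_one - f \<in> sos_cone h e)"

lemma sos_bounded_add:
  assumes "sos_bounded h e f" "sos_bounded h e g"
  shows "sos_bounded h e (f + g)"
proof -
  from assms obtain r s where "nc_smult (complex_of_real r) nc_one - f \<in> sos_cone h e"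
     "nc_smult (complex_of_real s) nc_one - g \<in> sos_cone h e" by (auto simp: sos_bounded_def)
  then have "(nc_smult (complex_of_real r) nc_one - f) + (nc_smult (complex_of_real s) nc_one - g) \<in> sos_cone h e"
    by (rule sos_cone_add)
  also have "(nc_smult (complex_of_real r) nc_one - f) + (nc_smult (complex_of_real s) nc_one - g)
     = nc_smult (complex_of_real (r + s)) nc_one - (f + g)"
    by (simp add: nc_smult_add_left)
  finally show ?thesis unfolding sos_bounded_def by blast
qed

context hyperbolic_form begin

lemma sos_bounded_var_square:
  "sos_bounded h e (nc_mul (nc_var i) (nc_var i))"
proof -
  let ?p = "hae h e (axis i 1)"
  have "finite {r. poly ?p r = 0}"
    using hae_nonzero by (rule poly_roots_finite)
  then have "bdd_above ((\<lambda>r. r * r) ` {r. poly ?p r = 0})" by simp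
  then obtain c where "\<And>r. poly ?p r = 0 \<Longrightarrow> r * r \<le> c" by (auto simp: bdd_above_def)
  \<comment> \<open>The polynomial is c + 1 - t^2; the extra 1 turns the bound on the squared roots
    into strict positivity.\<close>
  then have "0 < poly [:c + 1, 0, - 1:] r" if "poly ?p r = 0" for r
    using that by (simp add: algebra_simps) (metis add.commute le_less_trans less_add_one)
  then have "nc_polyeval [:c + 1, 0, - 1:] (nc_lin (axis i 1)) \<in> sos_cone h e"
    by (rule sos_cone_polyeval)
  moreover have "nc_polyeval [:c + 1, 0, - 1:] (nc_lin (axis i 1))
      = nc_smult (complex_of_real (c + 1)) nc_one - nc_mul (nc_var i) (nc_var i)"
    by (simp only: nc_polyeval_pCons nc_polyeval_0 nc_lin_axis nc_mul_zero_right of_real_0 nc_smult_zero_left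
      of_real_minus of_real_1 nc_smult_minus_one add_0 add_0_right)
      (simp only: nc_mul_diff_right[of _ 0, simplified] nc_mul_one_right, simp)
  ultimately show ?thesis unfolding sos_bounded_def by metis
qed

text \<open>Conjugating the bound on z_i^2 by \<open>w\<close> bounds the square of z_i w by a
  multiple of the square of \<open>w\<close>, to which the induction hypothesis applies.\<close>

lemma sos_bounded_word_square:
  "sos_bounded h e (nc_square (nc_word w))"
proof (induction w)
  case Nil
  have "nc_smult (complex_of_real 1) nc_one - nc_square (nc_word []) = (0 :: 'n ncpoly)"
    by (simp add: nc_word_Nil)
  then show ?case unfolding sos_bounded_def by (metis J_zero sos_cone_J)
next
  case (Cons i w)
  then obtain r where r: "nc_smult (complex_of_real r) nc_one - nc_square (nc_word w) \<in> sos_cone h e"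
    by (auto simp: sos_bounded_def)
  obtain s where s: "nc_smult (complex_of_real s) nc_one - nc_mul (nc_var i) (nc_var i) \<in> sos_cone h e"
    using sos_bounded_var_square by (auto simp: sos_bounded_def)
  \<comment> \<open>The induction hypothesis is scaled by this bound, so it must be
    nonnegative.\<close>
  define s' where "s' = max s 0"
  have s': "nc_smult (complex_of_real s') nc_one - nc_mul (nc_var i) (nc_var i) \<in> sos_cone h e"
  proof -
    have "(nc_smult (complex_of_real s) nc_one - nc_mul (nc_var i) (nc_var i))
        + nc_smult (complex_of_real (s' - s)) (nc_square nc_one) \<in> sos_cone h e"
      by (intro sos_cone_add s sos_cone_scale sos_cone_square nc_fin_one) (simp add: s'_def)
    then show ?thesis by (simp add: nc_smult_diff_left)
  qed
  have "nc_mul (nc_mul (nc_star (nc_word w)) (nc_smult (complex_of_real s') nc_one - nc_mul (nc_var i) (nc_var i))) (nc_word w)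
     + nc_smult (complex_of_real s') (nc_smult (complex_of_real r) nc_one - nc_square (nc_word w)) \<in> sos_cone h e"
    using r s' by (intro sos_cone_add sos_cone_conj sos_cone_scale) (auto simp: s'_def)
  also have "nc_mul (nc_mul (nc_star (nc_word w)) (nc_smult (complex_of_real s') nc_one - nc_mul (nc_var i) (nc_var i))) (nc_word w)
     + nc_smult (complex_of_real s') (nc_smult (complex_of_real r) nc_one - nc_square (nc_word w))
     = nc_smult (complex_of_real (s' * r)) nc_one - nc_square (nc_word (i # w))"
    by (simp add: nc_mul_diff_left nc_mul_diff_right nc_smult_diff_right nc_word_Cons nc_star_mul nc_mul_assoc)
  finally show ?case unfolding sos_bounded_def by blast
qed

text \<open>Expand the square of 1 - A as 1 - A - A^* + A^* A. The antihermitian term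
  \<open>nc_star A - A\<close> turns this into 1 - 2 A + A^* A, and the last summand is bounded by
  the square of the word.\<close>

lemma sos_bounded_smult_word:
  "sos_bounded h e (nc_smult \<alpha> (nc_word w))"
proof -
  let ?W = "nc_word w"
  obtain r where r: "nc_smult (complex_of_real r) nc_one - nc_square ?W \<in> sos_cone h e"
    using sos_bounded_word_square by (auto simp: sos_bounded_def)
  define A where "A = nc_smult \<alpha> ?W"
  define c where "c = (cmod \<alpha>)\<^sup>2"
  have AA: "nc_square A = nc_smult (complex_of_real c) (nc_square ?W)"
  proof -
    have "complex_of_real c = \<alpha> * cnj \<alpha>"
      unfolding c_def by (rule complex_norm_square)
    then show ?thesis by (simp add: A_def)
  qed
  have "nc_square (nc_one - A) + nc_smult (complex_of_real c) (nc_smult (complex_of_real r) nc_one - nc_square ?W)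
      + (nc_star A - A) \<in> sos_cone h e"
    by (intro sos_cone_add sos_cone_square sos_cone_scale[OF _ r] sos_cone_antihermitian)
       (simp_all add: nc_fin_intros A_def nc_star_diff c_def)
  also have "nc_square (nc_one - A) + nc_smult (complex_of_real c) (nc_smult (complex_of_real r) nc_one - nc_square ?W)
      + (nc_star A - A) = nc_smult (complex_of_real (1 + c * r)) nc_one - nc_smult 2 A"
  proof -
    have "nc_smult 2 A = A + A" using nc_smult_add_left[of 1 1 A] by simp
    then show ?thesis
      by (simp add: nc_star_diff nc_mul_diff_left nc_mul_diff_right AA nc_smult_diff_right nc_smult_add_left)
  qed
  finally have "nc_smult (complex_of_real (1/2)) (nc_smult (complex_of_real (1 + c * r)) nc_one - nc_smult 2 A) \<in> sos_cone h e"
    by (rule sos_cone_scale[rotated]) simp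
  then have "nc_smult (complex_of_real ((1 + c * r) / 2)) nc_one - A \<in> sos_cone h e"
    by (simp add: nc_smult_diff_right del: minus_apply)
  then show ?thesis unfolding sos_bounded_def A_def by blast
qed

lemma sos_bounded_fin:
  assumes "nc_fin f"
  shows "sos_bounded h e f"
proof -
  have "sos_bounded h e (\<Sum>w\<in>W. nc_smult (f w) (nc_word w))" if "finite W" for W
    using that
  proof (induction W rule: finite_induct)
    case empty
    have "nc_smult (complex_of_real 0) nc_one - 0 \<in> sos_cone h e"
      by (simp add: sos_cone_J J_zero)
    then show ?case unfolding sos_bounded_def by (metis sum.empty)
  next
    case (insert w W)
    then show ?case
      by (simp only: sum.insert not_False_eq_True) (intro sos_bounded_add sos_bounded_smult_word)
  qed
  moreover have "f = (\<Sum>w\<in>{w. f w \<noteq> 0}. nc_smult (f w) (nc_word w))"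
    using assms by (intro nc_expand_words) (auto simp: nc_fin_def)
  ultimately show ?thesis using assms by (metis nc_fin_def)
qed

lemma state_exists:
  assumes "\<not> minus_one_SOS h e"
  obtains L :: "'n ncpoly \<Rightarrow> real" where
    "\<And>x y. nc_fin x \<Longrightarrow> nc_fin y \<Longrightarrow> L (x + y) = L x + L y"
    "\<And>r x. nc_fin x \<Longrightarrow> L (nc_smult (complex_of_real r) x) = r * L x"
    "\<And>x. x \<in> sos_cone h e \<Longrightarrow> 0 \<le> L x" "L nc_one = 1"
proof -
  \<comment> \<open>Only real scalars act, as the cone is not stable under complex ones; the complex
    structure is recovered by \<open>\<phi>\<close>.\<close>
  let ?sc = "\<lambda>r::real. nc_smult (complex_of_real r) :: 'n ncpoly \<Rightarrow> 'n ncpoly"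
  have vs: "vector_space ?sc"
    by unfold_locales (simp_all add: nc_smult_add_right nc_smult_add_left)
  then interpret vector_space ?sc .
  have sub: "subspace {f :: 'n ncpoly. nc_fin f}"
    unfolding subspace_def by (simp add: nc_fin_intros)
  have one: "(nc_one :: 'n ncpoly) \<in> sos_cone h e"
    using sos_cone_square[of nc_one h e] by simp
  obtain L where "\<And>x y. x \<in> {f :: 'n ncpoly. nc_fin f} \<Longrightarrow> y \<in> {f. nc_fin f} \<Longrightarrow> L (x + y) = L x + (L y :: real)"
    "\<And>r x. x \<in> {f :: 'n ncpoly. nc_fin f} \<Longrightarrow> L (?sc r x) = r * L x"
    "\<And>x. x \<in> sos_cone h e \<Longrightarrow> 0 \<le> L x" "L nc_one = 1"
  proof (rule cone_state_exists[OF vs sub])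
    show "sos_cone h e \<subseteq> {f. nc_fin f}" using sos_cone_fin by blast
    show "\<exists>r. ?sc r nc_one - x \<in> sos_cone h e" if "x \<in> {f. nc_fin f}" for x
      using sos_bounded_fin that by (auto simp: sos_bounded_def)
  qed (use one minus_one_not_in_sos_cone[OF assms] in \<open>auto intro: sos_cone_add sos_cone_scale\<close>)
  then show ?thesis by (intro that[of L]) simp_all
qed

end

section \<open>Polynomial functions on boxes\<close>

text \<open>Total degree is measured by restriction to affine lines. This is stable under sums and
  products without reference to monomials, and it supplies a degree bound that is uniform over all
  lines.\<close>

definition total_degree_le :: "nat \<Rightarrow> (real^'n \<Rightarrow> real) \<Rightarrow> bool" where
  "total_degree_le N f \<longleftrightarrow> real_polynomial_function f \<and>
     (\<forall>a c. \<exists>p. degree p \<le> N \<and> (\<forall>s. f (a + s *\<^sub>R c) = poly p s))"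

lemma total_degree_le_mono: "total_degree_le M f \<Longrightarrow> M \<le> N \<Longrightarrow> total_degree_le N f"
  unfolding total_degree_le_def by (meson le_trans)

lemma total_degree_le_const: "total_degree_le N (\<lambda>_. c)"
  unfolding total_degree_le_def by (auto intro!: exI[of _ "[:c:]"])

lemma total_degree_le_linear:
  assumes "bounded_linear f"
  shows "total_degree_le 1 f"
proof -
  interpret bounded_linear f by fact
  have "degree [:f a, f c:] \<le> 1 \<and> (\<forall>s. f (a + s *\<^sub>R c) = poly [:f a, f c:] s)" for a c
    by (simp add: add scaleR)
  then show ?thesis using assms unfolding total_degree_le_def by blast
qed

lemma total_degree_le_add:
  assumes "total_degree_le N f" "total_degree_le N g"
  shows "total_degree_le N (\<lambda>x. f x + g x)"
  unfolding total_degree_le_def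
proof (intro conjI allI)
  show "real_polynomial_function (\<lambda>x. f x + g x)"
    using assms by (auto simp: total_degree_le_def)
  fix a c
  obtain p q where "degree p \<le> N" "\<forall>s. f (a + s *\<^sub>R c) = poly p s" "degree q \<le> N" "\<forall>s. g (a + s *\<^sub>R c) = poly q s"
    using assms unfolding total_degree_le_def by meson
  then show "\<exists>p. degree p \<le> N \<and> (\<forall>s. f (a + s *\<^sub>R c) + g (a + s *\<^sub>R c) = poly p s)"
    by (intro exI[of _ "p + q"]) (simp add: degree_add_le)
qed

lemma total_degree_le_mult:
  assumes "total_degree_le M f" "total_degree_le N g"
  shows "total_degree_le (M + N) (\<lambda>x. f x * g x)"
  unfolding total_degree_le_def
proof (intro conjI allI)
  show "real_polynomial_function (\<lambda>x. f x * g x)"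
    using assms by (auto simp: total_degree_le_def)
  fix a c
  obtain p q where "degree p \<le> M" "\<forall>s. f (a + s *\<^sub>R c) = poly p s" "degree q \<le> N" "\<forall>s. g (a + s *\<^sub>R c) = poly q s"
    using assms unfolding total_degree_le_def by meson
  then show "\<exists>p. degree p \<le> M + N \<and> (\<forall>s. f (a + s *\<^sub>R c) * g (a + s *\<^sub>R c) = poly p s)"
    by (intro exI[of _ "p * q"]) (auto intro: order_trans[OF degree_mult_le] add_mono)
qed

lemma total_degree_le_sum:
  "(\<And>i. i \<in> I \<Longrightarrow> total_degree_le N (f i)) \<Longrightarrow> total_degree_le N (\<lambda>x. \<Sum>i\<in>I. f i x)"
  by (induction I rule: infinite_finite_induct) (simp_all add: total_degree_le_const total_degree_le_add)

lemma total_degree_le_exists: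
  assumes "real_polynomial_function f"
  shows "\<exists>N. total_degree_le N f"
  using assms
proof induction
  case (add f g)
  then obtain M N where "total_degree_le M f" "total_degree_le N g" by blast
  then have "total_degree_le (max M N) (\<lambda>x. f x + g x)"
    by (intro total_degree_le_add) (auto elim: total_degree_le_mono)
  then show ?case ..
qed (blast intro: total_degree_le_linear total_degree_le_const total_degree_le_mult)+

text \<open>On the line through \<open>a\<close> and \<open>x\<close> the function is a univariate
  polynomial that vanishes for all small parameters, hence also at the parameter 1.\<close>

lemma polynomial_function_eq_0:
  fixes f :: "real^'n \<Rightarrow> real"
  assumes "real_polynomial_function f" "open U" "a \<in> U" "\<And>x. x \<in> U \<Longrightarrow> f x = 0"
  shows "f x = 0"
proof -
  obtain p where p: "\<And>s. f (a + s *\<^sub>R (x - a)) = poly p s"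
    using total_degree_le_exists[OF assms(1)] unfolding total_degree_le_def by metis
  have "((\<lambda>s. a + s *\<^sub>R (x - a)) \<longlongrightarrow> a + 0 *\<^sub>R (x - a)) (at 0)"
    by (intro tendsto_intros)
  then have "\<forall>\<^sub>F s in at 0. a + s *\<^sub>R (x - a) \<in> U"
    using assms by (intro topological_tendstoD) auto
  then obtain \<epsilon> where "\<epsilon> > 0" "\<And>s. s \<noteq> 0 \<Longrightarrow> dist s 0 < \<epsilon> \<Longrightarrow> a + s *\<^sub>R (x - a) \<in> U"
    unfolding eventually_at by auto
  then have "{0<..<\<epsilon>} \<subseteq> {s. poly p s = 0}"
    using assms p by (auto simp flip: p)
  moreover have "infinite {0<..<\<epsilon>}" using \<open>\<epsilon> > 0\<close> by simp
  ultimately have "p = 0" using poly_roots_finite finite_subset by blast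
  then show ?thesis using p[of 1] by simp
qed

lemma polynomial_function_extend_eq:
  fixes f g :: "real^'n \<Rightarrow> real"
  assumes "real_polynomial_function f" "real_polynomial_function g" "open U" "a \<in> U" "\<And>x. x \<in> U \<Longrightarrow> f x = g x"
  shows "f x = g x"
  using polynomial_function_eq_0[of "\<lambda>x. f x - g x" U a x] assms by auto

lemma isCont_polynomial_function: "real_polynomial_function f \<Longrightarrow> isCont f x"
  for f :: "real^'n \<Rightarrow> real"
  using continuous_real_polymonial_function by blast

text \<open>Lagrange interpolation, one coordinate at a time.\<close>

lemma polynomial_on_box_if_polynomial_on_lines:
  fixes F :: "real^'n \<Rightarrow> real"
  assumes lu: "\<And>i. l $ i < u $ i"
    and line: "\<And>x i. x \<in> box l u \<Longrightarrow> \<exists>p. degree p \<le> N \<and>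
        (\<forall>s. x + s *\<^sub>R axis i 1 \<in> box l u \<longrightarrow> F (x + s *\<^sub>R axis i 1) = poly p s)"
  shows "\<exists>P. real_polynomial_function P \<and> (\<forall>x\<in>box l u. F x = P x)"
proof -
  define upd where "upd x i t = x + (t - x $ i) *\<^sub>R axis i 1" for x :: "real^'n" and i t
  have upd_nth: "upd x i t $ j = (if j = i then t else x $ j)" for x i t j
    by (simp add: upd_def axis_def)
  have upd_box: "upd x i t \<in> box l u" if "x \<in> box l u" "l $ i < t" "t < u $ i" for x i t
    using that by (simp add: mem_box_cart upd_nth)
  have upd_poly: "polynomial_function (\<lambda>x. upd x i t)" for i t
    unfolding upd_def
    by (intro polynomial_function_add polynomial_function_id polynomial_function_mult polynomial_function_const
        polynomial_function_diff polynomial_function_bounded_linear bounded_linear_vec_nth)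
  \<comment> \<open>Induction on the set \<open>I\<close> of coordinates that may vary; the others
    are frozen at those of \<open>c\<close>, and \<open>P\<close> may depend on \<open>c\<close>.
    For \<open>I = UNIV\<close> nothing is frozen.\<close>
  have "\<forall>c\<in>box l u. \<exists>P. real_polynomial_function P \<and> (\<forall>x\<in>box l u. (\<forall>i. i \<notin> I \<longrightarrow> x $ i = c $ i) \<longrightarrow> F x = P x)"
    if "finite I" for I
    using that
  proof (induction I rule: finite_induct)
    case empty
    show ?case
    proof
      fix c
      show "\<exists>P. real_polynomial_function P \<and> (\<forall>x\<in>box l u. (\<forall>i. i \<notin> {} \<longrightarrow> x $ i = c $ i) \<longrightarrow> F x = P x)"
        by (rule exI[of _ "\<lambda>_. F c"]) (auto simp: vec_eq_iff[symmetric])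
    qed
  next
    case (insert i I)
    show ?case
    proof
      fix c assume c: "c \<in> box l u"
      have "infinite {l $ i<..<u $ i}" using lu by simp
      \<comment> \<open>One set of \<open>N + 1\<close> nodes serves all lines in direction
        \<open>i\<close>, which is why the degree bound has to be uniform.\<close>
      then obtain T where T: "finite T" "card T = Suc N" "T \<subseteq> {l $ i<..<u $ i}"
        using infinite_arbitrarily_large by blast
      have "\<forall>t\<in>T. \<exists>P. real_polynomial_function P \<and>
          (\<forall>x\<in>box l u. (\<forall>j. j \<notin> I \<longrightarrow> x $ j = upd c i t $ j) \<longrightarrow> F x = P x)"
        using insert.IH upd_box[OF c] T(3) by fastforce
      then obtain P where P: "\<And>t. t \<in> T \<Longrightarrow> real_polynomial_function (P t)"
        "\<And>t x. t \<in> T \<Longrightarrow> x \<in> box l u \<Longrightarrow> (\<And>j. j \<notin> I \<Longrightarrow> x $ j = upd c i t $ j) \<Longrightarrow> F x = P t x"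
        by metis
      \<comment> \<open>The slices at \<open>x $ i = t\<close> are polynomial by induction; the
        Lagrange basis polynomials in \<open>x $ i\<close> blend them.\<close>
      define Q where "Q x = (\<Sum>t\<in>T. P t (upd x i t) * (\<Prod>s\<in>T - {t}. (x $ i - s) / (t - s)))" for x
      have "real_polynomial_function Q"
        unfolding Q_def
      proof (intro real_polynomial_function_sum real_polynomial_function.intros(4) real_polynomial_function_prod
          real_polynomial_function_divide real_polynomial_function_diff)
        show "real_polynomial_function (\<lambda>x. P t (upd x i t))" if "t \<in> T" for t
          using real_polynomial_function_compose[OF upd_poly P(1)[OF that]] by (simp add: o_def)
        show "real_polynomial_function (\<lambda>x :: real^'n. x $ i)"
          by (intro real_polynomial_function.intros(1) bounded_linear_vec_nth)
      qed (use T in auto)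
      moreover have "F x = Q x" if x: "x \<in> box l u" "\<forall>j. j \<notin> insert i I \<longrightarrow> x $ j = c $ j" for x
      proof -
        obtain p where p: "degree p \<le> N" "\<And>s. x + s *\<^sub>R axis i 1 \<in> box l u \<Longrightarrow> F (x + s *\<^sub>R axis i 1) = poly p s"
          using line[OF x(1)] by blast
        \<comment> \<open>Reparametrizes the line by its \<open>i\<close>-th coordinate, so that its
          parameter values can be compared with the nodes.\<close>
        define q where "q = pcompose p [:- (x $ i), 1:]"
        have q: "F (upd x i t) = poly q t" if "l $ i < t" "t < u $ i" for t
          using p(2)[of "t - x $ i"] upd_box[OF x(1) that] by (simp add: upd_def q_def poly_pcompose)
        define R where "R = (\<Sum>t\<in>T. smult (poly q t) (\<Prod>s\<in>T - {t}. smult (1 / (t - s)) [:- s, 1:]))"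
        have R: "poly R y = (\<Sum>t\<in>T. poly q t * (\<Prod>s\<in>T - {t}. (y - s) / (t - s)))" for y
          by (simp add: R_def poly_sum poly_prod diff_divide_distrib)
        have qR: "q = R"
        proof (rule poly_eqI_degree)
          show "poly q t = poly R t" if "t \<in> T" for t
          proof -
            have "poly R t = (\<Sum>t'\<in>T. if t' = t then poly q t else 0)"
              unfolding R
            proof (rule sum.cong)
              fix t' assume "t' \<in> T"
              show "poly q t' * (\<Prod>s\<in>T - {t'}. (t - s) / (t' - s)) = (if t' = t then poly q t else 0)"
              proof (cases "t' = t")
                case False
                then have "(\<Prod>s\<in>T - {t'}. (t - s) / (t' - s)) = 0"
                  using T(1) \<open>t \<in> T\<close> by (intro prod_zero) auto
                then show ?thesis using False by simp
              qed simp
            qed simp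
            then show ?thesis using T(1) that by simp
          qed
          have "degree q \<le> N" using p(1) degree_pcompose_le[of p "[:- (x $ i), 1:]"] by (simp add: q_def)
          then show "degree q < card T" using T by simp
          have "degree (\<Prod>s\<in>T - {t}. smult (1 / (t - s)) [:- s, 1:]) \<le> N" if "t \<in> T" for t
          proof -
            have "degree (\<Prod>s\<in>T - {t}. smult (1 / (t - s)) [:- s, 1:]) \<le> (\<Sum>s\<in>T - {t}. degree (smult (1 / (t - s)) [:- s, 1:]))"
              using T(1) degree_prod_sum_le[of "T - {t}" "\<lambda>s. smult (1 / (t - s)) [:- s, 1:]"] by (simp add: o_def)
            also have "\<dots> \<le> (\<Sum>s\<in>T - {t}. 1)"
              by (intro sum_mono) (simp add: degree_smult_le[THEN order_trans])
            also have "\<dots> = N" using T that by simp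
            finally show ?thesis .
          qed
          then have "degree R \<le> N"
            unfolding R_def using T(1) by (intro degree_sum_le) (auto intro: order_trans[OF degree_smult_le])
          then show "degree R < card T" using T by simp
        qed
        have Fq: "F x = poly q (x $ i)"
          using q[of "x $ i"] x(1) by (simp add: upd_def mem_box_cart)
        have qP: "poly q t = P t (upd x i t)" if "t \<in> T" for t
        proof -
          have t: "l $ i < t" "t < u $ i" using that T(3) by auto
          have "F (upd x i t) = P t (upd x i t)"
            using that x t by (intro P(2) upd_box) (auto simp: upd_nth)
          then show ?thesis using q t by simp
        qed
        have "F x = (\<Sum>t\<in>T. poly q t * (\<Prod>s\<in>T - {t}. (x $ i - s) / (t - s)))"
          using R[of "x $ i"] Fq by (simp only: flip: qR)
        also have "\<dots> = Q x"
          unfolding Q_def by (intro sum.cong) (simp_all only: qP)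
        finally show ?thesis .
      qed
      ultimately show "\<exists>P. real_polynomial_function P \<and>
          (\<forall>x\<in>box l u. (\<forall>j. j \<notin> insert i I \<longrightarrow> x $ j = c $ j) \<longrightarrow> F x = P x)" by blast
    qed
  qed
  moreover have "(\<chi> i. (l $ i + u $ i) / 2) \<in> box l u"
    using lu by (simp add: mem_box_cart field_simps)
  ultimately show ?thesis by (metis UNIV_I finite)
qed

section \<open>Polynomials as polynomial functions\<close>

definition monomial_eval :: "('n::finite \<Rightarrow>\<^sub>0 nat) \<Rightarrow> real^'n \<Rightarrow> real" where
  "monomial_eval m a = (\<Prod>i\<in>UNIV. (a $ i) ^ Poly_Mapping.lookup m i)"

lemma monomial_eval_add: "monomial_eval (m + m') a = monomial_eval m a * monomial_eval m' a"
  by (simp add: monomial_eval_def lookup_add power_add prod.distrib)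

lemma mpoly_eval_superset:
  assumes "finite K" "Poly_Mapping.keys p \<subseteq> K"
  shows "mpoly_eval p a = (\<Sum>m\<in>K. Poly_Mapping.lookup p m * monomial_eval m a)"
  unfolding mpoly_eval_def monomial_eval_def
  by (rule sum.mono_neutral_left) (use assms in \<open>auto simp: in_keys_iff\<close>)

lemma mpoly_eval_0: "mpoly_eval 0 a = 0"
  by (simp add: mpoly_eval_def)

lemma mpoly_eval_add: "mpoly_eval (p + q) a = mpoly_eval p a + mpoly_eval q a"
proof -
  let ?K = "Poly_Mapping.keys p \<union> Poly_Mapping.keys q"
  have "mpoly_eval r a = (\<Sum>m\<in>?K. Poly_Mapping.lookup r m * monomial_eval m a)"
    if "Poly_Mapping.keys r \<subseteq> ?K" for r
    using that by (intro mpoly_eval_superset) auto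
  then show ?thesis
    by (simp add: keys_add lookup_add distrib_right sum.distrib)
qed

lemma mpoly_eval_sum: "mpoly_eval (\<Sum>i\<in>I. f i) a = (\<Sum>i\<in>I. mpoly_eval (f i) a)"
  by (induction I rule: infinite_finite_induct) (simp_all add: mpoly_eval_0 mpoly_eval_add)

lemma mpoly_eval_single: "mpoly_eval (Poly_Mapping.single m c) a = c * monomial_eval m a"
  by (simp add: mpoly_eval_superset[of "{m}"])

lemma mpoly_eq_sum_single: "p = (\<Sum>m\<in>Poly_Mapping.keys p. Poly_Mapping.single m (Poly_Mapping.lookup p m))"
  by (rule poly_mapping_eqI) (simp add: lookup_sum lookup_single when_def in_keys_iff)

lemma mpoly_eval_mult: "mpoly_eval (p * q) a = mpoly_eval p a * mpoly_eval q a"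
proof -
  have "p * q = (\<Sum>m\<in>Poly_Mapping.keys p. Poly_Mapping.single m (Poly_Mapping.lookup p m)) *
     (\<Sum>m\<in>Poly_Mapping.keys q. Poly_Mapping.single m (Poly_Mapping.lookup q m))"
    by (simp flip: mpoly_eq_sum_single)
  then have "mpoly_eval (p * q) a = (\<Sum>m\<in>Poly_Mapping.keys p. \<Sum>m'\<in>Poly_Mapping.keys q.
      (Poly_Mapping.lookup p m * monomial_eval m a) * (Poly_Mapping.lookup q m' * monomial_eval m' a))"
    by (simp add: sum_product mult_single mpoly_eval_sum mpoly_eval_single monomial_eval_add mult_ac)
  then show ?thesis
    by (simp add: sum_product mpoly_eval_superset[OF finite_keys order_refl])
qed

lemma mpoly_eval_1: "mpoly_eval 1 a = 1"
  using mpoly_eval_single[of 0 1 a] by (simp add: monomial_eval_def)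

lemma polynomial_function_mpoly_eval: "real_polynomial_function (mpoly_eval p)"
  unfolding mpoly_eval_def
  by (intro real_polynomial_function_sum real_polynomial_function.intros(4) real_polynomial_function_prod
      real_polynomial_function_power real_polynomial_function.intros(2) real_polynomial_function.intros(1)
      bounded_linear_vec_nth) auto

lemma polynomial_function_is_mpoly_eval:
  fixes f :: "real^'n \<Rightarrow> real"
  assumes "real_polynomial_function f"
  shows "\<exists>p. \<forall>a. f a = mpoly_eval p a"
  using assms
proof induction
  case (linear f)
  then interpret bounded_linear f .
  have "f a = mpoly_eval (\<Sum>i\<in>UNIV. Poly_Mapping.single (Poly_Mapping.single i 1) (f (axis i 1))) a" for a
  proof -
    have "monomial_eval (Poly_Mapping.single i 1) a = a $ i" for i
    proof -
      have "monomial_eval (Poly_Mapping.single i 1) a = (\<Prod>j\<in>UNIV. if j = i then a $ i else 1)"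
        unfolding monomial_eval_def by (rule prod.cong) (auto simp: lookup_single when_def)
      then show ?thesis by simp
    qed
    moreover have "f a = (\<Sum>i\<in>UNIV. f (axis i 1) * a $ i)"
    proof -
      have "a = (\<Sum>i\<in>UNIV. (a $ i) *\<^sub>R axis i 1)"
        using basis_expansion[of a] by (simp add: scalar_mult_eq_scaleR)
      then have "f a = f (\<Sum>i\<in>UNIV. (a $ i) *\<^sub>R axis i 1)" by simp
      then show ?thesis by (simp add: sum scaleR mult.commute)
    qed
    ultimately show ?thesis by (simp add: mpoly_eval_sum mpoly_eval_single)
  qed
  then show ?case by blast
next
  case (const c)
  have "c = mpoly_eval (Poly_Mapping.single 0 c) a" for a :: "real^'n"
    by (simp add: mpoly_eval_single monomial_eval_def)
  then show ?case by blast
next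
  case (add f g)
  then show ?case by (metis mpoly_eval_add)
next
  case (mult f g)
  then show ?case by (metis mpoly_eval_mult)
qed

text \<open>Reading the sum as a polynomial in \<open>x i\<close> alone and extracting one
  coefficient keeps only the monomials with a fixed exponent of \<open>x i\<close>. When all
  variables are consumed, a single monomial is left.\<close>

lemma sum_monomials_eq_0_imp_coeff_0:
  fixes c :: "('n::finite \<Rightarrow>\<^sub>0 nat) \<Rightarrow> real"
  assumes "finite I" "finite S"
    and "\<And>m m' i. m \<in> S \<Longrightarrow> m' \<in> S \<Longrightarrow> i \<notin> I \<Longrightarrow> Poly_Mapping.lookup m i = Poly_Mapping.lookup m' i"
    and "\<And>x :: 'n \<Rightarrow> real. (\<Sum>m\<in>S. c m * (\<Prod>i\<in>I. x i ^ Poly_Mapping.lookup m i)) = 0"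
    and "m \<in> S"
  shows "c m = 0"
  using assms
proof (induction I arbitrary: S m rule: finite_induct)
  case empty
  have "m' = m" if "m' \<in> S" for m'
    using that empty.prems(2)[OF that empty.prems(4)] by (intro poly_mapping_eqI) simp
  then have "S = {m}" using empty.prems(4) by blast
  then show ?case using empty.prems(3) by simp
next
  case (insert i I)
  define S' where "S' = {m'\<in>S. Poly_Mapping.lookup m' i = Poly_Mapping.lookup m i}"
  have "(\<Sum>m'\<in>S'. c m' * (\<Prod>j\<in>I. x j ^ Poly_Mapping.lookup m' j)) = 0" for x :: "'n \<Rightarrow> real"
  proof -
    define p where "p = (\<Sum>m'\<in>S. monom (c m' * (\<Prod>j\<in>I. x j ^ Poly_Mapping.lookup m' j)) (Poly_Mapping.lookup m' i))"
    have "poly p t = 0" for t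
    proof -
      have "(\<Prod>j\<in>I. (x(i := t)) j ^ Poly_Mapping.lookup m' j) = (\<Prod>j\<in>I. x j ^ Poly_Mapping.lookup m' j)" for m'
        using insert.hyps by (intro prod.cong) auto
      then show ?thesis
        using insert.prems(3)[of "x(i := t)"] insert.hyps
        by (simp add: p_def poly_sum poly_monom mult_ac)
    qed
    then have "p = 0" using poly_all_0_iff_0 by blast
    then have "coeff p (Poly_Mapping.lookup m i) = 0" by simp
    moreover have "coeff p (Poly_Mapping.lookup m i) = (\<Sum>m'\<in>S'. c m' * (\<Prod>j\<in>I. x j ^ Poly_Mapping.lookup m' j))"
      unfolding S'_def using insert.prems(1) by (simp add: p_def coeff_sum sum.inter_filter)
    ultimately show ?thesis by simp
  qed
  moreover have "Poly_Mapping.lookup m1 j = Poly_Mapping.lookup m2 j" if "m1 \<in> S'" "m2 \<in> S'" "j \<notin> I" for m1 m2 j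
    using that insert.prems(2)[of m1 m2 j] by (cases "j = i") (auto simp: S'_def)
  moreover have "finite S'" "m \<in> S'" using insert.prems(1,4) by (simp_all add: S'_def)
  ultimately show ?case by (intro insert.IH[of S' m])
qed

lemma mpoly_eval_inj:
  assumes "\<And>a. mpoly_eval p a = mpoly_eval q a"
  shows "p = q"
proof -
  define K where "K = Poly_Mapping.keys p \<union> Poly_Mapping.keys q"
  have "Poly_Mapping.lookup p m - Poly_Mapping.lookup q m = 0" if "m \<in> K" for m
  proof (rule sum_monomials_eq_0_imp_coeff_0[of UNIV K _ m])
    fix x :: "'a \<Rightarrow> real"
    have "(\<Sum>m\<in>K. Poly_Mapping.lookup r m * (\<Prod>i\<in>UNIV. x i ^ Poly_Mapping.lookup m i)) = mpoly_eval r (\<chi> i. x i)"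
      if "Poly_Mapping.keys r \<subseteq> K" for r
      using mpoly_eval_superset[of K r "\<chi> i. x i"] that by (simp add: K_def monomial_eval_def)
    then show "(\<Sum>m\<in>K. (Poly_Mapping.lookup p m - Poly_Mapping.lookup q m) *
        (\<Prod>i\<in>UNIV. x i ^ Poly_Mapping.lookup m i)) = 0"
      using assms by (simp add: left_diff_distrib sum_subtractf K_def)
  qed (use that in \<open>auto simp: K_def\<close>)
  then show ?thesis
    by (intro poly_mapping_eqI) (metis K_def UnCI eq_iff_diff_eq_0 in_keys_iff)
qed

text \<open>Restriction to the line through \<open>a\<close> and \<open>b\<close> turns a unit into
  a unit of R[t], hence into a constant.\<close>

lemma mpoly_unit_constant:
  assumes "p dvd (1 :: 'n::finite mpoly)"
  shows "mpoly_eval p a = mpoly_eval p b"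
proof -
  obtain q where "1 = p * q" using assms by (elim dvdE)
  then have pq: "mpoly_eval p x * mpoly_eval q x = 1" for x
    by (metis mpoly_eval_1 mpoly_eval_mult)
  obtain P Q where P: "\<And>s. mpoly_eval p (a + s *\<^sub>R (b - a)) = poly P s"
    and Q: "\<And>s. mpoly_eval q (a + s *\<^sub>R (b - a)) = poly Q s"
    using total_degree_le_exists[OF polynomial_function_mpoly_eval] unfolding total_degree_le_def by metis
  have "poly (P * Q) s = poly 1 s" for s using pq by (simp flip: P Q)
  then have "P * Q = 1" using poly_eq_poly_eq_iff by blast
  then have "P dvd 1" by (metis dvd_triv_left)
  then obtain c where "P = [:c:]" by (metis is_unit_poly_iff)
  then show ?thesis using P[of 0] P[of 1] by simp
qed

section \<open>Common factors of families of polynomials\<close>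

text \<open>Full column rank is an open condition. Gaussian elimination with a pivot that is nonzero
  at \<open>a\<close>, hence near \<open>a\<close>, removes one column at a time. One pivot row per
  column is chosen, so the rows may form an infinite family, such as the coefficient equations of
  all degrees.\<close>

lemma eventually_trivial_kernel:
  fixes A :: "'a::t2_space \<Rightarrow> 'j \<Rightarrow> 'i \<Rightarrow> real"
  assumes "finite I" "\<And>j i. i \<in> I \<Longrightarrow> isCont (\<lambda>x. A x j i) a"
    and "\<And>w. (\<And>j. (\<Sum>i\<in>I. A a j i * w i) = 0) \<Longrightarrow> \<forall>i\<in>I. w i = 0"
  shows "\<forall>\<^sub>F x in nhds a. \<forall>w. (\<forall>j. (\<Sum>i\<in>I. A x j i * w i) = 0) \<longrightarrow> (\<forall>i\<in>I. w i = 0)"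
  using assms
proof (induction I arbitrary: A rule: finite_induct)
  case empty
  then show ?case by simp
next
  case (insert i I)
  obtain j where j: "A a j i \<noteq> 0"
  proof (rule ccontr)
    assume "\<not> thesis"
    then have "\<And>j. A a j i = 0" using that by blast
    then have "(\<Sum>k\<in>insert i I. A a j k * (if k = i then 1 else 0)) = 0" for j
      by (intro sum.neutral) auto
    from insert.prems(2)[OF this] show False by auto
  qed
  define B where "B x j' k = A x j' k - A x j' i * A x j k / A x j i" for x j' k
  have B_sum: "(\<Sum>k\<in>I. B x j' k * w k)
      = (\<Sum>k\<in>I. A x j' k * w k) - A x j' i / A x j i * (\<Sum>k\<in>I. A x j k * w k)" for x j' w
    unfolding B_def sum_distrib_left sum_subtractf[symmetric]
    by (intro sum.cong) (simp_all add: algebra_simps)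
  have kernel: "\<forall>k\<in>I. w k = 0" if w: "\<And>j'. (\<Sum>k\<in>I. B a j' k * w k) = 0" for w
  proof -
    \<comment> \<open>A kernel vector of the reduced system extends to the full one; the entry at
      \<open>i\<close> is read off from the pivot row \<open>j\<close>.\<close>
    define w' where "w' = w(i := - (\<Sum>k\<in>I. A a j k * w k) / A a j i)"
    have "(\<Sum>k\<in>I. A a j' k * w' k) = (\<Sum>k\<in>I. A a j' k * w k)" for j'
      using insert.hyps by (intro sum.cong) (auto simp: w'_def)
    then have "(\<Sum>k\<in>insert i I. A a j' k * w' k) = 0" for j'
      using w[of j'] insert.hyps by (simp add: B_sum) (simp add: w'_def)
    from insert.prems(2)[OF this] show ?thesis
      using insert.hyps by (auto simp: w'_def split: if_splits)
  qed
  have "\<forall>\<^sub>F x in nhds a. \<forall>w. (\<forall>j'. (\<Sum>k\<in>I. B x j' k * w k) = 0) \<longrightarrow> (\<forall>k\<in>I. w k = 0)"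
  proof (rule insert.IH)
    show "isCont (\<lambda>x. B x j' k) a" if "k \<in> I" for j' k
      unfolding B_def using insert.prems(1) that j by (intro continuous_intros) auto
  qed (use kernel in blast)
  moreover have "\<forall>\<^sub>F x in nhds a. A x j i \<noteq> 0"
  proof -
    have "((\<lambda>x. A x j i) \<longlongrightarrow> A a j i) (at a)" using insert.prems(1)[of i j] by (simp add: isCont_def)
    then have "\<forall>\<^sub>F x in at a. A x j i \<noteq> 0" using j by (rule tendsto_imp_eventually_ne)
    then show ?thesis using j by (simp add: eventually_nhds_conv_at)
  qed
  ultimately show ?case
  proof eventually_elim
    case (elim x)
    show ?case
    proof (intro allI impI)
      fix w assume w: "\<forall>j'. (\<Sum>k\<in>insert i I. A x j' k * w k) = 0"
      have eq: "(\<Sum>k\<in>I. A x j' k * w k) = - A x j' i * w i" for j'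
        using w insert.hyps by (simp add: add_eq_0_iff)
      have "(\<Sum>k\<in>I. B x j' k * w k) = 0" for j'
        using elim(2) by (simp add: B_sum eq)
      then have wI: "\<forall>k\<in>I. w k = 0" using elim(1) by blast
      then have "A x j i * w i = 0" using eq[of j] by simp
      then show "\<forall>k\<in>insert i I. w k = 0" using wI elim(2) by simp
    qed
  qed
qed

text \<open>Brings a coefficient of a product into the shape of a row of a Sylvester-type
  matrix.\<close>

lemma coeff_mult_lessThan:
  fixes v f :: "real poly"
  assumes "\<And>i. m \<le> i \<Longrightarrow> coeff v i = 0"
  shows "coeff (v * f) c = (\<Sum>i<m. (if i \<le> c then coeff f (c - i) else 0) * coeff v i)"
proof -
  have "(\<Sum>i\<le>c. coeff v i * coeff f (c - i)) = (\<Sum>i\<in>{..c} \<inter> {..<m}. coeff v i * coeff f (c - i))"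
    by (rule sum.mono_neutral_right) (use assms in \<open>auto simp: not_less\<close>)
  also have "\<dots> = (\<Sum>i\<in>{..<m} \<inter> {..c}. coeff f (c - i) * coeff v i)"
    by (simp add: Int_commute mult.commute)
  also have "\<dots> = (\<Sum>i<m. if i \<in> {..c} then coeff f (c - i) * coeff v i else 0)"
    by (rule sum.inter_restrict) simp
  also have "\<dots> = (\<Sum>i<m. (if i \<le> c then coeff f (c - i) else 0) * coeff v i)"
    by (rule sum.cong) auto
  finally show ?thesis by (simp add: coeff_mult)
qed

text \<open>\<open>deg (gcd H f) > k\<close> holds exactly when \<open>v f + u H = 0\<close> has a nonzero solution with
  \<open>deg v < deg H - k\<close> and \<open>deg u < deg H\<close>: a condition on the kernel of a matrix that depends
  continuously on the coefficients.\<close>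

lemma eventually_degree_gcd_le:
  fixes H f :: "'a::t2_space \<Rightarrow> real poly"
  assumes cont: "\<And>k. isCont (\<lambda>x. coeff (H x) k) a" "\<And>k. isCont (\<lambda>x. coeff (f x) k) a"
    and deg: "\<And>x. degree (H x) = d" "\<And>x. H x \<noteq> 0" "\<And>x k. d \<le> k \<Longrightarrow> coeff (f x) k = 0"
  shows "\<forall>\<^sub>F x in nhds a. degree (gcd (H x) (f x)) \<le> degree (gcd (H a) (f a))"
proof -
  define k where "k = degree (gcd (H a) (f a))"
  \<comment> \<open>The coefficients of t^i p, the columns of the matrix. Columns \<open>Inl\<close>
    multiply the unknown coefficients of \<open>v\<close>, columns \<open>Inr\<close> those of
    \<open>u\<close>.\<close>
  define sh where "sh p c i = (if i \<le> c then coeff p (c - i) else 0)" for p :: "real poly" and c i :: nat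
  define A where "A x c i = (case i of Inl i \<Rightarrow> sh (f x) c i | Inr i \<Rightarrow> sh (H x) c i)" for x c and i :: "nat + nat"
  define I where "I = Inl ` {..<d - k} \<union> Inr ` {..<d}"
  have "finite I" by (simp add: I_def)
  have sumI: "(\<Sum>i\<in>I. A x c i * w i) = (\<Sum>i<d - k. sh (f x) c i * w (Inl i)) + (\<Sum>i<d. sh (H x) c i * w (Inr i))"
    for x c w
    unfolding I_def by (subst sum.union_disjoint) (auto simp: sum.reindex inj_on_def A_def)
  have "\<forall>\<^sub>F x in nhds a. \<forall>w. (\<forall>c. (\<Sum>i\<in>I. A x c i * w i) = 0) \<longrightarrow> (\<forall>i\<in>I. w i = 0)"
  proof (rule eventually_trivial_kernel[OF \<open>finite I\<close>])
    have "isCont (\<lambda>x. sh (f x) c i) a" "isCont (\<lambda>x. sh (H x) c i) a" for c i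
      by (cases "i \<le> c"; simp add: sh_def cont)+
    then show "isCont (\<lambda>x. A x c i) a" for c i
      by (cases i) (simp_all add: A_def)
    fix w assume w: "\<And>c. (\<Sum>i\<in>I. A a c i * w i) = 0"
    define v where "v = (\<Sum>i<d - k. monom (w (Inl i)) i)"
    define u where "u = (\<Sum>i<d. monom (w (Inr i)) i)"
    have v: "coeff v i = (if i < d - k then w (Inl i) else 0)" for i
      by (simp add: v_def coeff_sum)
    have u: "coeff u i = (if i < d then w (Inr i) else 0)" for i
      by (simp add: u_def coeff_sum)
    have "coeff (v * f a + u * H a) c = 0" for c
    proof -
      have "coeff (v * f a) c = (\<Sum>i<d - k. sh (f a) c i * w (Inl i))"
        by (subst coeff_mult_lessThan[of "d - k"]) (simp_all add: v sh_def)
      moreover have "coeff (u * H a) c = (\<Sum>i<d. sh (H a) c i * w (Inr i))"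
        by (subst coeff_mult_lessThan[of "d"]) (simp_all add: u sh_def)
      ultimately show ?thesis using w[of c] by (simp add: sumI)
    qed
    then have vu: "v * f a + u * H a = 0" by (intro poly_eqI) simp
    \<comment> \<open>After cancelling the gcd, \<open>H'\<close> divides \<open>v\<close>, but its
      degree d - k exceeds that of \<open>v\<close>.\<close>
    have "v = 0"
    proof (rule ccontr)
      assume "v \<noteq> 0"
      obtain H' f' where *: "H a = gcd (H a) (f a) * H'" "f a = gcd (H a) (f a) * f'" "coprime H' f'"
        using gcd_coprime_exists[of "H a" "f a"] deg(2) by (metis gcd_eq_0_iff mult.commute)
      have g: "gcd (H a) (f a) \<noteq> 0" using deg(2) by simp
      have "gcd (H a) (f a) * (v * f' + u * H') = v * (gcd (H a) (f a) * f') + u * (gcd (H a) (f a) * H')"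
        by (simp add: algebra_simps)
      also have "\<dots> = v * f a + u * H a" by (simp only: *(1,2)[symmetric])
      finally have "gcd (H a) (f a) * (v * f' + u * H') = v * f a + u * H a" .
      then have "gcd (H a) (f a) * (v * f' + u * H') = 0" using vu by (simp only:)
      then have "v * f' + u * H' = 0" using g by (metis mult_eq_0_iff)
      then have "v * f' = - u * H'" by (simp add: eq_neg_iff_add_eq_0)
      then have "H' dvd v * f'" by simp
      then have "H' dvd v" using *(3) by (simp add: coprime_dvd_mult_left_iff)
      then have "degree H' \<le> degree v" using \<open>v \<noteq> 0\<close> by (rule dvd_imp_degree_le)
      moreover have "H' \<noteq> 0" using *(1) deg(2) by (metis mult_zero_right)
      then have "d = k + degree H'" using *(1) g degree_mult_eq deg(1) k_def by metis
      moreover have "degree v < d - k"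
        using \<open>v \<noteq> 0\<close> v[of "degree v"] by (metis leading_coeff_neq_0)
      ultimately show False by simp
    qed
    moreover from this have "u = 0" using vu deg(2) by simp
    ultimately show "\<forall>i\<in>I. w i = 0"
      using u v unfolding I_def by (auto split: if_splits) (metis coeff_0)+
  qed
  then show ?thesis
    unfolding k_def[symmetric]
  proof eventually_elim
    case (elim x)
    show ?case
    proof (rule ccontr)
      let ?g = "gcd (H x) (f x)"
      assume "\<not> degree ?g \<le> k"
      \<comment> \<open>A gcd g of degree above \<open>k\<close> would give the relation (H / g) f -
        (f / g) H = 0, whose first multiplier has degree below d - k.\<close>
      define v where "v = H x div ?g"
      define u where "u = - (f x div ?g)"
      have g: "?g \<noteq> 0" using deg(2) by simp
      have Hx: "H x = ?g * v" by (simp add: v_def)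
      have fx: "f x = - ?g * u" by (simp add: u_def)
      have "v \<noteq> 0" using Hx deg(2) by (metis mult_zero_right)
      then have "d = degree ?g + degree v" using Hx g degree_mult_eq deg(1) by metis
      then have v: "coeff v i = 0" if "d - k \<le> i" for i
        using \<open>\<not> degree ?g \<le> k\<close> that by (intro coeff_eq_0) linarith
      have u: "coeff u i = 0" if "d \<le> i" for i
      proof (cases "u = 0")
        case False
        have "f x \<noteq> 0" using fx False g by (metis mult_eq_0_iff neg_equal_0_iff_equal)
        then have "degree (f x) < d" using deg(3)[of "degree (f x)" x] by (metis leading_coeff_neq_0 not_le)
        moreover have "degree (f x) = degree ?g + degree u"
          using fx False g degree_mult_eq[of "- ?g" u] by simp
        ultimately show ?thesis using that by (intro coeff_eq_0) simp
      qed simp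
      define w where "w = (\<lambda>i. case i of Inl i \<Rightarrow> coeff v i | Inr i \<Rightarrow> coeff u i)"
      have "(\<Sum>i\<in>I. A x c i * w i) = 0" for c
      proof -
        have "v * f x + u * H x = v * (- ?g * u) + u * (?g * v)"
          by (simp only: fx[symmetric] Hx[symmetric])
        also have "\<dots> = 0" by (simp add: algebra_simps)
        finally have "v * f x + u * H x = 0" .
        then have "coeff (v * f x) c + coeff (u * H x) c = 0" by (metis coeff_0 coeff_add)
        moreover have "coeff (v * f x) c = (\<Sum>i<d - k. sh (f x) c i * w (Inl i))"
          by (subst coeff_mult_lessThan[of "d - k"]) (simp_all add: v sh_def w_def)
        moreover have "coeff (u * H x) c = (\<Sum>i<d. sh (H x) c i * w (Inr i))"
          by (subst coeff_mult_lessThan[of "d"]) (simp_all add: u sh_def w_def)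
        ultimately show ?thesis by (simp add: sumI)
      qed
      then have "\<forall>i\<in>I. w i = 0" using elim by blast
      then have "coeff v i = 0" for i
        using v[of i] by (cases "d - k \<le> i") (force simp: I_def w_def)+
      then show False using \<open>v \<noteq> 0\<close> by (simp add: poly_eq_iff)
    qed
  qed
qed

text \<open>The Euclidean algorithm with pseudo-division: \<open>E\<close> is a gcd over the field
  of fractions, and the powers of leading coefficients multiplied in on the way are collected in
  \<open>c\<close>.\<close>

lemma pseudo_euclid:
  fixes H F :: "real poly poly"
  assumes "H \<noteq> 0"
  shows "\<exists>E A B c. c \<noteq> 0 \<and> E = A * H + B * F \<and> E dvd smult c H \<and> E dvd smult c F"
  using assms
\<comment> \<open>The zero polynomial gets the value 0 and nonzero constants the value 1, so that
  the last division also decreases the measure.\<close>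
proof (induction "if F = 0 then 0 else Suc (degree F)" arbitrary: H F rule: less_induct)
  case less
  show ?case
  proof (cases "F = 0")
    case True
    have "(1::real poly) \<noteq> 0 \<and> H = 1 * H + 0 * F \<and> H dvd smult 1 H \<and> H dvd smult 1 F"
      using True by simp
    then show ?thesis by blast
  next
    case False
    obtain Q R where QR: "pseudo_divmod H F = (Q, R)" by fastforce
    define l where "l = coeff F (degree F) ^ (Suc (degree H) - degree F)"
    have l: "l \<noteq> 0" using False by (simp add: l_def)
    have eq: "smult l H = F * Q + R" and R: "R = 0 \<or> degree R < degree F"
      using pseudo_divmod[OF False QR] by (simp_all add: l_def)
    have "(if R = 0 then 0 else Suc (degree R)) < (if F = 0 then 0 else Suc (degree F))"
      using R False by auto
    from less.hyps[OF this False] obtain E A B c where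
      IH: "c \<noteq> 0" "E = A * F + B * R" "E dvd smult c F" "E dvd smult c R" by blast
    have "smult c (smult l H) = smult c F * Q + smult c R"
      by (simp add: eq smult_add_right)
    then have "E dvd smult (c * l) H"
      using IH by (metis dvd_add dvd_mult2 smult_smult)
    moreover have "E dvd smult (c * l) F"
      using IH(3) by (metis dvd_smult mult.commute smult_smult)
    moreover have "E = smult l B * H + (A - B * Q) * F"
    proof -
      have Req: "R = smult l H - F * Q" using eq by simp
      show ?thesis unfolding IH(2) Req by (simp add: algebra_simps)
    qed
    ultimately show ?thesis using IH(1) l by (metis mult_eq_0_iff)
  qed
qed

text \<open>Gauss' lemma: \<open>c\<close> is invertible over the field of fractions, and
  divisibility there by a primitive polynomial descends to R[s].\<close>

lemma primitive_dvd_smult: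
  fixes p q :: "real poly poly"
  assumes "content p = 1" "c \<noteq> 0" "p dvd smult c q"
  shows "p dvd q"
proof -
  have "fract_poly p dvd smult (to_fract c) (fract_poly q)"
    using fract_poly_dvd[OF assms(3)] by simp
  then have "fract_poly p dvd fract_poly q"
    using assms(2) by (simp add: dvd_smult_iff)
  then show ?thesis using assms(1) by (rule fract_poly_dvdD)
qed

text \<open>With coefficients in R[s], a Bezout combination of coprime polynomials reaches only a
  nonzero constant in t, not 1. Coprimality therefore survives specialization of s away from the
  finitely many zeros of \<open>r\<close>.\<close>

lemma coprime_bezout_const:
  fixes H F :: "real poly poly"
  assumes "H \<noteq> 0" "coprime H F"
  shows "\<exists>A B r. r \<noteq> 0 \<and> A * H + B * F = [:r:]"
proof -
  obtain E A B c where *: "c \<noteq> 0" "E = A * H + B * F" "E dvd smult c H" "E dvd smult c F"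
    using pseudo_euclid[OF assms(1)] by blast
  have "E \<noteq> 0" using * assms(1) by auto
  \<comment> \<open>Dropping the content makes Gauss' lemma applicable: the primitive part divides
    \<open>H\<close> and \<open>F\<close>, so it is a unit, and \<open>E\<close> does not involve
    t.\<close>
  define P where "P = primitive_part E"
  have E: "E = smult (content E) P" by (simp add: P_def)
  have "content P = 1" using \<open>E \<noteq> 0\<close> by (simp add: P_def)
  moreover have "P dvd E" using E by (metis dvd_smult dvd_refl)
  ultimately have "P dvd H" "P dvd F"
    using * by (meson dvd_trans primitive_dvd_smult)+
  then have "P dvd 1" using assms(2) by (meson coprime_common_divisor)
  then obtain r where "P = [:r:]" by (metis is_unit_poly_iff)
  then have "E = [:content E * r:]" using E by simp
  moreover from this have "content E * r \<noteq> 0" using \<open>E \<noteq> 0\<close> by auto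
  ultimately show ?thesis using *(2) by metis
qed

text \<open>The outer variable is t and is kept; the coefficients are polynomials in the line
  parameter, which is set to \<open>s\<close>.\<close>

definition specialize :: "real \<Rightarrow> real poly poly \<Rightarrow> real poly" where
  "specialize s P = map_poly (\<lambda>p. poly p s) P"

lemma coeff_specialize [simp]: "coeff (specialize s P) k = poly (coeff P k) s"
  by (simp add: specialize_def coeff_map_poly)

lemma specialize_mult: "specialize s (P * Q) = specialize s P * specialize s Q"
  by (rule poly_eqI) (simp add: coeff_mult poly_sum)

lemma specialize_add: "specialize s (P + Q) = specialize s P + specialize s Q"
  by (rule poly_eqI) simp

lemma specialize_const: "specialize s [:r:] = [:poly r s:]"
  by (rule poly_eqI) (simp add: coeff_pCons split: nat.splits)

lemma degree_specialize_le: "degree (specialize s P) \<le> degree P"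
  by (rule degree_le) (simp add: coeff_eq_0)

lemma monic_dvd_degree_eq:
  fixes p q :: "real poly"
  assumes "p dvd q" "degree p = degree q" "lead_coeff p = 1" "lead_coeff q = 1"
  shows "p = q"
proof -
  obtain r where r: "q = p * r" using assms(1) by (elim dvdE)
  have "p \<noteq> 0" "r \<noteq> 0" using r assms(3,4) by auto
  then have "degree r = 0" using r assms(2) degree_mult_eq[of p r] by simp
  then obtain c where "r = [:c:]" by (rule degree_eq_zeroE)
  moreover have "lead_coeff r = 1" using r assms(3,4) by (simp add: lead_coeff_mult)
  ultimately show ?thesis using r by simp
qed

lemma lead_coeff_gcd_real_poly:
  fixes p q :: "real poly"
  assumes "p \<noteq> 0"
  shows "lead_coeff (gcd p q) = 1"
proof -
  have "normalize (gcd p q) = gcd p q" by simp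
  moreover have g: "gcd p q \<noteq> 0" using assms by simp
  ultimately have "unit_factor (gcd p q) = 1" by (metis unit_factor_normalize)
  then show ?thesis
    by (simp add: unit_factor_poly_def) (metis coeff_monom lead_coeff_1 one_pCons pCons_eq_iff monom_0)
qed

text \<open>The gcd over R[s][t] always specializes to a common divisor. Where the Bezout constant
  does not vanish it is the full gcd, whence deg \<open>G\<close> = \<open>k\<close>; constancy of
  the pointwise degree on \<open>S\<close> then forces equality at the exceptional parameters
  too.\<close>

lemma gcd_along_line:
  fixes H F :: "real poly poly"
  assumes H: "degree H = d" "coeff H d = [:c0:]" "c0 \<noteq> 0"
    and S: "infinite S" "\<And>s. s \<in> S \<Longrightarrow> degree (gcd (specialize s H) (specialize s F)) = k"
  obtains G K where "H = G * K" "\<And>s. s \<in> S \<Longrightarrow> gcd (specialize s H) (specialize s F) = specialize s G"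
proof -
  have "H \<noteq> 0" using H by auto
  define G0 where "G0 = gcd H F"
  have "G0 \<noteq> 0" using \<open>H \<noteq> 0\<close> by (simp add: G0_def)
  obtain H0 F0 where 0: "H = G0 * H0" "F = G0 * F0" "coprime H0 F0"
    using gcd_coprime_exists[of H F] \<open>H \<noteq> 0\<close> unfolding G0_def by (metis gcd_eq_0_iff mult.commute)
  have "H0 \<noteq> 0" using 0 \<open>H \<noteq> 0\<close> by auto
  \<comment> \<open>The leading coefficient of the gcd divides a nonzero real constant, so it can be
    normalized to 1; then specialization never lowers the degree.\<close>
  have "lead_coeff G0 * lead_coeff H0 = [:c0:]" using 0(1) H by (metis lead_coeff_mult)
  moreover have "is_unit [:c0:]" using H(3) by (simp add: is_unit_const_poly_iff dvd_field_iff)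
  ultimately have "is_unit (lead_coeff G0)" by (metis dvd_mult_left)
  then obtain g0 where g0: "lead_coeff G0 = [:g0:]" "g0 \<noteq> 0"
    by (metis is_unit_poly_iff not_is_unit_0)
  define G where "G = smult [:inverse g0:] G0"
  define H' where "H' = smult [:g0:] H0"
  define F' where "F' = smult [:g0:] F0"
  have gg: "[:inverse g0:] * [:g0:] = 1" "[:g0:] * [:inverse g0:] = 1"
    using g0 by (simp_all add: one_pCons)
  have HG: "H = G * H'" and FG: "F = G * F'"
    unfolding G_def H'_def F'_def by (simp_all only: mult_smult_left mult_smult_right smult_smult gg smult_1_left 0)
  obtain A B r where r: "r \<noteq> 0" "A * H0 + B * F0 = [:r:]"
    using coprime_bezout_const[OF \<open>H0 \<noteq> 0\<close> 0(3)] by blast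
  have degG: "degree (specialize s G) = degree G" and lcG: "lead_coeff (specialize s G) = 1" for s
  proof -
    have "lead_coeff G = 1"
      using g0 gg by (simp only: G_def lead_coeff_smult)
    then have 1: "coeff (specialize s G) (degree G) = 1" by simp
    then have "degree G \<le> degree (specialize s G)" by (intro le_degree) simp
    then show "degree (specialize s G) = degree G" using degree_specialize_le[of s G] by simp
    with 1 show "lead_coeff (specialize s G) = 1" by simp
  qed
  have specialize_nz: "specialize s H \<noteq> 0" for s
  proof -
    have "coeff (specialize s H) d = c0" using H by simp
    then show ?thesis using H(3) by (metis coeff_0)
  qed
  have dvd: "specialize s G dvd gcd (specialize s H) (specialize s F)" for s
  proof -
    have "specialize s H = specialize s G * specialize s H'" "specialize s F = specialize s G * specialize s F'"
      using HG FG specialize_mult by metis+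
    then show ?thesis by simp
  qed
  obtain s0 where s0: "s0 \<in> S" "poly r s0 \<noteq> 0"
  proof -
    have "finite {s. poly r s = 0}" using r(1) by (rule poly_roots_finite)
    then have "infinite (S - {s. poly r s = 0})" using S(1) by simp
    then obtain s where "s \<in> S - {s. poly r s = 0}" by (metis ex_in_conv finite.emptyI)
    then show ?thesis using that by blast
  qed
  have "degree G = k"
  proof -
    have "smult [:g0:] [:r:] = A * H' + B * F'"
      unfolding H'_def F'_def mult_smult_right smult_add_right[symmetric] r(2) ..
    then have "smult [:g0:] [:r:] * G = A * H + B * F"
      unfolding HG FG by (simp only: distrib_right mult.assoc) (simp only: mult.commute)
    then have "specialize s0 ([:[:g0:] * r:] * G) = specialize s0 (A * H + B * F)"
      by (simp only: smult_pCons smult_0_right)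
    then have "[:g0 * poly r s0:] * specialize s0 G = specialize s0 A * specialize s0 H + specialize s0 B * specialize s0 F"
      by (simp only: specialize_mult specialize_add specialize_const) simp
    then have "gcd (specialize s0 H) (specialize s0 F) dvd [:g0 * poly r s0:] * specialize s0 G"
      by (metis dvd_add dvd_mult gcd_dvd1 gcd_dvd2)
    then have "gcd (specialize s0 H) (specialize s0 F) dvd smult (g0 * poly r s0) (specialize s0 G)" by simp
    then have "gcd (specialize s0 H) (specialize s0 F) dvd specialize s0 G"
      using g0 s0 by (simp add: dvd_smult_iff)
    moreover have "specialize s0 G \<noteq> 0" using lcG[of s0] by (metis coeff_0 zero_neq_one)
    ultimately have "k \<le> degree G" using S(2)[OF s0(1)] dvd_imp_degree_le degG by metis
    moreover have "degree G \<le> k" using dvd_imp_degree_le[OF dvd[of s0]] specialize_nz S(2)[OF s0(1)] degG by simp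
    ultimately show ?thesis by simp
  qed
  have "gcd (specialize s H) (specialize s F) = specialize s G" if "s \<in> S" for s
    using monic_dvd_degree_eq[OF dvd[of s]] degG[of s] lcG[of s] lead_coeff_gcd_real_poly[OF specialize_nz, of s "specialize s F"]
      S(2)[OF that] \<open>degree G = k\<close> by simp
  with HG show ?thesis using that by blast
qed

lemma polynomial_family_along_line:
  fixes H :: "real^'n \<Rightarrow> real poly"
  assumes "\<And>k. real_polynomial_function (\<lambda>x. coeff (H x) k)" "\<And>x. degree (H x) \<le> d"
  obtains P where "\<And>s. specialize s P = H (a + s *\<^sub>R c)" "degree P \<le> d"
proof -
  have "\<exists>p. \<forall>s. coeff (H (a + s *\<^sub>R c)) k = poly p s" for k
    using total_degree_le_exists[OF assms(1)[of k]] unfolding total_degree_le_def by blast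
  then obtain p where p: "\<And>k s. coeff (H (a + s *\<^sub>R c)) k = poly (p k) s" by metis
  define P where "P = (\<Sum>k\<le>d. monom (p k) k)"
  have P: "coeff P k = (if k \<le> d then p k else 0)" for k
    by (simp add: P_def coeff_sum)
  have "specialize s P = H (a + s *\<^sub>R c)" for s
  proof (rule poly_eqI)
    fix k show "coeff (specialize s P) k = coeff (H (a + s *\<^sub>R c)) k"
      using assms(2)[of "a + s *\<^sub>R c"] by (simp add: P p[symmetric] coeff_eq_0)
  qed
  moreover have "degree P \<le> d" by (rule degree_le) (simp add: P)
  ultimately show ?thesis using that by blast
qed

text \<open>By upper semicontinuity the gcd degree is constant around a point where it is minimal,
  and \<open>gcd_along_line\<close> applies to every coordinate line there. Only the values at t = 0
  are kept, because their degrees in s can be bounded through their product.\<close>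

lemma gcd_family_polynomial:
  fixes H f :: "real^'n \<Rightarrow> real poly"
  assumes poly: "\<And>k. real_polynomial_function (\<lambda>x. coeff (H x) k)"
      "\<And>k. real_polynomial_function (\<lambda>x. coeff (f x) k)"
    and deg: "\<And>x. degree (H x) = d" "\<And>x. coeff (H x) d = c0" "c0 \<noteq> 0" "\<And>x k. d \<le> k \<Longrightarrow> coeff (f x) k = 0"
    and nz: "coeff (H x0) 0 \<noteq> 0"
    and U: "open U" "U \<noteq> {}"
  obtains P Q V k where "real_polynomial_function P" "real_polynomial_function Q"
    "open V" "V \<noteq> {}" "V \<subseteq> U"
    "\<And>x. x \<in> V \<Longrightarrow> degree (gcd (H x) (f x)) = k"
    "\<And>x. x \<in> V \<Longrightarrow> poly (gcd (H x) (f x)) 0 = P x"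
    "\<And>x. x \<in> V \<Longrightarrow> poly (H x div gcd (H x) (f x)) 0 = Q x"
proof -
  define D where "D x = degree (gcd (H x) (f x))" for x
  \<comment> \<open>The constant coefficient of \<open>H\<close> is kept nonzero so that it bounds
    the degrees of its factors.\<close>
  define U' where "U' = U \<inter> {x. coeff (H x) 0 \<noteq> 0}"
  have H_nz: "H x \<noteq> 0" for x using deg(2,3) by (metis coeff_0)
  have "open {x. coeff (H x) 0 \<noteq> 0}"
    using isCont_polynomial_function[OF poly(1)[of 0]]
    by (intro open_Collect_neq continuous_intros) (simp add: continuous_at_imp_continuous_on)
  then have "open U'" using U by (simp add: U'_def open_Int)
  have "U' \<noteq> {}"
  proof
    assume "U' = {}"
    obtain a where "a \<in> U" using U(2) by blast
    moreover have "coeff (H x) 0 = 0" if "x \<in> U" for x using that \<open>U' = {}\<close> by (auto simp: U'_def)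
    ultimately have "coeff (H x0) 0 = 0" using polynomial_function_eq_0[OF poly(1) U(1)] by blast
    then show False using nz by simp
  qed
  then obtain a0 where a0: "a0 \<in> U'" "\<And>x. x \<in> U' \<Longrightarrow> D a0 \<le> D x"
    using ex_has_least_nat[of "\<lambda>x. x \<in> U'" _ D] by blast
  have "\<forall>\<^sub>F x in nhds a0. D x \<le> D a0"
    unfolding D_def using poly deg H_nz
    by (intro eventually_degree_gcd_le[where d = d] isCont_polynomial_function) auto
  then obtain W where W: "open W" "a0 \<in> W" "\<And>x. x \<in> W \<Longrightarrow> D x \<le> D a0"
    unfolding eventually_nhds by blast
  then obtain l u where lu: "a0 \<in> box l u" "box l u \<subseteq> W \<inter> U'"
    using open_contains_box[of "W \<inter> U'" a0] \<open>open U'\<close> a0(1) by (metis IntI open_Int)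
  define V where "V = box l u"
  have D: "D x = D a0" if "x \<in> V" for x
  proof -
    have "x \<in> W" "x \<in> U'" using that lu(2) by (auto simp: V_def)
    then show ?thesis using W(3) a0(2) by (simp add: antisym)
  qed
  have lu_less: "l $ i < u $ i" for i
    using lu(1) by (auto simp: mem_box_cart intro: less_trans)
  obtain N where N: "total_degree_le N (\<lambda>x. coeff (H x) 0)"
    using total_degree_le_exists[OF poly(1)] by blast
  have line: "\<exists>p q. degree p \<le> N \<and> degree q \<le> N \<and> (\<forall>s. x + s *\<^sub>R axis i 1 \<in> V \<longrightarrow>
      poly (gcd (H (x + s *\<^sub>R axis i 1)) (f (x + s *\<^sub>R axis i 1))) 0 = poly p s \<and>
      poly (H (x + s *\<^sub>R axis i 1) div gcd (H (x + s *\<^sub>R axis i 1)) (f (x + s *\<^sub>R axis i 1))) 0 = poly q s)"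
    if x: "x \<in> V" for x i
  proof -
    obtain HP where HP: "\<And>s. specialize s HP = H (x + s *\<^sub>R axis i 1)" "degree HP \<le> d"
      using polynomial_family_along_line[OF poly(1), of d x "axis i 1"] deg(1) by auto
    have "degree (f x) \<le> d" for x
      using deg(4) by (intro degree_le) auto
    then obtain FP where FP: "\<And>s. specialize s FP = f (x + s *\<^sub>R axis i 1)"
      using polynomial_family_along_line[OF poly(2), of d x "axis i 1"] by metis
    have "poly (coeff HP d) s = poly [:c0:] s" for s
      using arg_cong[OF HP(1)[of s], of "\<lambda>p. coeff p d"] deg(2) by simp
    then have lc: "coeff HP d = [:c0:]" using poly_eq_poly_eq_iff by blast
    then have degHP: "degree HP = d"
      using HP(2) deg(3) le_degree[of HP d] by simp
    define S where "S = {s. x + s *\<^sub>R axis i 1 \<in> V}"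
    have "open ((\<lambda>s. x + s *\<^sub>R axis i 1) -` V)"
      unfolding V_def by (intro open_vimage open_box continuous_intros)
    then have "open S" by (simp add: S_def vimage_def)
    moreover have "0 \<in> S" using x by (simp add: S_def)
    ultimately have "infinite S" using finite_imp_not_open by blast
    moreover have "degree (gcd (specialize s HP) (specialize s FP)) = D a0" if "s \<in> S" for s
      using that D by (simp add: HP FP S_def D_def)
    ultimately obtain G K where GK: "HP = G * K" "\<And>s. s \<in> S \<Longrightarrow> gcd (specialize s HP) (specialize s FP) = specialize s G"
      using gcd_along_line[OF degHP lc deg(3)] by blast
    \<comment> \<open>Both factors divide a nonzero polynomial of degree at most \<open>N\<close>;
      this bound is independent of the line, as interpolation requires.\<close>
    have "coeff HP 0 = coeff G 0 * coeff K 0"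
      by (simp add: GK(1) coeff_mult)
    moreover have "coeff HP 0 \<noteq> 0"
    proof
      assume "coeff HP 0 = 0"
      then have "coeff (H x) 0 = 0" using arg_cong[OF HP(1)[of 0], of "\<lambda>p. coeff p 0"] by simp
      then show False using x lu(2) by (auto simp: V_def U'_def)
    qed
    moreover have "degree (coeff HP 0) \<le> N"
    proof -
      obtain p where "degree p \<le> N" "\<And>s. coeff (H (x + s *\<^sub>R axis i 1)) 0 = poly p s"
        using N unfolding total_degree_le_def by blast
      moreover from this have "coeff HP 0 = p"
        using arg_cong[OF HP(1), of "\<lambda>p. coeff p 0"] by (simp add: poly_eq_poly_eq_iff[symmetric] fun_eq_iff)
      ultimately show ?thesis by simp
    qed
    ultimately have "degree (coeff G 0) \<le> N" "degree (coeff K 0) \<le> N"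
      by (auto simp: degree_mult_eq)
    moreover have "poly (gcd (H (x + s *\<^sub>R axis i 1)) (f (x + s *\<^sub>R axis i 1))) 0 = poly (coeff G 0) s \<and>
      poly (H (x + s *\<^sub>R axis i 1) div gcd (H (x + s *\<^sub>R axis i 1)) (f (x + s *\<^sub>R axis i 1))) 0 = poly (coeff K 0) s"
      if "x + s *\<^sub>R axis i 1 \<in> V" for s
    proof -
      have g: "gcd (H (x + s *\<^sub>R axis i 1)) (f (x + s *\<^sub>R axis i 1)) = specialize s G"
        using GK(2)[of s] that by (simp add: S_def HP FP)
      have "H (x + s *\<^sub>R axis i 1) = specialize s G * specialize s K"
        using HP(1)[of s] GK(1) specialize_mult by metis
      moreover have "specialize s G \<noteq> 0" using g H_nz by (metis gcd_eq_0_iff)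
      ultimately have "H (x + s *\<^sub>R axis i 1) div specialize s G = specialize s K" by simp
      then show ?thesis by (simp add: g poly_0_coeff_0)
    qed
    ultimately show ?thesis by blast
  qed
  have "\<exists>P. real_polynomial_function P \<and> (\<forall>x\<in>V. poly (gcd (H x) (f x)) 0 = P x)"
    unfolding V_def
    by (rule polynomial_on_box_if_polynomial_on_lines[OF lu_less, of N]) (use line in \<open>unfold V_def, blast\<close>)
  moreover have "\<exists>P. real_polynomial_function P \<and> (\<forall>x\<in>V. poly (H x div gcd (H x) (f x)) 0 = P x)"
    unfolding V_def
    by (rule polynomial_on_box_if_polynomial_on_lines[OF lu_less, of N]) (use line in \<open>unfold V_def, blast\<close>)
  ultimately obtain P Q where "real_polynomial_function P" "\<And>x. x \<in> V \<Longrightarrow> poly (gcd (H x) (f x)) 0 = P x"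
    "real_polynomial_function Q" "\<And>x. x \<in> V \<Longrightarrow> poly (H x div gcd (H x) (f x)) 0 = Q x" by blast
  moreover have "open V" "V \<noteq> {}" "V \<subseteq> U" using lu by (auto simp: V_def U'_def open_box)
  ultimately show ?thesis using D that[of P Q V "D a0"] by (auto simp: D_def)
qed

section \<open>Irreducible hyperbolic forms\<close>

text \<open>Joint degree at most \<open>N\<close> in \<open>a\<close> and t, read
  coefficientwise.\<close>

definition coeffs_degree_le :: "nat \<Rightarrow> (real^'n \<Rightarrow> real poly) \<Rightarrow> bool" where
  "coeffs_degree_le N P \<longleftrightarrow>
     (\<forall>k. (k \<le> N \<longrightarrow> total_degree_le (N - k) (\<lambda>a. coeff (P a) k)) \<and> (N < k \<longrightarrow> (\<forall>a. coeff (P a) k = 0)))"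

lemma coeffs_degree_le_const: "coeffs_degree_le 0 (\<lambda>_. [:c:])"
  by (auto simp: coeffs_degree_le_def coeff_pCons total_degree_le_const split: nat.splits)

lemma coeffs_degree_le_mult:
  assumes "coeffs_degree_le M P" "coeffs_degree_le N Q"
  shows "coeffs_degree_le (M + N) (\<lambda>a. P a * Q a)"
  unfolding coeffs_degree_le_def
proof (intro allI conjI impI)
  have zero: "coeff (P a) i * coeff (Q a) (k - i) = 0" if "M < i \<or> N < k - i" for a i k
    using that assms by (auto simp: coeffs_degree_le_def)
  fix k
  show "coeff (P a * Q a) k = 0" if "M + N < k" for a
    unfolding coeff_mult by (intro sum.neutral ballI zero) (use that in auto)
  assume k: "k \<le> M + N"
  have "total_degree_le (M + N - k) (\<lambda>a. \<Sum>i\<le>k. coeff (P a) i * coeff (Q a) (k - i))"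
  proof (rule total_degree_le_sum)
    fix i assume i: "i \<in> {..k}"
    show "total_degree_le (M + N - k) (\<lambda>a. coeff (P a) i * coeff (Q a) (k - i))"
    proof (cases "M < i \<or> N < k - i")
      case True
      then have "(\<lambda>a. coeff (P a) i * coeff (Q a) (k - i)) = (\<lambda>_. 0)" using zero by (intro ext) auto
      then show ?thesis by (simp add: total_degree_le_const)
    next
      case False
      then have "total_degree_le ((M - i) + (N - (k - i))) (\<lambda>a. coeff (P a) i * coeff (Q a) (k - i))"
        using assms by (intro total_degree_le_mult) (auto simp: coeffs_degree_le_def)
      moreover have "(M - i) + (N - (k - i)) = M + N - k" using False i by auto
      ultimately show ?thesis by simp
    qed
  qed
  then show "total_degree_le (M + N - k) (\<lambda>a. coeff (P a * Q a) k)" by (simp add: coeff_mult)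
qed

lemma coeffs_degree_le_power:
  "coeffs_degree_le N P \<Longrightarrow> coeffs_degree_le (N * k) (\<lambda>a. P a ^ k)"
proof (induction k)
  case 0
  then show ?case using coeffs_degree_le_const[of 1] by (simp add: one_pCons)
next
  case (Suc k)
  then show ?case using coeffs_degree_le_mult[of N P "N * k" "\<lambda>a. P a ^ k"] by simp
qed

lemma coeffs_degree_le_prod:
  assumes "finite I" "\<And>i. i \<in> I \<Longrightarrow> coeffs_degree_le (n i) (P i)"
  shows "coeffs_degree_le (\<Sum>i\<in>I. n i) (\<lambda>a. \<Prod>i\<in>I. P i a)"
  using assms
proof (induction I rule: finite_induct)
  case empty
  then show ?case using coeffs_degree_le_const[of 1] by (simp add: one_pCons)
next
  case (insert i I)
  then show ?case by (simp add: coeffs_degree_le_mult)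
qed

lemma coeffs_degree_le_hae_term:
  "coeffs_degree_le (\<Sum>i\<in>UNIV. Poly_Mapping.lookup m i)
     (\<lambda>a. [:c:] * (\<Prod>i\<in>UNIV. [:a $ i, - (e $ i):] ^ Poly_Mapping.lookup m i))"
proof -
  have "coeffs_degree_le 1 (\<lambda>a. [:a $ i, - (e $ i):])" for i
    using total_degree_le_linear[OF bounded_linear_vec_nth, of i]
    by (auto simp: coeffs_degree_le_def coeff_pCons total_degree_le_const le_Suc_eq split: nat.splits)
  then have "coeffs_degree_le (1 * Poly_Mapping.lookup m i) (\<lambda>a. [:a $ i, - (e $ i):] ^ Poly_Mapping.lookup m i)" for i
    by (rule coeffs_degree_le_power)
  then have "coeffs_degree_le (\<Sum>i\<in>UNIV. Poly_Mapping.lookup m i)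
      (\<lambda>a. \<Prod>i\<in>UNIV. [:a $ i, - (e $ i):] ^ Poly_Mapping.lookup m i)"
    by (intro coeffs_degree_le_prod) auto
  from coeffs_degree_le_mult[OF coeffs_degree_le_const this] show ?thesis by simp
qed

lemma polynomial_function_coeff_if_coeffs_degree_le:
  assumes "coeffs_degree_le N P"
  shows "real_polynomial_function (\<lambda>a. coeff (P a) k)"
proof (cases "k \<le> N")
  case True
  then show ?thesis using assms unfolding coeffs_degree_le_def total_degree_le_def by blast
next
  case False
  then have "coeff (P a) k = 0" for a using assms unfolding coeffs_degree_le_def by (meson not_le)
  then show ?thesis by (simp only: real_polynomial_function.intros(2))
qed

lemma polynomial_function_coeff_hae: "real_polynomial_function (\<lambda>a. coeff (hae h e a) k)"
  unfolding hae_def coeff_sum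
proof (intro real_polynomial_function_sum finite_keys)
  fix m
  show "real_polynomial_function (\<lambda>a. coeff ([:Poly_Mapping.lookup h m:]
      * (\<Prod>i\<in>UNIV. [:a $ i, - (e $ i):] ^ Poly_Mapping.lookup m i)) k)"
    by (rule polynomial_function_coeff_if_coeffs_degree_le[OF coeffs_degree_le_hae_term])
qed

lemma hae_shift: "hae h e (a + r *\<^sub>R e) = pcompose (hae h e a) [:- r, 1:]"
proof -
  have "poly (hae h e (a + r *\<^sub>R e)) t = poly (pcompose (hae h e a) [:- r, 1:]) t" for t
    by (simp add: hae_poly poly_pcompose algebra_simps)
  then show ?thesis using poly_eq_poly_eq_iff by blast
qed

lemma poly_hae_shift: "poly (hae h e (a + r *\<^sub>R e)) t = poly (hae h e a) (t - r)"
  by (simp add: hae_shift poly_pcompose)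

lemma poly_constant_if_infinitely_often:
  fixes p :: "real poly"
  assumes "infinite S" "\<And>s. s \<in> S \<Longrightarrow> poly p s = c"
  shows "degree p = 0"
proof -
  have "S \<subseteq> {s. poly (p - [:c:]) s = 0}" using assms(2) by auto
  then have "p - [:c:] = 0" using assms(1) poly_roots_finite finite_subset by blast
  then show ?thesis by simp
qed

context hyperbolic_form begin

lemma total_degree_le_coeff_hae:
  assumes "k \<le> d"
  shows "total_degree_le (d - k) (\<lambda>a. coeff (hae h e a) k)"
  unfolding hae_def coeff_sum
proof (rule total_degree_le_sum)
  fix m assume "m \<in> Poly_Mapping.keys h"
  then show "total_degree_le (d - k) (\<lambda>a. coeff ([:Poly_Mapping.lookup h m:]
      * (\<Prod>i\<in>UNIV. [:a $ i, - (e $ i):] ^ Poly_Mapping.lookup m i)) k)"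
    using coeffs_degree_le_hae_term[of m "Poly_Mapping.lookup h m" e] keys_degree assms
    unfolding coeffs_degree_le_def by simp
qed

text \<open>The values at t = 0 of the gcd and of its cofactor give \<open>h = p1 * p2\<close>.
  Moving the base point along \<open>e\<close> shifts t, so a constant \<open>p1\<close> or
  \<open>p2\<close> makes the gcd or the cofactor constant in t. A constant gcd contradicts the
  common root; a constant cofactor means that h_{y,e} divides the restriction of \<open>f\<close>,
  whose degree is too small unless it vanishes.\<close>

lemma no_common_roots:
  assumes irr: "irreducible h" and f: "total_degree_le (d - 1) f" "f x0 \<noteq> 0" and d: "0 < d"
    and U: "open U" "U \<noteq> {}" "\<And>a. a \<in> U \<Longrightarrow> \<exists>r. poly (hae h e a) r = 0 \<and> f (a - r *\<^sub>R e) = 0"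
  shows False
proof -
  obtain q where q: "\<And>a. f a = mpoly_eval q a"
    using polynomial_function_is_mpoly_eval f(1) unfolding total_degree_le_def by blast
  \<comment> \<open>The restriction of \<open>f\<close> to lines in direction \<open>- e\<close>,
    built like \<open>hae\<close> so that its coefficients are known to be polynomial in the base
    point.\<close>
  define F where "F = hae q e"
  have F: "poly (F a) t = f (a - t *\<^sub>R e)" for a t by (simp add: F_def hae_poly q)
  have degF: "degree (F a) \<le> d - 1" for a
  proof -
    obtain p where "degree p \<le> d - 1" "\<And>s. f (a + s *\<^sub>R (- e)) = poly p s"
      using f(1) unfolding total_degree_le_def by blast
    moreover from this have "F a = p" using F by (simp add: poly_eq_poly_eq_iff[symmetric] fun_eq_iff)
    ultimately show ?thesis by simp
  qed
  let ?H = "hae h e"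
  let ?g = "\<lambda>a. gcd (?H a) (F a)"
  have g_nz: "?g a \<noteq> 0" for a using hae_nonzero by simp
  have nz: "coeff (?H e) 0 \<noteq> 0"
    using hae_poly[of h e e 0] hyperbolic by (simp add: poly_0_coeff_0 hyperbolic_def)
  have c0: "(- 1) ^ d * mpoly_eval h e \<noteq> 0" using hyperbolic by (simp add: hyperbolic_def)
  have degF': "coeff (F a) k = 0" if "d \<le> k" for a k
    using degF[of a] d that by (intro coeff_eq_0) simp
  have polyF: "real_polynomial_function (\<lambda>a. coeff (F a) k)" for k
    unfolding F_def by (rule polynomial_function_coeff_hae)
  obtain P Q V k where PQ: "real_polynomial_function P" "real_polynomial_function Q"
    and V: "open V" "V \<noteq> {}" "V \<subseteq> U"
    and k: "\<And>x. x \<in> V \<Longrightarrow> degree (?g x) = k"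
    and P: "\<And>x. x \<in> V \<Longrightarrow> poly (?g x) 0 = P x"
    and Q: "\<And>x. x \<in> V \<Longrightarrow> poly (?H x div ?g x) 0 = Q x"
    by (rule gcd_family_polynomial[OF polynomial_function_coeff_hae polyF degree_hae coeff_hae_top c0 degF' nz U(1,2)])
      blast+
  obtain p1 p2 where p1: "\<And>x. P x = mpoly_eval p1 x" and p2: "\<And>x. Q x = mpoly_eval p2 x"
    using PQ polynomial_function_is_mpoly_eval by metis
  obtain x where x: "x \<in> V" using V(2) by blast
  have "mpoly_eval h y = mpoly_eval (p1 * p2) y" if "y \<in> V" for y
  proof -
    have "mpoly_eval h y = poly (?g y * (?H y div ?g y)) 0" by (simp add: hae_poly)
    then show ?thesis using P[OF that] Q[OF that] by (simp only: poly_mult p1 p2 mpoly_eval_mult)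
  qed
  then have "mpoly_eval h y = mpoly_eval (p1 * p2) y" for y
    using polynomial_function_extend_eq[OF polynomial_function_mpoly_eval polynomial_function_mpoly_eval V(1) x] by blast
  then have "h = p1 * p2" by (rule mpoly_eval_inj)
  then have "p1 dvd 1 \<or> p2 dvd 1" using irr by (metis irreducibleD)
  \<comment> \<open>Displacements along \<open>e\<close> that stay in \<open>V\<close>, where
    \<open>P\<close> and \<open>Q\<close> represent the gcd and the cofactor.\<close>
  define S where "S y = {r. y + (- r) *\<^sub>R e \<in> V}" for y
  have S: "infinite (S y)" if "y \<in> V" for y
  proof -
    have "open ((\<lambda>r. y + (- r) *\<^sub>R e) -` V)"
      by (intro open_vimage V continuous_intros)
    then have "open (S y)" by (simp add: S_def vimage_def)
    moreover have "0 \<in> S y" using that by (simp add: S_def)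
    ultimately show ?thesis using finite_imp_not_open by blast
  qed
  have shift: "?g (y + (- r) *\<^sub>R e) = pcompose (?g y) [:r, 1:]"
    "?H (y + (- r) *\<^sub>R e) div ?g (y + (- r) *\<^sub>R e) = pcompose (?H y div ?g y) [:r, 1:]"
    if y: "y \<in> V" "r \<in> S y" for y r
  proof -
    let ?y = "y + (- r) *\<^sub>R e"
    have yV: "?y \<in> V" using y by (simp add: S_def)
    have H: "?H ?y = pcompose (?H y) [:r, 1:]" and F': "F ?y = pcompose (F y) [:r, 1:]"
      using hae_shift[of _ e y "- r"] by (simp_all add: F_def)
    have dvd: "pcompose p [:r, 1:] dvd pcompose q [:r, 1:]" if "p dvd q" for p q :: "real poly"
      using that by (elim dvdE) (simp add: pcompose_mult)
    \<comment> \<open>The shifted gcd is a common divisor, and on \<open>V\<close> all gcds have the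
      same degree \<open>k\<close>.\<close>
    show g: "?g ?y = pcompose (?g y) [:r, 1:]"
    proof (rule monic_dvd_degree_eq[symmetric])
      show "pcompose (?g y) [:r, 1:] dvd ?g ?y"
        unfolding H F' by (intro gcd_greatest dvd gcd_dvd1 gcd_dvd2)
      show "degree (pcompose (?g y) [:r, 1:]) = degree (?g ?y)"
        using k[OF yV] k[OF y(1)] by (simp add: degree_pcompose)
      show "lead_coeff (pcompose (?g y) [:r, 1:]) = 1"
        using lead_coeff_gcd_real_poly[OF hae_nonzero] by (subst lead_coeff_comp) simp_all
    qed (rule lead_coeff_gcd_real_poly[OF hae_nonzero])
    have "?H ?y = pcompose (?g y * (?H y div ?g y)) [:r, 1:]"
      by (simp only: H dvd_mult_div_cancel[OF gcd_dvd1])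
    then have "?H ?y = pcompose (?g y) [:r, 1:] * pcompose (?H y div ?g y) [:r, 1:]"
      by (simp only: pcompose_mult)
    moreover have "pcompose (?g y) [:r, 1:] \<noteq> 0" using g g_nz[of ?y] by (simp only: not_False_eq_True)
    ultimately have "?H ?y div pcompose (?g y) [:r, 1:] = pcompose (?H y div ?g y) [:r, 1:]"
      by (metis nonzero_mult_div_cancel_left)
    then show "?H ?y div ?g ?y = pcompose (?H y div ?g y) [:r, 1:]" by (simp only: g)
  qed
  show False
  proof (cases "p1 dvd 1")
    case True
    have "poly (?g x) r = P x" if "r \<in> S x" for r
    proof -
      have "poly (?g x) r = poly (?g (x + (- r) *\<^sub>R e)) 0"
        by (simp only: shift(1)[OF x that]) (simp add: poly_pcompose)
      also have "\<dots> = P (x + (- r) *\<^sub>R e)" using that by (intro P) (simp add: S_def)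
      also have "\<dots> = P x" using mpoly_unit_constant[OF True] p1 by simp
      finally show ?thesis .
    qed
    then have "degree (?g x) = 0" by (rule poly_constant_if_infinitely_often[OF S[OF x]])
    moreover obtain r where r: "poly (?H x) r = 0" "poly (F x) r = 0"
      using U(3)[OF subsetD[OF V(3) x]] unfolding F by blast
    then have "[:- r, 1:] dvd ?g x" by (simp add: poly_eq_0_iff_dvd)
    then have "degree [:- r, 1:] \<le> degree (?g x)" using g_nz by (rule dvd_imp_degree_le)
    ultimately show False by simp
  next
    case False
    then have unit: "p2 dvd 1" using \<open>p1 dvd 1 \<or> p2 dvd 1\<close> by blast
    have "f y = 0" if y: "y \<in> V" for y
    proof -
      have "poly (?H y div ?g y) r = Q y" if "r \<in> S y" for r
      proof -
        have "poly (?H y div ?g y) r = poly (?H (y + (- r) *\<^sub>R e) div ?g (y + (- r) *\<^sub>R e)) 0"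
          by (simp only: shift(2)[OF y that]) (simp add: poly_pcompose)
        also have "\<dots> = Q (y + (- r) *\<^sub>R e)" using that by (intro Q) (simp add: S_def)
        also have "\<dots> = Q y" using mpoly_unit_constant[OF unit] p2 by simp
        finally show ?thesis .
      qed
      then have "degree (?H y div ?g y) = 0" by (rule poly_constant_if_infinitely_often[OF S[OF y]])
      moreover have H: "?H y = ?g y * (?H y div ?g y)" by simp
      moreover from this have "?H y div ?g y \<noteq> 0" using hae_nonzero by (metis mult_zero_right)
      ultimately have "degree (?g y) = d"
        using degree_mult_eq[OF g_nz, of "?H y div ?g y"] degree_hae by (metis add.right_neutral)
      moreover have "F y = 0 \<or> degree (?g y) \<le> degree (F y)"
        using dvd_imp_degree_le[of "?g y" "F y"] by auto
      ultimately have "F y = 0" using degF[of y] d by auto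
      then show ?thesis using F[of y 0] by simp
    qed
    then have "f x0 = 0"
      using polynomial_function_eq_0[of f V x x0] f(1) V(1) x unfolding total_degree_le_def by blast
    then show False using f(2) by simp
  qed
qed

section \<open>Topology of the hyperbolicity cone\<close>

lemma hyp_cone_coeffs:
  "a \<in> hyp_cone h e \<longleftrightarrow>
     (\<forall>k\<le>d. 0 \<le> (- 1) ^ (d + k) * (coeff (hae h e a) k / ((- 1) ^ d * mpoly_eval h e)))"
proof
  let ?c = "(- 1) ^ d * mpoly_eval h e"
  have c: "?c \<noteq> 0" using hyperbolic by (simp add: hyperbolic_def)
  {
    assume a: "a \<in> hyp_cone h e"
    obtain c' rs where rs: "c' \<noteq> 0" "hae h e a = smult c' (\<Prod>r\<leftarrow>rs. [:- r, 1:])" using hae_split .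
    have "coeff (\<Prod>r\<leftarrow>rs. [:- r, 1:]) (length rs) = 1" using split_poly_degree[of rs] by metis
    moreover have "d = length rs" using split_poly_degree[of rs] rs degree_hae[of a] by auto
    ultimately have "d = length rs" "c' = ?c" using rs coeff_hae_top[of a] by auto
    moreover have "\<forall>r\<in>set rs. 0 \<le> r" using a rs by (simp add: hyp_cone_iff poly_split_eq_0_iff)
    ultimately show "\<forall>k\<le>d. 0 \<le> (- 1) ^ (d + k) * (coeff (hae h e a) k / ?c)"
      using alternating_coeffs rs by simp
  next
    assume nonneg: "\<forall>k\<le>d. 0 \<le> (- 1) ^ (d + k) * (coeff (hae h e a) k / ?c)"
    show "a \<in> hyp_cone h e"
      unfolding hyp_cone_iff
    proof (intro allI impI, rule ccontr)
      fix r assume r: "poly (hae h e a) r = 0" "\<not> 0 \<le> r"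
      \<comment> \<open>With alternating coefficients all terms have the same sign at a negative
        \<open>r\<close>, and the leading term is nonzero, so \<open>r\<close> cannot be a
        root.\<close>
      have "(- 1) ^ d * (poly (hae h e a) r / ?c)
          = (\<Sum>k\<le>d. ((- 1) ^ (d + k) * (coeff (hae h e a) k / ?c)) * (- r) ^ k)"
        unfolding poly_altdef degree_hae sum_divide_distrib sum_distrib_left
        by (intro sum.cong) (simp_all add: power_add power_minus[of r])
      moreover have "\<dots> > 0"
      proof (rule sum_pos2[of _ d])
        show "0 < ((- 1) ^ (d + d) * (coeff (hae h e a) d / ?c)) * (- r) ^ d"
          using c r by (simp add: coeff_hae_top)
        show "0 \<le> ((- 1) ^ (d + k) * (coeff (hae h e a) k / ?c)) * (- r) ^ k" if "k \<in> {..d}" for k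
        proof (rule mult_nonneg_nonneg)
          show "0 \<le> (- 1) ^ (d + k) * (coeff (hae h e a) k / ?c)" using that nonneg by blast
          show "0 \<le> (- r) ^ k" using r(2) by simp
        qed
      qed auto
      ultimately show False using r by simp
    qed
  }
qed

lemma closed_hyp_cone: "closed (hyp_cone h e)"
proof -
  have "closed {a. 0 \<le> (- 1) ^ (d + k) * (coeff (hae h e a) k / ((- 1) ^ d * mpoly_eval h e))}" for k
  proof -
    have "continuous_on UNIV (\<lambda>a. coeff (hae h e a) k)"
      by (intro continuous_at_imp_continuous_on ballI isCont_polynomial_function polynomial_function_coeff_hae)
    then show ?thesis
      using hyperbolic by (intro closed_Collect_le continuous_intros) (auto simp: hyperbolic_def)
  qed
  then have "closed (\<Inter>k\<in>{..d}. {a. 0 \<le> (- 1) ^ (d + k) * (coeff (hae h e a) k / ((- 1) ^ d * mpoly_eval h e))})"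
    by blast
  also have "\<dots> = hyp_cone h e" using hyp_cone_coeffs by auto
  finally show ?thesis .
qed

text \<open>Adding \<open>c *\<^sub>R e\<close> shifts the finitely many roots by \<open>c\<close>.
  This makes \<open>e\<close> an order unit for the cone.\<close>

lemma hyp_cone_absorbing: "\<exists>C. \<forall>c\<ge>C. b + c *\<^sub>R e \<in> hyp_cone h e"
proof -
  have "finite {r. poly (hae h e b) r = 0}" using hae_nonzero by (rule poly_roots_finite)
  then obtain C where C: "\<forall>r\<in>{r. poly (hae h e b) r = 0}. - C \<le> r"
    using bdd_below_finite[of "{r. poly (hae h e b) r = 0}"] unfolding bdd_below_def by (metis minus_minus)
  then have "0 \<le> r" if "C \<le> c" "poly (hae h e b) (r - c) = 0" for c r
    using that by fastforce
  then show ?thesis by (auto simp: hyp_cone_iff poly_hae_shift)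
qed

end

section \<open>The moment pencil of a state\<close>

locale hyperbolic_state = hyperbolic_form h e for h :: "'n::finite mpoly" and e :: "real^'n" +
  fixes L :: "'n ncpoly \<Rightarrow> real"
  assumes L_add: "nc_fin x \<Longrightarrow> nc_fin y \<Longrightarrow> L (x + y) = L x + L y"
    and L_scale: "nc_fin x \<Longrightarrow> L (nc_smult (complex_of_real r) x) = r * L x"
    and L_nonneg: "x \<in> sos_cone h e \<Longrightarrow> 0 \<le> L x"
    and L_one: "L nc_one = 1"
begin

lemma L_zero: "L 0 = 0"
  using L_scale[of 0 0] by simp

lemma L_minus: "nc_fin x \<Longrightarrow> L (- x) = - L x"
  using L_scale[of x "- 1"] by (simp add: nc_smult_minus_one)

lemma L_diff: "nc_fin x \<Longrightarrow> nc_fin y \<Longrightarrow> L (x - y) = L x - L y"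
  using L_add[of x "- y"] L_minus[of y] nc_fin_minus[of y] by simp

lemma L_sum: "finite I \<Longrightarrow> (\<And>i. i \<in> I \<Longrightarrow> nc_fin (f i)) \<Longrightarrow> L (\<Sum>i\<in>I. f i) = (\<Sum>i\<in>I. L (f i))"
proof (induction I rule: finite_induct)
  case empty
  then show ?case by (simp only: sum.empty L_zero)
next
  case (insert i I)
  then show ?case by (simp add: L_add nc_fin_sum del: plus_fun_apply)
qed

lemma L_J: assumes "j \<in> J h e" shows "L j = 0"
proof -
  have "0 \<le> L j" "0 \<le> L (- j)"
    using assms by (auto intro!: L_nonneg sos_cone_J J_minus)
  then show ?thesis using L_minus[OF J_fin[OF assms]] by simp
qed

lemma L_antihermitian: assumes "nc_fin k" "nc_star k = - k" shows "L k = 0"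
proof -
  have "0 \<le> L k" "0 \<le> L (- k)"
    using assms by (auto intro!: L_nonneg sos_cone_antihermitian nc_fin_minus simp: nc_star_minus)
  then show ?thesis using L_minus[OF assms(1)] by simp
qed

lemma L_star: assumes "nc_fin x" shows "L (nc_star x) = L x"
proof -
  have "L (nc_star x - x) = 0"
    using assms by (intro L_antihermitian) (simp_all add: nc_fin_intros nc_star_diff)
  then show ?thesis using assms by (simp add: L_diff nc_fin_star)
qed

lemma L_square_nonneg: "nc_fin p \<Longrightarrow> 0 \<le> L (nc_square p)"
  by (intro L_nonneg sos_cone_square)

text \<open>Cauchy--Schwarz against \<open>1\<close>.\<close>

lemma L_square_eq_0:
  assumes p: "nc_fin p" and "L (nc_square p) = 0"
  shows "L p = 0"
proof -
  \<comment> \<open>Subtracting the mean \<open>L p\<close> leaves the variance L(p^* p) - L(p)^2,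
    which is nonnegative.\<close>
  define c where "c = complex_of_real (L p)"
  have "0 \<le> L (nc_square (p - nc_smult c nc_one))"
    using p by (intro L_square_nonneg nc_fin_intros)
  also have "nc_square (p - nc_smult c nc_one)
      = nc_square p - nc_smult c (nc_star p) - nc_smult c p + nc_smult (c * c) nc_one"
    by (simp add: nc_star_diff nc_mul_diff_left nc_mul_diff_right nc_smult_diff_right c_def)
  also have "L \<dots> = - (L p * L p)"
  proof -
    have "c * c = complex_of_real (L p * L p)" by (simp add: c_def)
    then have "L (nc_smult (c * c) nc_one) = L p * L p"
      using L_scale[of nc_one "L p * L p"] by (simp add: L_one)
    moreover have "L (nc_smult c (nc_star p)) = L p * L p" "L (nc_smult c p) = L p * L p"
      using p by (simp_all only: c_def L_scale nc_fin_star L_star)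
    ultimately show ?thesis
      using assms by (simp add: L_add L_diff nc_fin_intros)
  qed
  finally show ?thesis by (simp add: mult_le_0_iff) (metis antisym linear)
qed

section \<open>The quadratic forms \<open>B a\<close>, linear in \<open>a\<close>\<close>

definition B :: "real^'n \<Rightarrow> 'n ncpoly \<Rightarrow> real" where
  "B a p = L (nc_mul (nc_mul (nc_star p) (nc_lin a)) p)"

lemma B_add: "nc_fin p \<Longrightarrow> B (a + b) p = B a p + B b p"
  by (simp add: B_def nc_lin_add nc_mul_add_left nc_mul_add_right L_add nc_fin_intros)

lemma B_scale: "nc_fin p \<Longrightarrow> B (r *\<^sub>R a) p = r * B a p"
  by (simp add: B_def nc_lin_scaleR L_scale nc_fin_intros)

lemma B_e: assumes "nc_fin p" shows "B e p = L (nc_square p)"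
proof -
  have "L (nc_mul (nc_mul (nc_star p) (nc_one - nc_lin e)) p) = 0"
    using assms by (intro L_J J_mul one_minus_lin_in_J nc_fin_star)
  then show ?thesis
    using assms by (simp add: B_def nc_mul_diff_left nc_mul_diff_right L_diff nc_fin_intros)
qed

text \<open>The roots are only nonnegative, so \<epsilon> + t instead of t is positive on them.
  Modulo the ideal the constant \<epsilon> equals \<epsilon> (e . z), and then \<epsilon> tends to
  0.\<close>

lemma B_nonneg:
  assumes a: "a \<in> hyp_cone h e" and p: "nc_fin p"
  shows "0 \<le> B a p"
proof (rule ccontr)
  assume neg: "\<not> 0 \<le> B a p"
  define q where "q = L (nc_square p)"
  have "0 \<le> q" using L_square_nonneg[OF p] by (simp add: q_def)
  have "0 \<le> B (a + \<epsilon> *\<^sub>R e) p" if "0 < \<epsilon>" for \<epsilon>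
  proof -
    have "nc_polyeval [:\<epsilon>, 1:] (nc_lin a) \<in> sos_cone h e"
      using a that by (intro sos_cone_polyeval) (auto simp: hyp_cone_iff add_pos_nonneg)
    moreover have "nc_polyeval [:\<epsilon>, 1:] (nc_lin a) = nc_smult (complex_of_real \<epsilon>) nc_one + nc_lin a"
      by (simp only: nc_polyeval_pCons nc_polyeval_0 nc_mul_zero_right of_real_1 nc_smult_one add_0_right nc_mul_one_right)
    moreover have "nc_smult (complex_of_real \<epsilon>) nc_one + nc_lin a
        = nc_smult (complex_of_real \<epsilon>) (nc_one - nc_lin e) + nc_lin (a + \<epsilon> *\<^sub>R e)"
      by (simp add: nc_lin_add nc_lin_scaleR nc_smult_diff_right)
    ultimately have "0 \<le> L (nc_mul (nc_mul (nc_star p)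
        (nc_smult (complex_of_real \<epsilon>) (nc_one - nc_lin e) + nc_lin (a + \<epsilon> *\<^sub>R e))) p)"
      using p by (intro L_nonneg sos_cone_conj) simp_all
    also have "\<dots> = L (nc_mul (nc_mul (nc_star p) (nc_smult (complex_of_real \<epsilon>) (nc_one - nc_lin e))) p)
        + B (a + \<epsilon> *\<^sub>R e) p"
      using p by (simp only: B_def nc_mul_add_left nc_mul_add_right L_add nc_fin_intros)
    also have "L (nc_mul (nc_mul (nc_star p) (nc_smult (complex_of_real \<epsilon>) (nc_one - nc_lin e))) p) = 0"
      using p by (intro L_J J_mul J_smult one_minus_lin_in_J nc_fin_star)
    finally show ?thesis by simp
  qed
  then have *: "0 \<le> B a p + \<epsilon> * q" if "0 < \<epsilon>" for \<epsilon>
    using that p by (simp add: B_add B_scale B_e q_def)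
  \<comment> \<open>An explicit \<epsilon> replaces the limit; the summand 1 covers the case
    \<open>q = 0\<close>.\<close>
  have "- B a p / (q + 1) * q < - B a p"
    using neg \<open>0 \<le> q\<close> by (simp add: field_simps)
  moreover have "0 < - B a p / (q + 1)" using neg \<open>0 \<le> q\<close> by (intro divide_pos_pos) auto
  ultimately show False using *[of "- B a p / (q + 1)"] by simp
qed

text \<open>Both signs of a coordinate direction enter the cone after adding a multiple of
  \<open>e\<close>, so its form is squeezed between multiples of the Gram form
  \<open>B e\<close>.\<close>

lemma B_bounded:
  obtains C where "0 \<le> C" "\<And>i p. nc_fin p \<Longrightarrow> \<bar>B (axis i 1) p\<bar> \<le> C * L (nc_square p)"
proof -
  have "\<exists>C\<ge>0. \<forall>p. nc_fin p \<longrightarrow> \<bar>B (axis i 1) p\<bar> \<le> C * L (nc_square p)" for i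
  proof -
    obtain C1 C2 where "\<forall>c\<ge>C1. axis i 1 + c *\<^sub>R e \<in> hyp_cone h e"
      "\<forall>c\<ge>C2. (- 1) *\<^sub>R axis i 1 + c *\<^sub>R e \<in> hyp_cone h e"
      using hyp_cone_absorbing by metis
    then have C: "axis i 1 + max 0 (max C1 C2) *\<^sub>R e \<in> hyp_cone h e"
      "(- 1) *\<^sub>R axis i 1 + max 0 (max C1 C2) *\<^sub>R e \<in> hyp_cone h e" by auto
    have "\<bar>B (axis i 1) p\<bar> \<le> max 0 (max C1 C2) * L (nc_square p)" if "nc_fin p" for p
      using B_nonneg[OF C(1) that] B_nonneg[OF C(2) that] that
      unfolding B_add[OF that] B_scale[OF that] B_e[OF that] by linarith
    then show ?thesis by (intro exI[of _ "max 0 (max C1 C2)"]) simp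
  qed
  then obtain C where C: "\<And>i. 0 \<le> C i" "\<And>i p. nc_fin p \<Longrightarrow> \<bar>B (axis i 1) p\<bar> \<le> C i * L (nc_square p)"
    by metis
  show ?thesis
  proof (rule that)
    show "0 \<le> (\<Sum>i\<in>UNIV. C i)" using C(1) by (intro sum_nonneg)
    fix i :: 'n and p :: "'n ncpoly" assume p: "nc_fin p"
    have "C i \<le> (\<Sum>i\<in>UNIV. C i)" using C(1) by (intro member_le_sum) auto
    then show "\<bar>B (axis i 1) p\<bar> \<le> (\<Sum>i\<in>UNIV. C i) * L (nc_square p)"
      using C(2)[OF p, of i] L_square_nonneg[OF p] by (meson mult_right_mono order_trans)
  qed
qed

lemma B_sum:
  assumes "nc_fin p"
  shows "B (\<Sum>i\<in>I. f i) p = (\<Sum>i\<in>I. B (f i) p)"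
proof -
  have "B 0 p = 0" using B_scale[OF assms, of 0 0] by simp
  then show ?thesis
    by (induction I rule: infinite_finite_induct) (simp_all add: B_add[OF assms])
qed

text \<open>\<open>poly_shift 1\<close> drops the constant coefficient and divides by t, so this is
  q_a(a . z) with h_{a,e}(t) = h(a) + t q_a(t).\<close>

definition quot :: "real^'n \<Rightarrow> 'n ncpoly" where
  "quot a = nc_polyeval (poly_shift 1 (hae h e a)) (nc_lin a)"

lemma hae_eq_pCons: "hae h e a = pCons (mpoly_eval h a) (poly_shift 1 (hae h e a))"
proof (rule poly_eqI)
  fix k
  have "coeff (hae h e a) 0 = mpoly_eval h a"
    using hae_poly[of h e a 0] by (simp add: poly_0_coeff_0)
  then show "coeff (hae h e a) k = coeff (pCons (mpoly_eval h a) (poly_shift 1 (hae h e a))) k"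
    by (cases k) (simp_all add: coeff_poly_shift)
qed

lemma quot_fin: "nc_fin (quot a)"
  by (simp add: quot_def nc_fin_polyeval)

lemma degree_poly_shift_hae: "degree (poly_shift 1 (hae h e a)) \<le> d - 1"
  by (rule degree_le) (auto simp: coeff_poly_shift coeff_eq_0 degree_hae)

lemma quot_eq: "0 < d \<Longrightarrow> quot a = (\<Sum>k<d. nc_smult (complex_of_real (coeff (hae h e a) (Suc k))) (nc_pow (nc_lin a) k))"
  using nc_polyeval_upto[OF degree_poly_shift_hae, of a "nc_lin a"]
  by (simp add: quot_def coeff_poly_shift lessThan_Suc_atMost[symmetric])

lemma nc_deg_le_quot: assumes "0 < d" shows "nc_deg_le d (quot a)"
  unfolding quot_eq[OF assms]
proof (intro nc_deg_le_sum nc_deg_le_smult)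
  fix k assume "k \<in> {..<d}"
  then show "nc_deg_le d (nc_pow (nc_lin a) k)"
    using nc_deg_le_pow_lin[of k a] by (auto simp: nc_deg_le_def)
qed

text \<open>At a zero b of \<open>h\<close> the generator h_{b,e}(b . z) of the ideal equals (b . z)
  q_b(b . z).\<close>

lemma B_quot: assumes "mpoly_eval h b = 0" shows "B b (quot b) = 0"
proof -
  have "nc_polyeval (hae h e b) (nc_lin b) = nc_mul (nc_lin b) (quot b)"
    by (subst hae_eq_pCons) (simp only: nc_polyeval_pCons assms quot_def of_real_0 nc_smult_zero_left add_0)
  then have "nc_mul (nc_lin b) (quot b) \<in> J h e" using polyeval_hae_in_J[of h e b] by simp
  then have "nc_mul (nc_mul (nc_star (quot b)) (nc_mul (nc_lin b) (quot b))) nc_one \<in> J h e"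
    by (intro J_mul nc_fin_star quot_fin nc_fin_one)
  then show ?thesis by (simp add: B_def L_J nc_mul_assoc)
qed

text \<open>The factor \<open>w\<close> collects the letters already expanded; each further power of
  \<open>nc_lin b\<close> contributes one coordinate of \<open>b\<close>.\<close>

lemma total_degree_le_L_pow:
  "nc_fin w \<Longrightarrow> total_degree_le k (\<lambda>b. L (nc_mul w (nc_pow (nc_lin b) k)))"
proof (induction k arbitrary: w)
  case 0
  show ?case by (simp add: total_degree_le_const)
next
  case (Suc k)
  have "L (nc_mul w (nc_pow (nc_lin b) (Suc k)))
      = (\<Sum>i\<in>UNIV. b $ i * L (nc_mul (nc_mul w (nc_var i)) (nc_pow (nc_lin b) k)))" for b
  proof -
    have "nc_mul w (nc_pow (nc_lin b) (Suc k))
        = (\<Sum>i\<in>UNIV. nc_smult (complex_of_real (b $ i)) (nc_mul (nc_mul w (nc_var i)) (nc_pow (nc_lin b) k)))"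
      by (simp only: nc_pow.simps nc_lin_def[of b, symmetric])
        (simp only: nc_lin_def[of b] nc_mul_sum_left nc_mul_sum_right nc_mul_smult_left nc_mul_smult_right nc_mul_assoc)
    then show ?thesis
      using Suc.prems by (simp only:) (subst L_sum; simp add: L_scale nc_fin_intros)
  qed
  moreover have "total_degree_le (1 + k) (\<lambda>b. \<Sum>i\<in>UNIV. b $ i * L (nc_mul (nc_mul w (nc_var i)) (nc_pow (nc_lin b) k)))"
    using Suc.prems
    by (intro total_degree_le_sum total_degree_le_mult total_degree_le_linear bounded_linear_vec_nth Suc.IH nc_fin_mul nc_fin_var)
  ultimately show ?case by simp
qed

text \<open>The degrees d - (k + 1) of the coefficient and k of the power add up to d - 1 for every
  k.\<close>

lemma total_degree_le_L_quot:
  assumes "0 < d"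
  shows "total_degree_le (d - 1) (\<lambda>b. L (quot b))"
proof -
  have "L (quot b) = (\<Sum>k<d. coeff (hae h e b) (Suc k) * L (nc_mul nc_one (nc_pow (nc_lin b) k)))" for b
    unfolding quot_eq[OF assms] by (subst L_sum) (simp_all add: L_scale nc_fin_intros)
  moreover have "total_degree_le (d - 1) (\<lambda>b. \<Sum>k<d. coeff (hae h e b) (Suc k) * L (nc_mul nc_one (nc_pow (nc_lin b) k)))"
  proof (rule total_degree_le_sum)
    fix k assume k: "k \<in> {..<d}"
    have "total_degree_le ((d - Suc k) + k) (\<lambda>b. coeff (hae h e b) (Suc k) * L (nc_mul nc_one (nc_pow (nc_lin b) k)))"
      using k by (intro total_degree_le_mult total_degree_le_coeff_hae total_degree_le_L_pow) auto
    then show "total_degree_le (d - 1) (\<lambda>b. coeff (hae h e b) (Suc k) * L (nc_mul nc_one (nc_pow (nc_lin b) k)))"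
      using k by simp
  qed
  ultimately show ?thesis by simp
qed

text \<open>Modulo the ideal e . z equals 1, so division by t - 1 leaves the remainder p(1).\<close>

lemma L_polyeval_lin_e: "L (nc_polyeval p (nc_lin e)) = poly p 1"
proof -
  have "[:- 1, 1:] dvd p - [:poly p 1:]" by (simp add: poly_eq_0_iff_dvd[symmetric])
  then obtain g where "p - [:poly p 1:] = [:- 1, 1:] * g" by (elim dvdE)
  then have p: "p = [:- 1, 1:] * g + [:poly p 1:]" by (simp add: diff_eq_eq)
  have x: "nc_polyeval [:- 1, 1:] (nc_lin e) = - (nc_one - nc_lin e)"
    by (simp only: nc_polyeval_pCons nc_polyeval_0 nc_mul_zero_right of_real_1 of_real_minus nc_smult_one
        add_0_right nc_mul_one_right nc_smult_minus_one) simp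
  have const: "nc_polyeval [:c:] y = nc_smult (complex_of_real c) nc_one" for c and y :: "'n ncpoly"
    by (simp only: nc_polyeval_pCons nc_polyeval_0 nc_mul_zero_right add_0_right)
  have "nc_polyeval p (nc_lin e)
      = nc_mul (- (nc_one - nc_lin e)) (nc_polyeval g (nc_lin e)) + nc_smult (complex_of_real (poly p 1)) nc_one"
    by (subst p) (simp only: nc_polyeval_add nc_polyeval_mult x const)
  moreover have "nc_mul (- (nc_one - nc_lin e)) (nc_polyeval g (nc_lin e)) \<in> J h e"
    by (intro J_mul_right J_minus one_minus_lin_in_J nc_fin_polyeval nc_fin_lin)
  moreover from this have "nc_fin (nc_mul (- (nc_one - nc_lin e)) (nc_polyeval g (nc_lin e)))" by (rule J_fin)
  ultimately show ?thesis by (simp add: L_add L_J L_scale L_one nc_fin_smult)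
qed

text \<open>Since h(0) = 0 in positive degree, h_{e,e}(t) = h(e) + t q_e(t) at t = 1 gives q_e(1) =
  - h(e).\<close>

lemma L_quot_e: assumes "0 < d" shows "L (quot e) \<noteq> 0"
proof -
  have "mpoly_eval h 0 = 0"
    unfolding mpoly_eval_def
  proof (intro sum.neutral ballI)
    fix m assume "m \<in> Poly_Mapping.keys h"
    then have "(\<Sum>i\<in>UNIV. Poly_Mapping.lookup m i) \<noteq> 0" using keys_degree assms by simp
    then obtain i where "Poly_Mapping.lookup m i \<noteq> 0" by (metis sum.neutral)
    then have "(\<Prod>i\<in>UNIV. ((0 :: real^'n) $ i) ^ Poly_Mapping.lookup m i) = 0"
      by (intro prod_zero) auto
    then show "Poly_Mapping.lookup h m * (\<Prod>i\<in>UNIV. ((0 :: real^'n) $ i) ^ Poly_Mapping.lookup m i) = 0" by simp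
  qed
  moreover have "poly (hae h e e) 1 = mpoly_eval h e + poly (poly_shift 1 (hae h e e)) 1"
    by (subst hae_eq_pCons) simp
  ultimately have "mpoly_eval h e + L (quot e) = 0"
    by (simp add: hae_poly quot_def L_polyeval_lin_e)
  then show ?thesis using hyperbolic by (auto simp: hyperbolic_def)
qed

text \<open>Moving \<open>a\<close> slightly towards \<open>e\<close> makes its form dominate a multiple of the Gram form but keeps a
  negative root; both properties persist on the neighbourhood \<open>U\<close>.\<close>

lemma in_hyp_cone_if_form_nonneg:
  assumes irr: "irreducible h" and form: "\<And>p. nc_fin p \<Longrightarrow> nc_deg_le d p \<Longrightarrow> 0 \<le> B a p"
  shows "a \<in> hyp_cone h e"
proof (rule ccontr)
  assume "a \<notin> hyp_cone h e"
  then obtain \<mu> where \<mu>: "poly (hae h e a) \<mu> = 0" "\<mu> < 0" by (auto simp: hyp_cone_iff not_le)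
  have d: "0 < d"
  proof (rule ccontr)
    assume "\<not> 0 < d"
    then have "degree (hae h e a) = 0" using degree_hae by simp
    then obtain c where "hae h e a = [:c:]" by (rule degree_eq_zeroE)
    then show False using \<mu> hae_nonzero[of a] by auto
  qed
  \<comment> \<open>Half the modulus of the root, so that the shifted point still has the negative
    root \<mu> / 2.\<close>
  define \<eta> where "\<eta> = - \<mu> / 2"
  have \<eta>: "0 < \<eta>" using \<mu> by (simp add: \<eta>_def)
  define a1 where "a1 = a + \<eta> *\<^sub>R e"
  have "poly (hae h e a1) (\<mu> + \<eta>) = 0" using \<mu> by (simp add: a1_def poly_hae_shift)
  moreover have "\<mu> + \<eta> < 0" using \<mu> by (simp add: \<eta>_def)
  ultimately have a1: "a1 \<notin> hyp_cone h e" by (auto simp: hyp_cone_iff not_le)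
  obtain C where C: "0 \<le> C" "\<And>i p. nc_fin p \<Longrightarrow> \<bar>B (axis i 1) p\<bar> \<le> C * L (nc_square p)"
    using B_bounded by blast
  \<comment> \<open>The first condition provides a negative root; the second keeps the perturbation
    of the form below \<eta> times the Gram form, the margin gained at \<open>a1\<close>.\<close>
  define U where "U = - hyp_cone h e \<inter> {b. (\<Sum>i\<in>UNIV. \<bar>b $ i - a1 $ i\<bar>) * C < \<eta>}"
  have "open U"
    unfolding U_def using closed_hyp_cone
    by (intro open_Int open_Compl open_Collect_less continuous_intros) auto
  moreover have "a1 \<in> U" using a1 \<eta> by (simp add: U_def)
  then have "U \<noteq> {}" by blast
  moreover have "\<exists>r. poly (hae h e b) r = 0 \<and> L (quot (b - r *\<^sub>R e)) = 0" if b: "b \<in> U" for b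
  proof -
    obtain r where r: "poly (hae h e b) r = 0" "r < 0"
      using b by (auto simp: U_def hyp_cone_iff not_le)
    let ?b = "b - r *\<^sub>R e"
    have "mpoly_eval h ?b = 0" using r(1) by (simp add: hae_poly)
    then have zero: "B ?b (quot ?b) = 0" by (rule B_quot)
    define p where "p = quot ?b"
    define q where "q = L (nc_square p)"
    have p: "nc_fin p" unfolding p_def by (rule quot_fin)
    have "0 \<le> q" using L_square_nonneg[OF p] by (simp add: q_def)
    define \<delta> where "\<delta> = (\<Sum>i\<in>UNIV. \<bar>b $ i - a1 $ i\<bar>) * C"
    have "\<delta> < \<eta>" using b by (simp add: U_def \<delta>_def)
    \<comment> \<open>The form at \<open>?b\<close> splits into the nonnegative form at
      \<open>a\<close>, the margin \<eta>, the perturbation, and a further nonnegative multiple of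
      the Gram form because \<open>r < 0\<close>. As it vanishes on \<open>p\<close>, the Gram form
      must vanish there too.\<close>
    have "?b = a + \<eta> *\<^sub>R e + (\<Sum>i\<in>UNIV. (b $ i - a1 $ i) *\<^sub>R axis i 1) + (- r) *\<^sub>R e"
    proof -
      have "(\<Sum>i\<in>UNIV. (b $ i - a1 $ i) *\<^sub>R axis i 1) = b - a1"
        using basis_expansion[of "b - a1"] by (simp add: scalar_mult_eq_scaleR)
      then show ?thesis by (simp add: a1_def)
    qed
    from arg_cong[OF this, of "\<lambda>b. B b p"] have "0 = B a p + \<eta> * q + (\<Sum>i\<in>UNIV. (b $ i - a1 $ i) * B (axis i 1) p) + (- r) * q"
      by (simp only: B_add[OF p] B_scale[OF p] B_sum[OF p] B_e[OF p] q_def zero[folded p_def])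
    moreover have "0 \<le> B a p" using form[OF p] nc_deg_le_quot[OF d] unfolding p_def by blast
    moreover have "- (\<delta> * q) \<le> (\<Sum>i\<in>UNIV. (b $ i - a1 $ i) * B (axis i 1) p)"
    proof -
      have "\<bar>\<Sum>i\<in>UNIV. (b $ i - a1 $ i) * B (axis i 1) p\<bar> \<le> (\<Sum>i\<in>UNIV. \<bar>(b $ i - a1 $ i) * B (axis i 1) p\<bar>)"
        by (rule sum_abs)
      also have "\<dots> \<le> (\<Sum>i\<in>UNIV. \<bar>b $ i - a1 $ i\<bar> * (C * q))"
        unfolding abs_mult q_def by (intro sum_mono mult_left_mono C(2) p) simp
      also have "\<dots> = \<delta> * q" by (simp add: \<delta>_def sum_distrib_right mult.assoc)
      finally show ?thesis by linarith
    qed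
    moreover have "0 \<le> (- r) * q" using r \<open>0 \<le> q\<close> by (intro mult_nonneg_nonneg) auto
    ultimately have "(\<eta> - \<delta>) * q \<le> 0" unfolding left_diff_distrib by linarith
    then have "q \<le> 0" using \<open>\<delta> < \<eta>\<close> by (simp add: mult_le_0_iff)
    then have "L (nc_square p) = 0" using \<open>0 \<le> q\<close> unfolding q_def by (rule antisym)
    then have "L p = 0" by (rule L_square_eq_0[OF p])
    then show ?thesis using r unfolding p_def by blast
  qed
  ultimately show False
    using no_common_roots[OF irr total_degree_le_L_quot[OF d] L_quot_e[OF d] d] by blast
qed

text \<open>The complex linear functional with real part \<open>L\<close>; the matrix entries have
  to be complex, while the cone yields only a real functional.\<close>

definition \<phi> :: "'n ncpoly \<Rightarrow> complex" where
  "\<phi> x = Complex (L x) (- L (nc_smult \<i> x))"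

lemma \<phi>_add: "nc_fin x \<Longrightarrow> nc_fin y \<Longrightarrow> \<phi> (x + y) = \<phi> x + \<phi> y"
  by (simp add: \<phi>_def L_add nc_smult_add_right nc_fin_smult complex_eq_iff)

lemma \<phi>_smult: assumes x: "nc_fin x" shows "\<phi> (nc_smult c x) = c * \<phi> x"
proof -
  have *: "L (nc_smult c x) = Re c * L x + Im c * L (nc_smult \<i> x)" if "nc_fin x" for c x
  proof -
    have "nc_smult c x = nc_smult (complex_of_real (Re c)) x + nc_smult (complex_of_real (Im c)) (nc_smult \<i> x)"
      unfolding nc_smult_smult nc_smult_add_left[symmetric] by (rule arg_cong[where f = "\<lambda>c. nc_smult c x"]) (simp add: complex_eq_iff)
    then show ?thesis using that by (simp only: L_add L_scale nc_fin_smult)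
  qed
  show ?thesis
    using *[OF x, of c] *[OF x, of "\<i> * c"] by (simp add: \<phi>_def complex_eq_iff)
qed

lemma \<phi>_sum: "finite I \<Longrightarrow> (\<And>i. i \<in> I \<Longrightarrow> nc_fin (f i)) \<Longrightarrow> \<phi> (\<Sum>i\<in>I. f i) = (\<Sum>i\<in>I. \<phi> (f i))"
proof (induction I rule: finite_induct)
  case empty
  have "\<phi> 0 = 0" using \<phi>_smult[of 0 0] by simp
  then show ?case by (simp only: sum.empty)
next
  case (insert i I)
  then show ?case by (simp add: \<phi>_add nc_fin_sum del: plus_fun_apply)
qed

lemma \<phi>_star: assumes x: "nc_fin x" shows "\<phi> (nc_star x) = cnj (\<phi> x)"
proof -
  have "nc_smult \<i> (nc_star x) = nc_star (nc_smult (- \<i>) x)" by simp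
  then have "L (nc_smult \<i> (nc_star x)) = L (nc_smult (- \<i>) x)"
    using x by (simp only: L_star nc_fin_smult)
  also have "nc_smult (- \<i>) x = - nc_smult \<i> x"
    by (rule ext) (simp add: nc_smult_def)
  also have "L \<dots> = - L (nc_smult \<i> x)" using x by (simp add: L_minus nc_fin_smult)
  finally show ?thesis using x by (simp add: \<phi>_def complex_eq_iff L_star)
qed

lemma \<phi>_hermitian: assumes "nc_fin x" "nc_star x = x" shows "\<phi> x = complex_of_real (L x)"
  using \<phi>_star[OF assms(1)] assms(2) by (simp add: \<phi>_def complex_eq_iff)

definition pencil :: "'n list list \<Rightarrow> 'n \<Rightarrow> nat \<Rightarrow> nat \<Rightarrow> complex" where
  "pencil ws i r c = \<phi> (nc_mul (nc_mul (nc_star (nc_word (ws ! r))) (nc_var i)) (nc_word (ws ! c)))"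

lemma pencil_hermitian: "pencil ws i r c = cnj (pencil ws i c r)"
  unfolding pencil_def by (simp add: \<phi>_star[symmetric] nc_fin_intros nc_star_mul nc_mul_assoc)

text \<open>Coefficient vectors correspond to elements spanned by the words in \<open>ws\<close>, so
  semidefiniteness of the matrix at \<open>a\<close> is nonnegativity of \<open>B a\<close> on that
  span.\<close>

lemma pencil_form:
  fixes v :: "nat \<Rightarrow> complex" and ws :: "'n list list" and m :: nat
  defines "p \<equiv> \<Sum>j<m. nc_smult (v j) (nc_word (ws ! j))"
  shows "(\<Sum>r<m. \<Sum>c<m. cnj (v r) * (\<Sum>i\<in>UNIV. complex_of_real (a $ i) * pencil ws i r c) * v c) = complex_of_real (B a p)"
proof -
  let ?W = "\<lambda>r i c. nc_mul (nc_mul (nc_star (nc_word (ws ! r))) (nc_var i)) (nc_word (ws ! c))"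
  have p: "nc_fin p" by (simp add: p_def nc_fin_intros)
  have "nc_mul (nc_mul (nc_star p) (nc_lin a)) p
      = (\<Sum>c<m. \<Sum>i\<in>UNIV. \<Sum>r<m. nc_smult (cnj (v r) * complex_of_real (a $ i) * v c) (?W r i c))"
    unfolding p_def nc_lin_def nc_star_sum nc_star_smult nc_mul_sum_left nc_mul_sum_right
      nc_mul_smult_left nc_mul_smult_right nc_smult_sum_right nc_smult_smult
    by (simp only: mult_ac)
  then have "\<phi> (nc_mul (nc_mul (nc_star p) (nc_lin a)) p)
      = (\<Sum>c<m. \<Sum>i\<in>UNIV. \<Sum>r<m. cnj (v r) * complex_of_real (a $ i) * v c * pencil ws i r c)"
    by (simp only:) (simp add: \<phi>_sum \<phi>_smult nc_fin_intros pencil_def)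
  also have "\<dots> = (\<Sum>r<m. \<Sum>c<m. \<Sum>i\<in>UNIV. cnj (v r) * complex_of_real (a $ i) * v c * pencil ws i r c)"
    by (subst sum.swap[of _ "{..<m}" "{..<m}"]) (rule sum.cong[OF refl], rule sum.swap)
  also have "\<dots> = (\<Sum>r<m. \<Sum>c<m. cnj (v r) * (\<Sum>i\<in>UNIV. complex_of_real (a $ i) * pencil ws i r c) * v c)"
    by (simp add: sum_distrib_left sum_distrib_right mult_ac)
  finally show ?thesis
    using \<phi>_hermitian[of "nc_mul (nc_mul (nc_star p) (nc_lin a)) p"] p
    by (simp add: B_def nc_fin_intros nc_star_mul nc_mul_assoc)
qed

lemma spectrahedral_hyp_cone:
  assumes irr: "irreducible h"
  shows "spectrahedral (hyp_cone h e)"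
proof -
  have "finite {w :: 'n list. length w \<le> d}"
    using finite_lists_length_le[of "UNIV :: 'n set" d] by simp
  then obtain ws :: "'n list list" where ws: "set ws = {w. length w \<le> d}" "distinct ws"
    using finite_distinct_list by blast
  define m where "m = length ws"
  let ?A = "\<lambda>a r c. \<Sum>i\<in>UNIV. complex_of_real (a $ i) * pencil ws i r c"
  have herm: "hermitian_mat m (?A a)" for a
  proof -
    have "?A a r c = cnj (?A a c r)" for r c
      unfolding cnj_sum complex_cnj_mult complex_cnj_complex_of_real
      by (intro sum.cong refl arg_cong2[where f = "(*)"] pencil_hermitian)
    then show ?thesis unfolding hermitian_mat_def by blast
  qed
  have "a \<in> hyp_cone h e \<longleftrightarrow> psd_mat m (?A a)" for a
  proof
    assume a: "a \<in> hyp_cone h e"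
    show "psd_mat m (?A a)"
      unfolding psd_mat_def Let_def pencil_form
    proof (intro conjI allI)
      show "hermitian_mat m (?A a)" by (rule herm)
      fix v :: "nat \<Rightarrow> complex"
      let ?p = "\<Sum>j<m. nc_smult (v j) (nc_word (ws ! j))"
      have "nc_fin ?p" by (intro nc_fin_sum nc_fin_smult nc_fin_word)
      then show "0 \<le> Re (complex_of_real (B a ?p))" using B_nonneg[OF a] by simp
    qed simp
  next
    assume psd: "psd_mat m (?A a)"
    show "a \<in> hyp_cone h e"
    proof (rule in_hyp_cone_if_form_nonneg[OF irr])
      fix p :: "'n ncpoly" assume "nc_fin p" "nc_deg_le d p"
      \<comment> \<open>The words in \<open>ws\<close> span all elements of degree at most
        \<open>d\<close>, so the coefficients of \<open>p\<close> serve as the test vector.\<close>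
      define v where "v j = p (ws ! j)" for j
      have "p = (\<Sum>w\<in>set ws. nc_smult (p w) (nc_word w))"
      proof (rule nc_expand_words)
        show "w \<in> set ws" if "p w \<noteq> 0" for w
          using that \<open>nc_deg_le d p\<close> unfolding ws(1) nc_deg_le_def by (auto simp: not_less[symmetric])
      qed simp
      also have "\<dots> = (\<Sum>j<m. nc_smult (v j) (nc_word (ws ! j)))"
        unfolding v_def m_def
        by (rule sum.reindex_bij_betw[symmetric, OF bij_betw_nth[OF ws(2)]]) simp_all
      finally have p: "p = (\<Sum>j<m. nc_smult (v j) (nc_word (ws ! j)))" .
      have "let q = (\<Sum>i<m. \<Sum>j<m. cnj (v i) * ?A a i j * v j) in q \<in> \<real> \<and> 0 \<le> Re q"
        using psd unfolding psd_mat_def by blast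
      then show "0 \<le> B a p" unfolding Let_def pencil_form p[symmetric] by simp
    qed
  qed
  moreover have "\<forall>i. hermitian_mat m (pencil ws i)"
    unfolding hermitian_mat_def using pencil_hermitian by blast
  ultimately show ?thesis unfolding spectrahedral_def by blast
qed

end

theorem theorem3p1:
  fixes h :: "'n::finite mpoly" and e :: "real^'n"
  assumes "irreducible h"
    and "homogeneous h"
    and "hyperbolic h e"
    and "\<not> minus_one_SOS h e"
  shows "spectrahedral (hyp_cone h e)"
proof -
  interpret hyperbolic_form h e using assms by unfold_locales
  obtain L :: "'n ncpoly \<Rightarrow> real" where
    "\<And>x y. nc_fin x \<Longrightarrow> nc_fin y \<Longrightarrow> L (x + y) = L x + L y"
    "\<And>r x. nc_fin x \<Longrightarrow> L (nc_smult (complex_of_real r) x) = r * L x"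
    "\<And>x. x \<in> sos_cone h e \<Longrightarrow> 0 \<le> L x" "L nc_one = 1"
    using state_exists[OF assms(4)] by blast
  then interpret hyperbolic_state h e L by unfold_locales
  show ?thesis using assms(1) by (rule spectrahedral_hyp_cone)
qed

end
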